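(* Let $N$ be an infinitely generated free two-step nilpotent group (i.e. a free nilpotent group of class two of arbitrary infinite rank). Then the automorphism group $\operatorname{Aut}(N)$ is complete.
   Context: A free two-step nilpotent group is a relatively free group of the variety of nilpotent groups of class at most two, i.e. $F/[F,[F,F]]$ with $F$ an absolutely free group; here the rank is infinite. A group $G$ is complete if $G$ has trivial centre and every automorphism of $G$ is inner. *)

theory Defs
  imports "HOL-Algebra.Generated_Groups" "HOL-Algebra.Bij"
begin

subsection \<open>Absolutely free groups\<close>

text \<open>
  A letter is a pair of a sign and a generator: \<open>(False, x)\<close> stands for \<open>x\<close> and
  \<open>(True, x)\<close> for its inverse. The elements of the free group on \<open>S\<close> are the reduced words
  over such letters; words are multiplied by concatenation followed by free reduction.
\<close>

type_synonym 'a letter = "bool \<times> 'a"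

definition inv_letter :: "'a letter \<Rightarrow> 'a letter" where
  "inv_letter l = (\<not> fst l, snd l)"

fun push :: "'a letter \<Rightarrow> 'a letter list \<Rightarrow> 'a letter list" where
  "push l [] = [l]"
| "push l (m # w) = (if m = inv_letter l then w else l # m # w)"

definition reduce :: "'a letter list \<Rightarrow> 'a letter list" where
  "reduce w = foldr push w []"

fun reduced :: "'a letter list \<Rightarrow> bool" where
  "reduced (l # m # w) \<longleftrightarrow> m \<noteq> inv_letter l \<and> reduced (m # w)"
| "reduced _ \<longleftrightarrow> True"

definition free_group :: "'a set \<Rightarrow> 'a letter list monoid" where
  "free_group S =
    \<lparr>carrier = {w. set w \<subseteq> UNIV \<times> S \<and> reduced w},
     mult = (\<lambda>v w. reduce (v @ w)),
     one = []\<rparr>"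

definition free_gen :: "'a \<Rightarrow> 'a letter list" where
  "free_gen x = [(False, x)]"

lemma inv_letter_inv_letter [simp]: "inv_letter (inv_letter l) = l"
  by (simp add: inv_letter_def)

lemma inv_letter_neq [simp]: "inv_letter l \<noteq> l" "l \<noteq> inv_letter l"
  by (auto simp: inv_letter_def prod_eq_iff)

lemma reduced_tail: "reduced (l # w) \<Longrightarrow> reduced w"
  by (cases w) auto

lemma reduced_push: "reduced w \<Longrightarrow> reduced (push l w)"
  by (cases w) (auto dest: reduced_tail)

lemma push_reduced: "reduced (l # w) \<Longrightarrow> push l w = l # w"
  by (cases w) auto

lemma push_inv_push: "reduced w \<Longrightarrow> push l (push (inv_letter l) w) = w"
  by (cases w) (auto simp: push_reduced)

lemma reduced_foldr_push: "reduced w \<Longrightarrow> reduced (foldr push v w)"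
  by (induction v) (auto intro: reduced_push)

lemma reduced_reduce: "reduced (reduce w)"
  by (simp add: reduce_def reduced_foldr_push)

lemma reduce_reduced: "reduced w \<Longrightarrow> reduce w = w"
proof (induction w)
  case (Cons l w)
  then show ?case using push_reduced[of l w] reduced_tail[of l w] by (simp add: reduce_def)
qed (simp add: reduce_def)

lemma foldr_push_push:
  assumes "reduced w"
  shows "foldr push (push l v) w = push l (foldr push v w)"
  using assms push_inv_push[OF reduced_foldr_push[OF assms], of l]
  by (cases v) auto

lemma foldr_push_reduce: "reduced w \<Longrightarrow> foldr push (reduce v) w = foldr push v w"
  by (induction v) (auto simp: reduce_def foldr_push_push)

lemma reduce_append: "reduce (v @ w) = foldr push v (reduce w)"
  by (simp add: reduce_def)

lemma reduce_reduce_append [simp]: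
  "reduce (reduce v @ w) = reduce (v @ w)"
  "reduce (v @ reduce w) = reduce (v @ w)"
  by (simp_all add: reduce_append foldr_push_reduce reduced_reduce reduce_reduced)

lemma set_push: "set (push l w) \<subseteq> insert l (set w)"
  by (cases w) auto

lemma set_reduce: "set (reduce w) \<subseteq> set w"
  unfolding reduce_def
proof (induction w)
  case (Cons l w)
  then show ?case using set_push[of l "foldr push w []"] by auto
qed simp

lemma reduce_inverse_word: "reduce (rev (map inv_letter w) @ w) = []"
proof (induction w)
  case (Cons l w)
  have "reduce (rev (map inv_letter (l # w)) @ l # w)
      = foldr push (rev (map inv_letter w)) (push (inv_letter l) (push l (reduce w)))"
    by (simp add: reduce_def)
  also have "push (inv_letter l) (push l (reduce w)) = reduce w"
    using push_inv_push[OF reduced_reduce, of "inv_letter l" w] by simp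
  finally show ?case using Cons by (simp add: reduce_append)
qed (simp add: reduce_def)

lemma group_free_group: "group (free_group S)"
proof (rule groupI)
  fix u v w
  assume "u \<in> carrier (free_group S)" "v \<in> carrier (free_group S)" "w \<in> carrier (free_group S)"
  show "u \<otimes>\<^bsub>free_group S\<^esub> v \<otimes>\<^bsub>free_group S\<^esub> w = u \<otimes>\<^bsub>free_group S\<^esub> (v \<otimes>\<^bsub>free_group S\<^esub> w)"
    by (simp add: free_group_def)
next
  fix w assume w: "w \<in> carrier (free_group S)"
  let ?v = "reduce (rev (map inv_letter w))"
  have "set (rev (map inv_letter w)) \<subseteq> UNIV \<times> S"
    using w by (auto simp: free_group_def inv_letter_def)
  then have "?v \<in> carrier (free_group S)"
    using set_reduce[of "rev (map inv_letter w)"] by (auto simp: free_group_def reduced_reduce)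
  moreover have "?v \<otimes>\<^bsub>free_group S\<^esub> w = \<one>\<^bsub>free_group S\<^esub>"
    using reduce_inverse_word[of w] by (simp add: free_group_def)
  ultimately show "\<exists>v\<in>carrier (free_group S). v \<otimes>\<^bsub>free_group S\<^esub> w = \<one>\<^bsub>free_group S\<^esub>"
    by blast
next
  fix v w assume "v \<in> carrier (free_group S)" "w \<in> carrier (free_group S)"
  then show "v \<otimes>\<^bsub>free_group S\<^esub> w \<in> carrier (free_group S)"
    using set_reduce[of "v @ w"] by (auto simp: free_group_def reduced_reduce)
qed (auto simp: free_group_def reduce_reduced)

lemma free_gen_closed: "x \<in> S \<Longrightarrow> free_gen x \<in> carrier (free_group S)"
  by (simp add: free_group_def free_gen_def)

text \<open>The universal property of the free group on \<open>S\<close>.\<close>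

lemma free_group_extend:
  assumes "group G" and f: "f \<in> S \<rightarrow> carrier G"
  shows "\<exists>h \<in> hom (free_group S) G. \<forall>x\<in>S. h (free_gen x) = f x"
proof -
  interpret group G by fact
  define e where "e = (\<lambda>l. if fst l then inv\<^bsub>G\<^esub> (f (snd l)) else f (snd l))"
  define h where "h = (\<lambda>w. foldr (\<lambda>l g. e l \<otimes>\<^bsub>G\<^esub> g) w \<one>\<^bsub>G\<^esub>)"
  let ?L = "UNIV \<times> S"
  have e: "e l \<in> carrier G" if "l \<in> ?L" for l
    using that f by (auto simp: e_def)
  have e_inv: "e l \<otimes>\<^bsub>G\<^esub> e (inv_letter l) = \<one>\<^bsub>G\<^esub>" if "l \<in> ?L" for l
    using that f by (auto simp: e_def inv_letter_def Pi_iff)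
  have h: "h w \<in> carrier G" if "set w \<subseteq> ?L" for w
    using that by (induction w) (auto simp: h_def intro!: m_closed e)
  have h_push: "h (push l w) = e l \<otimes>\<^bsub>G\<^esub> h w" if "l \<in> ?L" "set w \<subseteq> ?L" for l w
  proof (cases "\<exists>w'. w = inv_letter l # w'")
    case True
    then obtain w' where w': "w = inv_letter l # w'" by blast
    have "inv_letter l \<in> ?L" "set w' \<subseteq> ?L" using that w' by auto
    then have "e l \<otimes>\<^bsub>G\<^esub> (e (inv_letter l) \<otimes>\<^bsub>G\<^esub> h w') = h w'"
      using that e h e_inv by (simp add: m_assoc [symmetric])
    then show ?thesis using w' by (simp add: h_def)
  next
    case False
    then have "push l w = l # w" by (cases w) auto
    then show ?thesis by (simp add: h_def)
  qed
  have h_reduce: "h (foldr push v w) = h v \<otimes>\<^bsub>G\<^esub> h w" if "set v \<subseteq> ?L" "set w \<subseteq> ?L" for v w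
    using that(1)
  proof (induction v)
    case Nil
    then show ?case using h[OF that(2)] by (simp add: h_def)
  next
    case (Cons l v)
    have "set (foldr push v w) \<subseteq> set v \<union> set w"
    proof (induction v)
      case (Cons m v)
      then show ?case using set_push[of m "foldr push v w"] by auto
    qed simp
    then have s: "set (foldr push v w) \<subseteq> ?L" using Cons.prems that(2) by auto
    have l: "l \<in> ?L" and v: "set v \<subseteq> ?L" using Cons.prems by auto
    have "h (foldr push (l # v) w) = e l \<otimes>\<^bsub>G\<^esub> (h v \<otimes>\<^bsub>G\<^esub> h w)"
      using Cons.IH[OF v] h_push[OF l s] by simp
    also have "\<dots> = h (l # v) \<otimes>\<^bsub>G\<^esub> h w"
      using m_assoc[OF e[OF l] h[OF v] h[OF that(2)]] by (simp add: h_def)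
    finally show ?case .
  qed
  have "h \<in> hom (free_group S) G"
    by (rule homI) (auto simp: free_group_def reduce_append reduce_reduced h h_reduce)
  moreover have "\<forall>x\<in>S. h (free_gen x) = f x"
    using f by (auto simp: h_def e_def free_gen_def Pi_iff)
  ultimately show ?thesis by blast
qed

lemma generate_free_gen: "generate (free_group S) (free_gen ` S) = carrier (free_group S)"
proof
  interpret group "free_group S" by (rule group_free_group)
  let ?H = "generate (free_group S) (free_gen ` S)"
  have "free_gen ` S \<subseteq> carrier (free_group S)"
    using free_gen_closed by auto
  then show "?H \<subseteq> carrier (free_group S)"
    by (rule generate_incl)
  have letter: "[l] \<in> ?H" if "snd l \<in> S" for l
  proof (cases "fst l")
    case False
    then have "[l] = free_gen (snd l)" by (simp add: free_gen_def prod_eq_iff)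
    then show ?thesis using that by (auto intro: generate.incl)
  next
    case True
    then have "[l] \<otimes>\<^bsub>free_group S\<^esub> free_gen (snd l) = \<one>\<^bsub>free_group S\<^esub>"
      by (simp add: free_group_def free_gen_def reduce_def inv_letter_def)
    moreover have "[l] \<in> carrier (free_group S)"
      using that by (cases l) (auto simp: free_group_def)
    ultimately have "[l] = inv\<^bsub>free_group S\<^esub> (free_gen (snd l))"
      using that free_gen_closed by (metis inv_equality)
    then show ?thesis using that by (auto intro: generate.inv)
  qed
  show "carrier (free_group S) \<subseteq> ?H"
  proof
    fix w assume "w \<in> carrier (free_group S)"
    then show "w \<in> ?H"
    proof (induction w)
      case Nil
      then show ?case using generate.one[of "free_group S"] by (simp add: free_group_def)
    next
      case (Cons l w)
      then have lw: "reduced (l # w)" "snd l \<in> S" "w \<in> carrier (free_group S)"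
        by (auto simp: free_group_def dest: reduced_tail)
      have "[l] \<otimes>\<^bsub>free_group S\<^esub> w \<in> ?H"
        using Cons.IH[OF lw(3)] letter[OF lw(2)] by (rule generate.eng[rotated])
      moreover have "[l] \<otimes>\<^bsub>free_group S\<^esub> w = l # w"
        using reduce_reduced[OF lw(1)] by (simp add: free_group_def)
      ultimately show ?case by simp
    qed
  qed
qed


subsection \<open>Free two-step nilpotent groups\<close>

definition commutator_subgroup :: "('a, 'b) monoid_scheme \<Rightarrow> 'a set \<Rightarrow> 'a set \<Rightarrow> 'a set" where
  "commutator_subgroup G H K =
    generate G (\<Union>h\<in>H. \<Union>k\<in>K. {h \<otimes>\<^bsub>G\<^esub> k \<otimes>\<^bsub>G\<^esub> inv\<^bsub>G\<^esub> h \<otimes>\<^bsub>G\<^esub> inv\<^bsub>G\<^esub> k})"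

lemma commutator_subgroup_self: "commutator_subgroup G H H = derived G H"
  by (simp add: commutator_subgroup_def derived_def)

definition free_two_step_nilpotent_group :: "'a set \<Rightarrow> 'a letter list set monoid" where
  "free_two_step_nilpotent_group S =
    (let F = free_group S
     in F Mod commutator_subgroup F (carrier F) (commutator_subgroup F (carrier F) (carrier F)))"

lemma (in group) normal_commutator_subgroup:
  assumes "H \<lhd> G" "K \<lhd> G"
  shows "commutator_subgroup G H K \<lhd> G"
proof -
  have sub: "H \<subseteq> carrier G" "K \<subseteq> carrier G"
    using assms by (simp_all add: normal_imp_subgroup subgroup.subset)
  show ?thesis
    unfolding commutator_subgroup_def
  proof (rule normal_generateI)
    show "(\<Union>h\<in>H. \<Union>k\<in>K. {h \<otimes> k \<otimes> inv h \<otimes> inv k}) \<subseteq> carrier G"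
      using sub by (auto simp: subset_iff)
  next
    fix c g assume "c \<in> (\<Union>h\<in>H. \<Union>k\<in>K. {h \<otimes> k \<otimes> inv h \<otimes> inv k})" and g: "g \<in> carrier G"
    then obtain h k where hk: "h \<in> H" "k \<in> K" and c: "c = h \<otimes> k \<otimes> inv h \<otimes> inv k" by blast
    have hkG: "h \<in> carrier G" "k \<in> carrier G" using hk sub by auto
    let ?h = "g \<otimes> h \<otimes> inv g" and ?k = "g \<otimes> k \<otimes> inv g"
    have "?h \<in> H" "?k \<in> K" using assms hk g by (simp_all add: normal.inv_op_closed2)
    moreover have "g \<otimes> c \<otimes> inv g = ?h \<otimes> ?k \<otimes> inv ?h \<otimes> inv ?k"
    proof -
      have "inv g \<otimes> (g \<otimes> x) = x" if "x \<in> carrier G" for x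
        using that g by (simp add: m_assoc [symmetric])
      then show ?thesis using g hkG by (simp add: c m_assoc inv_mult_group)
    qed
    ultimately show "g \<otimes> c \<otimes> inv g \<in> (\<Union>h\<in>H. \<Union>k\<in>K. {h \<otimes> k \<otimes> inv h \<otimes> inv k})" by blast
  qed
qed

lemma (in group) carrier_normal: "carrier G \<lhd> G"
  by (simp add: normal_inv_iff subgroup_self)

lemma group_free_two_step_nilpotent_group: "group (free_two_step_nilpotent_group S)"
proof -
  interpret group "free_group S" by (rule group_free_group)
  show ?thesis
    unfolding free_two_step_nilpotent_group_def Let_def
    by (intro normal.factorgroup_is_group normal_commutator_subgroup carrier_normal)
qed


subsection \<open>Complete groups\<close>

definition centre :: "('a, 'b) monoid_scheme \<Rightarrow> 'a set" where
  "centre G = {z \<in> carrier G. \<forall>x \<in> carrier G. z \<otimes>\<^bsub>G\<^esub> x = x \<otimes>\<^bsub>G\<^esub> z}"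

text \<open>
  The restriction to \<open>carrier G\<close> matches the library's \<open>auto G\<close> and \<open>AutoGroup G\<close>, whose
  elements are extensional functions.
\<close>

definition inner_auto :: "('a, 'b) monoid_scheme \<Rightarrow> ('a \<Rightarrow> 'a) set" where
  "inner_auto G =
    {\<lambda>x \<in> carrier G. g \<otimes>\<^bsub>G\<^esub> x \<otimes>\<^bsub>G\<^esub> inv\<^bsub>G\<^esub> g | g. g \<in> carrier G}"

definition complete_group :: "('a, 'b) monoid_scheme \<Rightarrow> bool" where
  "complete_group G \<longleftrightarrow> group G \<and> centre G = {\<one>\<^bsub>G\<^esub>} \<and> (\<forall>\<phi> \<in> auto G. \<phi> \<in> inner_auto G)"

end

theory Submission
  imports Defs "HOL-Library.Groups_Big_Fun"
begin

text \<open>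
  Let \<open>A\<close> be the abelianisation of \<open>N\<close>. The automorphisms of \<open>N\<close> acting trivially on \<open>A\<close> form an
  abelian group \<open>IA\<close>, isomorphic to \<open>Hom(A, \<Lambda>\<^sup>2 A)\<close>, and it is the largest abelian normal subgroup
  of \<open>Aut N\<close>, hence characteristic. The conjugations form a copy of \<open>A\<close> in \<open>IA\<close>, and an
  automorphism \<open>\<phi>\<close> of \<open>Aut N\<close> preserves it: every conjugation is a power of a conjugate of the
  conjugation by a basis element, whereas the normal closure of a non-inner element of \<open>IA\<close>
  contains homomorphisms of rank one and of rank two. So \<open>\<phi>\<close> induces an automorphism of \<open>A\<close>;
  lifting it to \<open>N\<close> we may assume that \<open>\<phi>\<close> fixes all conjugations, and then \<open>\<phi>\<close> acts trivially
  on \<open>Aut N / IA\<close> and equivariantly on \<open>IA\<close>.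

  An equivariant endomorphism of \<open>Hom(A, \<Lambda>\<^sup>2 A)\<close> is \<open>f \<mapsto> c f + \<iota>(a(f))\<close> with \<open>\<iota>\<close> the inclusion of \<open>A\<close>
  and \<open>a\<close> equivariant (in finite rank \<open>a\<close> could be a trace); in infinite rank a swindle
  gives \<open>a = 0\<close>, and \<open>c = 1\<close> because \<open>\<iota>\<close> is fixed. Finally let \<open>\<theta>\<close> invert the basis elements. It
  inverts \<open>IA\<close> by conjugation and commutes with the permutations of the basis, which forces
  \<open>\<phi> \<theta> = \<theta> \<beta>\<^sup>2\<close> with \<open>\<beta>\<close> in \<open>IA\<close>. After conjugating by \<open>\<beta>\<close> the automorphism \<open>\<phi>\<close> fixes \<open>IA\<close> and \<open>\<theta>\<close>,
  and then all of \<open>Aut N\<close>, because a conjugate of \<open>\<theta>\<close> determines the conjugating element modulo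
  its centraliser, which meets \<open>IA\<close> trivially.
\<close>

subsection \<open>Equivariant endomorphisms of \<open>Hom(A, \<Lambda>\<^sup>2 A)\<close>\<close>

text \<open>The obstacle is that a homomorphism given on an infinite basis is not a finite sum of
  rank one homomorphisms, while an abstract automorphism of \<open>IA\<close> respects only finite
  sums. So knowing the scalar \<open>c\<close> on elementary tensors says nothing directly about a
  general tensor. What helps is an infinite reserve of indices that a tensor does not involve:
  equivariance under transvections starting in the reserve determines the image entry by entry, up
  to an inner part. A general tensor leaves no reserve, hence the cutting into pieces that each
  avoid an infinite block. Once \<open>\<phi>\<close> fixes \<open>IA\<close> and is trivial modulo
  it, sending \<open>g\<close> to the product of its inverse with \<open>\<phi> g\<close> is a
  crossed homomorphism into \<open>IA\<close>, to be shown principal. As \<open>\<theta>\<close> is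
  central modulo \<open>IA\<close> and acts on it as -1, this holds up to a factor of two. The value
  at \<open>\<theta>\<close> can be halved because modulo 2 it is symmetric under permutations of
  the basis, and rows of finite support with this symmetry are even.\<close>

text \<open>
  A homomorphism \<open>f\<close> from the free abelian group on \<open>I\<close> to its exterior square is encoded by
  its coefficients: \<open>s i j k\<close> is the coefficient of \<open>j \<and> k\<close> in \<open>f i\<close>. The index set need not be the
  whole type, so coefficients outside \<open>I\<close> are zero.
\<close>

type_synonym 'i tensor = "'i \<Rightarrow> 'i \<Rightarrow> 'i \<Rightarrow> int"

definition tensors :: "'i set \<Rightarrow> 'i tensor set" where
  "tensors I = {s. (\<forall>i j k. s i j k \<noteq> 0 \<longrightarrow> i \<in> I \<and> j \<in> I \<and> k \<in> I) \<and>
     (\<forall>i j k. s i j k = - s i k j) \<and> (\<forall>i. finite {(j, k). s i j k \<noteq> 0})}"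

text \<open>The conjugate of a tensor by the transvection \<open>u \<mapsto> u + v\<close>.\<close>

definition transvect :: "'i \<Rightarrow> 'i \<Rightarrow> 'i tensor \<Rightarrow> 'i tensor" where
  "transvect u v s = (\<lambda>i j k.
     let r = (\<lambda>j k. s i j k - (if i = u then s v j k else 0))
     in r j k + (if j = v then r u k else 0) + (if k = v then r j u else 0))"

text \<open>Used for involutions only, so that pulling back along \<open>p\<close> and pushing
  forward by it agree.\<close>

definition permute :: "('i \<Rightarrow> 'i) \<Rightarrow> 'i tensor \<Rightarrow> 'i tensor" where
  "permute p s = (\<lambda>i j k. s (p i) (p j) (p k))"

text \<open>The homomorphism \<open>i \<mapsto> a \<and> i\<close>.\<close>

definition inner_tensor :: "'i set \<Rightarrow> ('i \<Rightarrow> int) \<Rightarrow> 'i tensor" where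
  "inner_tensor I a = (\<lambda>i j k. if i \<in> I
     then (if i = k then a j else 0) - (if i = j then a k else 0) else 0)"

text \<open>Coordinate vectors of the free abelian group on \<open>I\<close>, that is, of the
  abelianisation.\<close>

definition fin_vec :: "'i set \<Rightarrow> ('i \<Rightarrow> int) set" where
  "fin_vec I = {a. finite {i. a i \<noteq> 0} \<and> {i. a i \<noteq> 0} \<subseteq> I}"

text \<open>The tensor product of the dual vector of \<open>w\<close> with the form
  \<open>r\<close>.\<close>

definition elem_tensor :: "'i \<Rightarrow> ('i \<Rightarrow> 'i \<Rightarrow> int) \<Rightarrow> 'i tensor" where
  "elem_tensor w r = (\<lambda>i j k. if i = w then r j k else 0)"

definition wedge :: "'i \<Rightarrow> 'i \<Rightarrow> 'i \<Rightarrow> 'i \<Rightarrow> int" where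
  "wedge s t = (\<lambda>j k. (if j = s \<and> k = t then 1 else 0) - (if j = t \<and> k = s then 1 else 0))"

text \<open>The exterior square of the free abelian group: an antisymmetric matrix stands for the
  sum of \<open>r j k\<close> times \<open>j \<and> k\<close> over unordered pairs.\<close>

definition forms :: "'i set \<Rightarrow> ('i \<Rightarrow> 'i \<Rightarrow> int) set" where
  "forms I = {r. finite {(j, k). r j k \<noteq> 0} \<and> (\<forall>j k. r j k = - r k j) \<and>
      (\<forall>j k. r j k \<noteq> 0 \<longrightarrow> j \<in> I \<and> k \<in> I)}"

section \<open>Closure properties of tensors and forms\<close>

lemma tensorsI:
  assumes "\<And>i j k. s i j k \<noteq> 0 \<Longrightarrow> i \<in> I \<and> j \<in> I \<and> k \<in> I"
    and "\<And>i j k. s i j k = - s i k j" and "\<And>i. finite {(j, k). s i j k \<noteq> 0}"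
  shows "s \<in> tensors I"
  using assms unfolding tensors_def by blast

lemma tensors_out:
  assumes "s \<in> tensors I" "i \<notin> I \<or> j \<notin> I \<or> k \<notin> I" shows "s i j k = 0"
  using assms unfolding tensors_def by blast

lemma tensors_in:
  assumes "s \<in> tensors I" "s i j k \<noteq> 0" shows "i \<in> I \<and> j \<in> I \<and> k \<in> I"
  using assms unfolding tensors_def by blast

lemma tensors_anti: "s \<in> tensors I \<Longrightarrow> s i j k = - s i k j"
  unfolding tensors_def by blast

lemma tensors_diag [simp]: "s \<in> tensors I \<Longrightarrow> s i j j = 0"
  using tensors_anti[of s I i j j] by simp

lemma tensors_finite: "s \<in> tensors I \<Longrightarrow> finite {(j, k). s i j k \<noteq> 0}"
  unfolding tensors_def by blast

lemma tensors_finite_support: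
  assumes "s \<in> tensors I"
  shows "finite {j. \<exists>k. s i j k \<noteq> 0}"
proof -
  have "{j. \<exists>k. s i j k \<noteq> 0} = fst ` {(j, k). s i j k \<noteq> 0}" by force
  then show ?thesis using tensors_finite[OF assms] by simp
qed

lemma tensors_mono: "Y \<subseteq> I \<Longrightarrow> tensors Y \<subseteq> tensors I"
  unfolding tensors_def by blast

lemma tensors_add:
  assumes s: "s \<in> tensors I" and t: "t \<in> tensors I"
  shows "(\<lambda>i j k. s i j k + t i j k) \<in> tensors I"
proof (rule tensorsI)
  fix i j k
  show "s i j k + t i j k \<noteq> 0 \<Longrightarrow> i \<in> I \<and> j \<in> I \<and> k \<in> I"
    using tensors_in[OF s, of i j k] tensors_in[OF t, of i j k] by (cases "s i j k = 0") auto
  show "s i j k + t i j k = - (s i k j + t i k j)"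
    using tensors_anti[OF s, of i j k] tensors_anti[OF t, of i j k] by auto
  show "finite {(j, k). s i j k + t i j k \<noteq> 0}"
    by (rule finite_subset[of _ "{(j, k). s i j k \<noteq> 0} \<union> {(j, k). t i j k \<noteq> 0}"])
      (auto simp: tensors_finite[OF s] tensors_finite[OF t])
qed

lemma tensors_scale:
  assumes s: "s \<in> tensors I"
  shows "(\<lambda>i j k. c * s i j k) \<in> tensors I"
proof (rule tensorsI)
  fix i j k
  show "c * s i j k \<noteq> 0 \<Longrightarrow> i \<in> I \<and> j \<in> I \<and> k \<in> I"
    using tensors_in[OF s, of i j k] by auto
  show "c * s i j k = - (c * s i k j)"
    using tensors_anti[OF s, of i j k] by simp
  show "finite {(j, k). c * s i j k \<noteq> 0}"
    by (rule finite_subset[OF _ tensors_finite[OF s, of i]]) auto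
qed

lemma tensors_diff:
  assumes s: "s \<in> tensors I" and t: "t \<in> tensors I"
  shows "(\<lambda>i j k. s i j k - t i j k) \<in> tensors I"
  using tensors_add[OF s tensors_scale[OF t, of "-1"]] by simp

lemma tensors_zero: "(\<lambda>i j k. 0) \<in> tensors I"
  by (rule tensorsI) auto

lemma tensors_restrict:
  assumes s: "s \<in> tensors I"
  shows "(\<lambda>i j k. if i \<in> Y \<and> j \<in> Y \<and> k \<in> Y then s i j k else 0) \<in> tensors I"
proof (rule tensorsI)
  fix i j k
  show "(if i \<in> Y \<and> j \<in> Y \<and> k \<in> Y then s i j k else 0) \<noteq> 0 \<Longrightarrow> i \<in> I \<and> j \<in> I \<and> k \<in> I"
    using tensors_in[OF s, of i j k] by (auto split: if_splits)
  show "(if i \<in> Y \<and> j \<in> Y \<and> k \<in> Y then s i j k else 0) =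
      - (if i \<in> Y \<and> k \<in> Y \<and> j \<in> Y then s i k j else 0)"
    using tensors_anti[OF s, of i j k] by simp
  show "finite {(j, k). (if i \<in> Y \<and> j \<in> Y \<and> k \<in> Y then s i j k else 0) \<noteq> 0}"
    by (rule finite_subset[OF _ tensors_finite[OF s, of i]]) auto
qed

lemma tensors_subsetI:
  assumes s: "s \<in> tensors I" and "\<And>i j k. s i j k \<noteq> 0 \<Longrightarrow> i \<in> Y \<and> j \<in> Y \<and> k \<in> Y"
  shows "s \<in> tensors Y"
  using assms unfolding tensors_def by blast

lemma formsI:
  assumes "finite {(j, k). r j k \<noteq> 0}" "\<And>j k. r j k = - r k j"
    "\<And>j k. r j k \<noteq> 0 \<Longrightarrow> j \<in> I \<and> k \<in> I"
  shows "r \<in> forms I"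
  using assms unfolding forms_def by blast

lemma forms_in: "r \<in> forms I \<Longrightarrow> r j k \<noteq> 0 \<Longrightarrow> j \<in> I \<and> k \<in> I"
  unfolding forms_def by blast

lemma forms_anti: "r \<in> forms I \<Longrightarrow> r j k = - r k j"
  unfolding forms_def by blast

lemma forms_finite: "r \<in> forms I \<Longrightarrow> finite {(j, k). r j k \<noteq> 0}"
  unfolding forms_def by blast

lemma forms_tensor: "s \<in> tensors I \<Longrightarrow> s i \<in> forms I"
  unfolding tensors_def forms_def by blast

lemma forms_elem_tensor: "r \<in> forms I \<Longrightarrow> w \<in> I \<Longrightarrow> elem_tensor w r \<in> tensors I"
proof (rule tensorsI)
  fix i j k
  assume r: "r \<in> forms I" and w: "w \<in> I"
  show "elem_tensor w r i j k \<noteq> 0 \<Longrightarrow> i \<in> I \<and> j \<in> I \<and> k \<in> I"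
    using forms_in[OF r, of j k] w by (simp add: elem_tensor_def split: if_splits)
  show "elem_tensor w r i j k = - elem_tensor w r i k j"
    using forms_anti[OF r, of j k] by (simp add: elem_tensor_def)
  show "finite {(j, k). elem_tensor w r i j k \<noteq> 0}"
    using forms_finite[OF r] by (cases "i = w") (simp_all add: elem_tensor_def)
qed

lemma wedge_nonzero: "wedge s t j k \<noteq> 0 \<Longrightarrow> (j = s \<and> k = t) \<or> (j = t \<and> k = s)"
  by (simp add: wedge_def split: if_splits)

lemma wedge_anti: "wedge s t j k = - wedge s t k j"
  unfolding wedge_def by (smt (verit))

lemma wedge_forms:
  assumes "s \<in> I" "t \<in> I" shows "wedge s t \<in> forms I"
proof (rule formsI)
  show "finite {(j, k). wedge s t j k \<noteq> 0}"
    by (rule finite_subset[of _ "{(s,t),(t,s)}"]) (auto dest!: wedge_nonzero)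
  fix j k
  show "wedge s t j k = - wedge s t k j" by (rule wedge_anti)
  show "wedge s t j k \<noteq> 0 \<Longrightarrow> j \<in> I \<and> k \<in> I"
    using assms wedge_nonzero[of s t j k] by auto
qed

lemma inner_tensor_tensors:
  assumes "a \<in> fin_vec I"
  shows "inner_tensor I a \<in> tensors I"
proof (rule tensorsI)
  fix i
  have "finite ({i} \<times> {j. a j \<noteq> 0} \<union> {j. a j \<noteq> 0} \<times> {i})"
    using assms by (auto simp: fin_vec_def)
  then show "finite {(j, k). inner_tensor I a i j k \<noteq> 0}"
    by (rule finite_subset[rotated]) (auto simp: inner_tensor_def split: if_splits)
  fix j k
  show "inner_tensor I a i j k = - inner_tensor I a i k j" unfolding inner_tensor_def by (smt (verit))
  show "inner_tensor I a i j k \<noteq> 0 \<Longrightarrow> i \<in> I \<and> j \<in> I \<and> k \<in> I"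
    using assms by (auto simp: inner_tensor_def fin_vec_def split: if_splits)
qed

text \<open>Wedges of distinct indices span the exterior square: subtracting the multiple of
  \<open>wedge s t\<close> that cancels a nonzero entry at \<open>(s, t)\<close> also cancels the
  one at \<open>(t, s)\<close> and creates no new entry, so the support shrinks.\<close>

lemma form_induct [consumes 1, case_names zero add]:
  assumes r: "r \<in> forms I"
    and z: "P (\<lambda>j k. 0)"
    and a: "\<And>r c s t. r \<in> forms I \<Longrightarrow> P r \<Longrightarrow> s \<in> I \<Longrightarrow> t \<in> I \<Longrightarrow> s \<noteq> t \<Longrightarrow>
      P (\<lambda>j k. r j k + c * wedge s t j k)"
  shows "P r"
  using r
proof (induction "card {(j, k). r j k \<noteq> 0}" arbitrary: r rule: less_induct)
  case less
  note rI = less.prems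
  note fin = forms_finite[OF rI] and anti = forms_anti[OF rI]
  show ?case
  proof (cases "\<exists>s t. r s t \<noteq> 0")
    case False
    then have "r = (\<lambda>j k. 0)" by auto
    then show ?thesis using z by simp
  next
    case True
    then obtain s t where st: "r s t \<noteq> 0" by blast
    have I: "s \<in> I" "t \<in> I" using st rI unfolding forms_def by blast+
    have ne: "s \<noteq> t" using st anti[of s s] by auto
    let ?r = "\<lambda>j k. r j k - r s t * wedge s t j k"
    have sub: "{(j, k). ?r j k \<noteq> 0} \<subset> {(j, k). r j k \<noteq> 0}"
    proof
      show "{(j, k). ?r j k \<noteq> 0} \<subseteq> {(j, k). r j k \<noteq> 0}"
        using st anti[of t s] wedge_nonzero[of s t] by fastforce
      have "(s, t) \<in> {(j, k). r j k \<noteq> 0}" "(s, t) \<notin> {(j, k). ?r j k \<noteq> 0}"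
        using st ne by (simp_all add: wedge_def)
      then show "{(j, k). ?r j k \<noteq> 0} \<noteq> {(j, k). r j k \<noteq> 0}" by blast
    qed
    have "?r \<in> forms I"
    proof (rule formsI)
      show "finite {(j, k). ?r j k \<noteq> 0}" using sub fin by (meson finite_subset psubset_imp_subset)
      show "?r j k = - ?r k j" for j k using anti[of j k] wedge_anti[of s t j k] by simp
      show "?r j k \<noteq> 0 \<Longrightarrow> j \<in> I \<and> k \<in> I" for j k
        using sub rI unfolding forms_def by blast
    qed
    then have "P ?r" "?r \<in> forms I"
      using less.hyps[of ?r] psubset_card_mono[OF fin sub] by auto
    from a[OF this(2,1) I ne, of "r s t"] show ?thesis by simp
  qed
qed

text \<open>\<open>\<Phi>\<close> models the action on \<open>IA\<close>, read through tensors, of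
  an automorphism that fixes all conjugations. Equivariance is recorded only for transvections and
  involutive permutations, and nothing relates \<open>\<Phi>\<close> to infinite sums.\<close>

locale tensor_map =
  fixes I :: "'i set" and \<Phi> :: "'i tensor \<Rightarrow> 'i tensor"
  assumes infinite: "infinite I"
    and closed: "s \<in> tensors I \<Longrightarrow> \<Phi> s \<in> tensors I"
    and map_add: "s \<in> tensors I \<Longrightarrow> t \<in> tensors I \<Longrightarrow>
      \<Phi> (\<lambda>i j k. s i j k + t i j k) = (\<lambda>i j k. \<Phi> s i j k + \<Phi> t i j k)"
    and transvect: "u \<in> I \<Longrightarrow> v \<in> I \<Longrightarrow> u \<noteq> v \<Longrightarrow> s \<in> tensors I \<Longrightarrow>
      \<Phi> (transvect u v s) = transvect u v (\<Phi> s)"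
    and permute: "(\<And>i. p (p i) = i) \<Longrightarrow> p ` I \<subseteq> I \<Longrightarrow> s \<in> tensors I \<Longrightarrow>
      \<Phi> (permute p s) = permute p (\<Phi> s)"
    and inner: "a \<in> fin_vec I \<Longrightarrow> \<Phi> (inner_tensor I a) = inner_tensor I a"
begin

lemma fresh: "finite F \<Longrightarrow> \<exists>x\<in>I. x \<notin> F"
  using infinite by (meson finite_subset subsetI)

lemma map_zero: "\<Phi> (\<lambda>i j k. 0) = (\<lambda>i j k. 0)"
proof (intro ext)
  fix i j k
  show "\<Phi> (\<lambda>i j k. 0) i j k = 0"
    using fun_cong[OF fun_cong[OF fun_cong[OF map_add[OF tensors_zero tensors_zero]]], of i j k] by simp
qed

lemma map_diff:
  assumes s: "s \<in> tensors I" and t: "t \<in> tensors I"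
  shows "\<Phi> (\<lambda>i j k. s i j k - t i j k) = (\<lambda>i j k. \<Phi> s i j k - \<Phi> t i j k)"
proof (intro ext)
  fix i j k
  show "\<Phi> (\<lambda>i j k. s i j k - t i j k) i j k = \<Phi> s i j k - \<Phi> t i j k"
    using fun_cong[OF fun_cong[OF fun_cong[OF map_add[OF tensors_diff[OF s t] t]]], of i j k] by simp
qed

lemma map_scale:
  assumes s: "s \<in> tensors I"
  shows "\<Phi> (\<lambda>i j k. c * s i j k) = (\<lambda>i j k. c * \<Phi> s i j k)"
proof -
  have n: "\<Phi> (\<lambda>i j k. int n * s i j k) = (\<lambda>i j k. int n * \<Phi> s i j k)" for n
  proof (induction n)
    case 0
    then show ?case using map_zero by simp
  next
    case (Suc n)
    have "\<Phi> (\<lambda>i j k. int (Suc n) * s i j k) = \<Phi> (\<lambda>i j k. int n * s i j k + s i j k)"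
      by (simp add: algebra_simps)
    also have "\<dots> = (\<lambda>i j k. int n * \<Phi> s i j k + \<Phi> s i j k)"
      using map_add[OF tensors_scale[OF s] s] Suc by simp
    finally show ?case by (simp add: algebra_simps)
  qed
  show ?thesis
  proof (cases c)
    case (nonneg n)
    then show ?thesis using n by simp
  next
    case (neg n)
    have e: "(\<lambda>i j k. - int (Suc n) * x i j k) = (\<lambda>i j k. 0 - int (Suc n) * x i j k)" for x :: "'i tensor"
      by (simp only: diff_0 mult_minus_left)
    show ?thesis
      unfolding neg e
      by (simp only: map_diff[OF tensors_zero tensors_scale[OF s]] map_zero n)
  qed
qed

end

text \<open>The conditions mean that \<open>s\<close> kills \<open>v\<close> and that
  \<open>u\<close> occurs in its values only within \<open>u \<and> v\<close>, which does not change
  when \<open>u + v\<close> is substituted for \<open>u\<close>.\<close>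

lemma transvect_invariant:
  assumes u: "\<And>i k. s i u k = 0 \<or> k = v" and v: "\<And>j k. s v j k = 0" and s: "s \<in> tensors I" and "u \<noteq> v"
  shows "transvect u v s = s"
proof (intro ext)
  fix i j k
  have "(if j = v then s i u k else 0) + (if k = v then s i j u else 0) = 0"
    using u[of i k] u[of i j] tensors_anti[OF s, of i j u] tensors_anti[OF s, of i v u]
    by (auto simp del: minus_equation_iff)
  then show "transvect u v s i j k = s i j k"
    using v by (auto simp: transvect_def split: if_splits)
qed

text \<open>The relations come from the entries at \<open>(i, v, k)\<close>,
  \<open>(u, j, k)\<close> and \<open>(u, v, k)\<close>. The third compares diagonal entries instead
  of killing them, since this is where inner tensors live.\<close>

lemma invariant_transvect:
  assumes inv: "transvect u v s = s" and s: "s \<in> tensors I" and ne: "u \<noteq> v"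
  shows "i \<noteq> u \<Longrightarrow> k \<noteq> v \<Longrightarrow> s i u k = 0"
    and "j \<noteq> v \<Longrightarrow> k \<noteq> v \<Longrightarrow> s v j k = 0"
    and "k \<noteq> v \<Longrightarrow> s u u k = s v v k + s v u k"
proof -
  have eq: "transvect u v s i j k = s i j k" for i j k using inv by simp
  show "i \<noteq> u \<Longrightarrow> k \<noteq> v \<Longrightarrow> s i u k = 0"
    using eq[of i v k] by (simp add: transvect_def)
  show "j \<noteq> v \<Longrightarrow> k \<noteq> v \<Longrightarrow> s v j k = 0"
    using eq[of u j k] by (simp add: transvect_def)
  show "k \<noteq> v \<Longrightarrow> s u u k = s v v k + s v u k"
    using eq[of u v k] by (simp add: transvect_def)
qed


section \<open>Images of tensors that leave infinitely many indices free\<close>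

context tensor_map
begin

text \<open>Invariance under the transvections between two indices outside \<open>Y\<close> is all that is used here.\<close>

lemma localize:
  assumes Y: "Y \<subseteq> I" "infinite (I - Y)" and f: "f \<in> tensors Y"
  obtains a where "a \<in> fin_vec Y"
    and "(\<lambda>i j k. \<Phi> f i j k - inner_tensor I a i j k) \<in> tensors Y"
proof -
  define h where "h = \<Phi> f"
  have fI: "f \<in> tensors I" using tensors_mono[OF Y(1)] f by blast
  have h: "h \<in> tensors I" unfolding h_def by (rule closed[OF fI])
  have inv: "transvect w w' h = h" if "w \<in> I - Y" "w' \<in> I - Y" "w \<noteq> w'" for w w'
  proof -
    have "transvect w w' f = f"
      using that by (intro transvect_invariant[OF _ _ f]) (auto simp: tensors_out[OF f])
    then show ?thesis using transvect[OF _ _ that(3) fI] that by (simp add: h_def)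
  qed
  \<comment> \<open>The relations at \<open>w\<close> need a partner outside \<open>Y\<close> that
    avoids a further index of the entry; the infinite complement provides one.\<close>
  have other: "\<exists>w'. w' \<in> I - Y \<and> w' \<noteq> w \<and> w' \<noteq> z" for w z
  proof -
    have "infinite (I - Y - {w, z})" using Y(2) by simp
    then obtain w' where "w' \<in> I - Y - {w, z}" by (metis ex_in_conv finite.emptyI)
    then show ?thesis by blast
  qed
  have A: "h i w k = 0" if "w \<in> I - Y" "i \<noteq> w" for i w k
  proof -
    obtain w' where "w' \<in> I - Y" "w' \<noteq> w" "w' \<noteq> k" using other[of w k] by blast
    then show ?thesis using invariant_transvect(1)[OF inv h] that by metis
  qed
  have B: "h w j k = 0" if "w \<in> I - Y" "j \<noteq> w" "k \<noteq> w" for w j k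
  proof -
    obtain w' where "w' \<in> I - Y" "w' \<noteq> w" using other[of w w] by blast
    then show ?thesis using invariant_transvect(2)[OF inv h] that by metis
  qed
  \<comment> \<open>The diagonal entries do not depend on the row outside \<open>Y\<close>, so a
    single vector accounts for all of these rows.\<close>
  have C: "h w w k = h w' w' k" if "w \<in> I - Y" "w' \<in> I - Y" "k \<noteq> w'" for w w' k
  proof (cases "w = w'")
    case False
    then show ?thesis
      using invariant_transvect(3)[OF inv[OF that(1,2)] h] that A[of w w' k] by simp
  qed simp
  obtain w0 where w0: "w0 \<in> I - Y" using other by blast
  have D: "h w w k = h w0 w0 k" if "w \<in> I - Y" "k \<in> Y" for w k
    using C[OF that(1) w0, of k] that w0 by blast
  have E: "h w w k = 0" if "w \<in> I - Y" "k \<in> I - Y" for w k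
    using A[of k w w] tensors_anti[OF h, of w w k] tensors_diag[OF h] that by (cases "w = k") auto
  \<comment> \<open>The sign is that of \<open>a \<and> w\<close>, whose entry at
    \<open>(w, w, k)\<close> is \<open>- a k\<close>.\<close>
  define a where "a = (\<lambda>k. if k \<in> Y then - h w0 w0 k else 0)"
  have "finite {k. h w0 w0 k \<noteq> 0}"
  proof -
    have "{k. h w0 w0 k \<noteq> 0} \<subseteq> snd ` {(j, k). h w0 j k \<noteq> 0}" by force
    then show ?thesis using tensors_finite[OF h] finite_subset by blast
  qed
  then have a: "a \<in> fin_vec Y"
    by (auto simp: fin_vec_def a_def elim: rev_finite_subset)
  then have aI: "a \<in> fin_vec I" using Y(1) by (auto simp: fin_vec_def)
  let ?g = "\<lambda>i j k. h i j k - inner_tensor I a i j k"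
  have g: "?g \<in> tensors I"
    by (rule tensors_diff[OF h inner_tensor_tensors[OF aI]])
  have i0: "?g i j k = 0" if i: "i \<in> I - Y" for i j k
  proof -
    have 1: "?g i i k = 0" for k
    proof (cases "k \<in> I")
      case True
      then show ?thesis
        using i D[of i k] E[of i k] by (cases "k \<in> Y"; auto simp: inner_tensor_def a_def)
    next
      case False
      then show ?thesis using tensors_out[OF g] by blast
    qed
    consider "j = i" | "k = i" | "j \<noteq> i" "k \<noteq> i" by blast
    then show ?thesis
    proof cases
      case 2
      then show ?thesis using 1[of j] tensors_anti[OF g, of i j i] by simp
    next
      case 3
      then show ?thesis using B[OF i] by (simp add: inner_tensor_def)
    qed (use 1 in simp)
  qed
  have j0: "?g i j k = 0" if i: "i \<in> Y" and j: "j \<in> I - Y" for i j k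
    using A[OF j, of i k] i j by (auto simp: inner_tensor_def a_def)
  have "?g \<in> tensors Y"
  proof (rule tensors_subsetI[OF g])
    fix i j k assume nz: "?g i j k \<noteq> 0"
    have I: "i \<in> I" "j \<in> I" "k \<in> I" using tensors_in[OF g nz] by blast+
    have i: "i \<in> Y" using i0 I nz by blast
    have "j \<in> Y" using j0 i I nz by blast
    moreover have "?g i k j \<noteq> 0" using nz tensors_anti[OF g, of i j k] by auto
    then have "k \<in> Y" using j0 i I by blast
    ultimately show "i \<in> Y \<and> j \<in> Y \<and> k \<in> Y" using i by blast
  qed
  then show thesis using that a unfolding h_def by blast
qed

text \<open>The tensor is fixed by every transvection from \<open>u\<close> to \<open>v\<close> with
  \<open>v \<noteq> w\<close> that does not lead out of \<open>{s, t}\<close>, because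
  \<open>(s + t) \<and> t = s \<and> t\<close>. Its image is fixed by the same transvections, and
  their relations leave only the entries at \<open>(w, s, t)\<close> and \<open>(w, t, s)\<close>;
  in particular no inner part survives.\<close>

lemma elem_wedge_scalar:
  assumes d: "w \<in> I" "s \<in> I" "t \<in> I" "w \<noteq> s" "w \<noteq> t" "s \<noteq> t"
  shows "\<exists>c. \<Phi> (elem_tensor w (wedge s t)) = (\<lambda>i j k. c * elem_tensor w (wedge s t) i j k)"
proof -
  define f where "f = elem_tensor w (wedge s t)"
  define h where "h = \<Phi> f"
  have f: "f \<in> tensors I" unfolding f_def by (rule forms_elem_tensor[OF wedge_forms]) (use d in auto)
  have h: "h \<in> tensors I" unfolding h_def by (rule closed[OF f])
  have f_nz: "f i j k \<noteq> 0 \<Longrightarrow> i = w \<and> (j = s \<and> k = t \<or> j = t \<and> k = s)" for i j k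
    using wedge_nonzero[of s t j k] by (simp add: f_def elem_tensor_def split: if_splits)
  have inv: "transvect u v h = h"
    if "u \<in> I" "v \<in> I" "u \<noteq> v" "v \<noteq> w" "u \<in> {s, t} \<Longrightarrow> v \<in> {s, t}" for u v
  proof -
    have "f i u k = 0 \<or> k = v" for i k using f_nz[of i u k] that by auto
    moreover have "f v j k = 0" for j k using f_nz[of v j k] that by auto
    ultimately have "transvect u v f = f"
      by (rule transvect_invariant[OF _ _ f that(3)])
    then show ?thesis using transvect[OF that(1-3) f] by (simp add: h_def)
  qed
  note A = invariant_transvect(1)[OF inv h] and B = invariant_transvect(2)[OF inv h]
    and C = invariant_transvect(3)[OF inv h]
  have A1: "h i u k = 0" if "u \<in> I" "u \<notin> {s, t}" "i \<noteq> u" for i u k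
  proof (cases "k = s")
    case True
    then show ?thesis using A[of u t i k] d that by auto
  next
    case False
    then show ?thesis using A[of u s i k] d that by auto
  qed
  have A2: "h i t k = 0" if "i \<noteq> t" "k \<noteq> s" for i k
    using A[of t s i k] d that by auto
  have A3: "h i s k = 0" if "i \<noteq> s" "k \<noteq> t" for i k
    using A[of s t i k] d that by auto
  have B1: "h v j k = 0" if "v \<in> I" "v \<noteq> w" "j \<noteq> v" "k \<noteq> v" for v j k
  proof -
    obtain u where "u \<in> I" "u \<notin> {v, w, s, t}" using fresh[of "{v, w, s, t}"] by auto
    then show ?thesis using B[of u v j k] that by auto
  qed
  \<comment> \<open>The entries at \<open>(s, s, t)\<close> and \<open>(t, t, s)\<close> escape the
    vanishing relations. A fresh \<open>u\<close> reaches them: the third relation equates them with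
    diagonal entries in row \<open>u\<close>, which vanish.\<close>
  obtain u where u: "u \<in> I" "u \<notin> {w, s, t}" using fresh[of "{w, s, t}"] by auto
  have uut: "h u u t = 0" and uus: "h u u s = 0"
    using A2[of u u] A3[of u u] u tensors_anti[OF h, of u u t] tensors_anti[OF h, of u u s] by auto
  have sst: "h s s t = 0"
    using C[of u s t] A1[of u s t] u uut d by auto
  have tts: "h t t s = 0"
    using C[of u t s] A1[of u t s] u uus d by auto
  have main: "h i j k = h w s t * f i j k" for i j k
  proof (cases "h i j k = 0 \<and> f i j k = 0")
    case False
    then have I: "i \<in> I" "j \<in> I" "k \<in> I" and ne: "j \<noteq> k"
      using tensors_in[OF h, of i j k] tensors_in[OF f, of i j k] tensors_diag[OF h] tensors_diag[OF f] by auto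
    have z: "h i j k = 0" if "i \<noteq> w \<or> \<not> (j = s \<and> k = t \<or> j = t \<and> k = s)" for i j k
    proof (cases "i \<in> I \<and> j \<in> I \<and> k \<in> I \<and> j \<noteq> k")
      case True
      have *: "h i j k = 0" if "i \<noteq> w" "j = i" "k \<in> I" "k \<noteq> j" "i \<in> I" for i j k
      proof -
        consider "k \<notin> {s, t}" | "k = s" "i = t" | "k = t" "i = s" | "k = s" "i \<noteq> t" | "k = t" "i \<noteq> s"
          by blast
        then show ?thesis
        proof cases
          case 1
          then show ?thesis using A1[of k i j] that tensors_anti[OF h, of i j k] by auto
        next
          case 4
          then show ?thesis using A3[of i j] that tensors_anti[OF h, of i j k] d by auto
        next
          case 5
          then show ?thesis using A2[of i j] that tensors_anti[OF h, of i j k] d by auto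
        qed (use sst tts that in auto)
      qed
      show ?thesis
      proof (cases "i = w")
        case True
        with that have n: "\<not> (j = s \<and> k = t \<or> j = t \<and> k = s)" by blast
        have "h w x y = 0" if "x \<noteq> w" "x \<noteq> y" "x \<in> I" "\<not> (x = s \<and> y = t \<or> x = t \<and> y = s)" for x y
          using A1[of x w y] A2[of w y] A3[of w y] d that by auto
        then show ?thesis
          using n True \<open>i \<in> I \<and> j \<in> I \<and> k \<in> I \<and> j \<noteq> k\<close> tensors_anti[OF h, of w j k] by (cases "j = w") auto
      next
        case False
        then show ?thesis
          using B1[of i j k] *[of i j k] *[of i k j] True tensors_anti[OF h, of i j k] by (cases "j = i"; cases "k = i") auto
      qed
    next
      case False
      then show ?thesis using tensors_out[OF h] tensors_diag[OF h] by blast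
    qed
    show ?thesis
    proof (cases "i = w \<and> (j = s \<and> k = t \<or> j = t \<and> k = s)")
      case True
      then show ?thesis
        using tensors_anti[OF h, of w t s] d by (auto simp: f_def elem_tensor_def wedge_def)
    next
      case no: False
      then show ?thesis using z[of i j k] f_nz[of i j k] by auto
    qed
  qed auto
  have "h = (\<lambda>i j k. h w s t * f i j k)" using main by blast
  then show ?thesis unfolding h_def f_def by blast
qed


text \<open>A transvection adds to an elementary tensor, or subtracts from it, a neighbouring one;
  comparing images shows that both have the same scalar. This replaces \<open>t\<close> or
  \<open>w\<close> by a new index, and antisymmetry exchanges \<open>s\<close> and \<open>t\<close>.
  Arbitrary triples are compared through a third one disjoint from both.\<close>

lemma scalar_exists:
  obtains c where "\<And>w s t. w \<in> I \<Longrightarrow> s \<in> I \<Longrightarrow> t \<in> I \<Longrightarrow> w \<noteq> s \<Longrightarrow> w \<noteq> t \<Longrightarrow> s \<noteq> t \<Longrightarrow>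
    \<Phi> (elem_tensor w (wedge s t)) = (\<lambda>i j k. c * elem_tensor w (wedge s t) i j k)"
proof -
  let ?E = "\<lambda>w s t. elem_tensor w (wedge s t)"
  let ?d = "\<lambda>w s t. w \<in> I \<and> s \<in> I \<and> t \<in> I \<and> w \<noteq> s \<and> w \<noteq> t \<and> s \<noteq> t"
  define C where "C = (\<lambda>w s t. \<Phi> (?E w s t) w s t)"
  have E: "?E w s t \<in> tensors I" if "?d w s t" for w s t
    by (rule forms_elem_tensor[OF wedge_forms]) (use that in auto)
  have C: "\<Phi> (?E w s t) = (\<lambda>i j k. C w s t * ?E w s t i j k)" if d: "?d w s t" for w s t
  proof -
    obtain c where c: "\<Phi> (?E w s t) = (\<lambda>i j k. c * ?E w s t i j k)"
      using elem_wedge_scalar[of w s t] d by blast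
    moreover have "C w s t = c"
      unfolding C_def c using d by (simp add: elem_tensor_def wedge_def)
    ultimately show ?thesis by simp
  qed
  have t: "C w s t = C w s t'" if d: "?d w s t" and t': "t' \<in> I" "t' \<notin> {w, s, t}" for w s t t'
  proof -
    have d': "?d w s t'" using d t' by auto
    have "transvect t t' (?E w s t) = (\<lambda>i j k. ?E w s t i j k + ?E w s t' i j k)"
      using d t' by (auto simp: transvect_def elem_tensor_def wedge_def fun_eq_iff)
    then have "transvect t t' (\<Phi> (?E w s t)) = (\<lambda>i j k. \<Phi> (?E w s t) i j k + \<Phi> (?E w s t') i j k)"
      using transvect[of t t' "?E w s t"] map_add[OF E[OF d] E[OF d']] E[OF d] d t' by auto
    from fun_cong[OF fun_cong[OF fun_cong[OF this, of w], of s], of t'] show ?thesis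
      using C[OF d] C[OF d'] d t' by (auto simp: transvect_def elem_tensor_def wedge_def)
  qed
  have s: "C w s t = C w t s" if d: "?d w s t" for w s t
  proof -
    have d': "?d w t s" using d by auto
    have "?E w t s = (\<lambda>i j k. (-1) * ?E w s t i j k)"
      using d by (auto simp: elem_tensor_def wedge_def fun_eq_iff)
    then have "\<Phi> (?E w t s) = (\<lambda>i j k. (-1) * \<Phi> (?E w s t) i j k)"
      using map_scale[OF E[OF d], of "-1"] by simp
    from fun_cong[OF fun_cong[OF fun_cong[OF this, of w], of s], of t] show ?thesis
      using C[OF d] C[OF d'] d by (auto simp: elem_tensor_def wedge_def)
  qed
  have w: "C w s t = C u s t" if d: "?d w s t" and u: "u \<in> I" "u \<notin> {w, s, t}" for w s t u
  proof -
    have d': "?d u s t" using d u by auto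
    have "transvect u w (?E w s t) = (\<lambda>i j k. ?E w s t i j k - ?E u s t i j k)"
      using d u by (auto simp: transvect_def elem_tensor_def wedge_def fun_eq_iff)
    then have "transvect u w (\<Phi> (?E w s t)) = (\<lambda>i j k. \<Phi> (?E w s t) i j k - \<Phi> (?E u s t) i j k)"
      using transvect[of u w "?E w s t"] map_diff[OF E[OF d] E[OF d']] E[OF d] d u by auto
    from fun_cong[OF fun_cong[OF fun_cong[OF this, of u], of s], of t] show ?thesis
      using C[OF d] C[OF d'] d u by (auto simp: transvect_def elem_tensor_def wedge_def)
  qed
  have far: "C w s t = C p q r" if d: "?d w s t" and d': "?d p q r" and x: "{w, s, t} \<inter> {p, q, r} = {}"
    for w s t p q r
  proof -
    have "C w s t = C p s t" using d d' x by (intro w) auto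
    also have "\<dots> = C p s r" using d d' x by (intro t) auto
    also have "\<dots> = C p r s" using d d' x by (intro s) auto
    also have "\<dots> = C p r q" using d d' x by (intro t) auto
    also have "\<dots> = C p q r" using d d' x by (intro s) auto
    finally show ?thesis .
  qed
  have "C w s t = C w' s' t'" if d: "?d w s t" and d': "?d w' s' t'" for w s t w' s' t'
  proof -
    let ?F = "{w, s, t, w', s', t'}"
    obtain p where p: "p \<in> I" "p \<notin> ?F" using fresh[of ?F] by auto
    obtain q where q: "q \<in> I" "q \<notin> insert p ?F" using fresh[of "insert p ?F"] by auto
    obtain r where r: "r \<in> I" "r \<notin> insert q (insert p ?F)"
      using fresh[of "insert q (insert p ?F)"] by auto
    have pqr: "?d p q r" using p q r by auto
    have "C w s t = C p q r" by (rule far[OF d pqr]) (use p q r in auto)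
    also have "C w' s' t' = C p q r" by (rule far[OF d' pqr]) (use p q r in auto)
    finally show ?thesis by simp
  qed
  then have "\<exists>c. \<forall>w s t. ?d w s t \<longrightarrow> C w s t = c" by metis
  then obtain c where "\<And>w s t. ?d w s t \<Longrightarrow> C w s t = c" by blast
  then show thesis using that[of c] C by simp
qed

text \<open>The form has to avoid \<open>w\<close>, because the scalar is known only for wedges that
  do not involve \<open>w\<close>.\<close>

lemma elem_scalar:
  assumes c: "\<And>w s t. w \<in> I \<Longrightarrow> s \<in> I \<Longrightarrow> t \<in> I \<Longrightarrow> w \<noteq> s \<Longrightarrow> w \<noteq> t \<Longrightarrow> s \<noteq> t \<Longrightarrow>
    \<Phi> (elem_tensor w (wedge s t)) = (\<lambda>i j k. c * elem_tensor w (wedge s t) i j k)"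
    and r: "r \<in> forms (I - {w})" and w: "w \<in> I"
  shows "\<Phi> (elem_tensor w r) = (\<lambda>i j k. c * elem_tensor w r i j k)"
  using r
proof (induction rule: form_induct)
  case zero
  have "elem_tensor w (\<lambda>j k. 0) = (\<lambda>i j k. 0)" by (auto simp: elem_tensor_def)
  then show ?case using map_zero by simp
next
  case (add r b s t)
  have r: "elem_tensor w r \<in> tensors I"
  proof (rule forms_elem_tensor[OF _ w])
    show "r \<in> forms I" using add.hyps(1) unfolding forms_def by blast
  qed
  have e: "elem_tensor w (wedge s t) \<in> tensors I"
    by (rule forms_elem_tensor[OF wedge_forms]) (use add.hyps w in auto)
  have "elem_tensor w (\<lambda>j k. r j k + b * wedge s t j k) =
      (\<lambda>i j k. elem_tensor w r i j k + b * elem_tensor w (wedge s t) i j k)"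
    by (auto simp: elem_tensor_def fun_eq_iff)
  then have "\<Phi> (elem_tensor w (\<lambda>j k. r j k + b * wedge s t j k)) =
     (\<lambda>i j k. c * elem_tensor w r i j k + b * (c * elem_tensor w (wedge s t) i j k))"
    using map_add[OF r tensors_scale[OF e, of b]] map_scale[OF e, of b] add.IH c[of w s t] add.hyps w by auto
  then show ?case
    by (auto simp: elem_tensor_def fun_eq_iff algebra_simps)
qed

text \<open>
  For \<open>w\<close> outside \<open>Y\<close>, the transvection \<open>w \<mapsto> w + x\<close> changes \<open>f\<close> by \<open>- w\<^sup>* \<otimes> f x\<close>, on which the scalar is
  already known.
\<close>

lemma local_scalar:
  assumes c: "\<And>w s t. w \<in> I \<Longrightarrow> s \<in> I \<Longrightarrow> t \<in> I \<Longrightarrow> w \<noteq> s \<Longrightarrow> w \<noteq> t \<Longrightarrow> s \<noteq> t \<Longrightarrow>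
    \<Phi> (elem_tensor w (wedge s t)) = (\<lambda>i j k. c * elem_tensor w (wedge s t) i j k)"
    and Y: "Y \<subseteq> I" "infinite (I - Y)" and f: "f \<in> tensors Y"
  obtains a where "a \<in> fin_vec Y" "\<Phi> f = (\<lambda>i j k. c * f i j k + inner_tensor I a i j k)"
proof -
  obtain a where a: "a \<in> fin_vec Y"
    and g: "(\<lambda>i j k. \<Phi> f i j k - inner_tensor I a i j k) \<in> tensors Y" (is "?g \<in> _")
    using localize[OF Y f] by blast
  obtain w where w: "w \<in> I" "w \<notin> Y"
    using Y(2) by (metis DiffE ex_in_conv finite.emptyI)
  have fI: "f \<in> tensors I" using tensors_mono[OF Y(1)] f by blast
  have "?g x j k = c * f x j k" for x j k
  proof (cases "x \<in> Y")
    case True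
    then have x: "x \<in> I" "w \<noteq> x" using Y w by auto
    have r: "f x \<in> forms (I - {w})"
      using forms_tensor[OF f, of x] Y(1) w unfolding forms_def by blast
    have e: "elem_tensor w (f x) \<in> tensors I"
      using forms_elem_tensor[OF forms_tensor[OF fI] w(1)] .
    define h where "h = ?g"
    have o: "f w j k = 0" "f i w k = 0" "f i j w = 0" for i j k
      using tensors_out[OF f] w by blast+
    have "h w j k = 0 \<and> h i w k = 0 \<and> h i j w = 0" for i j k
      using tensors_out[OF g[folded h_def]] w by blast
    then have og: "h w j k = 0" "h i w k = 0" "h i j w = 0" for i j k by blast+
    have "transvect w x f = (\<lambda>i j k. f i j k - elem_tensor w (f x) i j k)"
      using x o by (auto simp: transvect_def elem_tensor_def fun_eq_iff)
    then have "transvect w x (\<Phi> f) = (\<lambda>i j k. \<Phi> f i j k - c * elem_tensor w (f x) i j k)"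
      using transvect[OF w(1) x(1,2) fI] map_diff[OF fI e] elem_scalar[OF c r w(1)] by simp
    from fun_cong[OF fun_cong[OF fun_cong[OF this, of w], of j], of k]
    have *: "transvect w x (\<Phi> f) w j k = \<Phi> f w j k - c * f x j k"
      by (simp add: elem_tensor_def)
    have F: "\<Phi> f = (\<lambda>i j k. h i j k + inner_tensor I a i j k)" by (simp add: h_def)
    \<comment> \<open>Without a component at \<open>w\<close> the vector \<open>a\<close> is fixed
      by the transvection, hence so is its inner tensor; only the part \<open>h\<close> changes the
      row \<open>w\<close>.\<close>
    have aw: "a w = 0" using a w by (auto simp: fin_vec_def)
    have "transvect w x (\<Phi> f) w j k = \<Phi> f w j k - h x j k"
      unfolding transvect_def F Let_def using og aw x w
      by (auto simp: inner_tensor_def)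
    with * show ?thesis unfolding h_def by linarith
  next
    case False
    then show ?thesis using tensors_out[OF g] tensors_out[OF f] by simp
  qed
  then have "\<Phi> f = (\<lambda>i j k. c * f i j k + inner_tensor I a i j k)"
    by (auto simp: fun_eq_iff algebra_simps)
  then show thesis using that a by blast
qed


text \<open>
  Let \<open>F\<close> be the sum of the translates of \<open>f\<close> to the columns \<open>\<kappa>(Y, n)\<close>. As \<open>F\<close> is invariant under
  exchanging columns, its inner part is a finitely supported vector invariant under these
  exchanges, so it has no component in the column \<open>Y\<close>. Neither has the inner part of \<open>F - f\<close>.
\<close>

lemma swindle:
  assumes c: "\<And>w s t. w \<in> I \<Longrightarrow> s \<in> I \<Longrightarrow> t \<in> I \<Longrightarrow> w \<noteq> s \<Longrightarrow> w \<noteq> t \<Longrightarrow> s \<noteq> t \<Longrightarrow>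
    \<Phi> (elem_tensor w (wedge s t)) = (\<lambda>i j k. c * elem_tensor w (wedge s t) i j k)"
    and Y: "Y \<subseteq> I" and f: "f \<in> tensors Y"
    and inj: "\<And>y z m n. y \<in> Y \<Longrightarrow> z \<in> Y \<Longrightarrow> \<kappa> y m = \<kappa> z n \<Longrightarrow> y = z \<and> m = n"
    and \<kappa>0: "\<And>y. \<kappa> y (0::nat) = y" and \<kappa>I: "\<And>y n. y \<in> Y \<Longrightarrow> \<kappa> y n \<in> I"
    and inf: "infinite (I - {\<kappa> y n | y n. y \<in> Y})"
  shows "\<Phi> f = (\<lambda>i j k. c * f i j k)"
proof -
  define K where "K = {\<kappa> y n | y n. y \<in> Y}"
  define row where "row = (\<lambda>i. THE y. y \<in> Y \<and> (\<exists>n. i = \<kappa> y n))"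
  define col where "col = (\<lambda>i. THE n. \<exists>y\<in>Y. i = \<kappa> y n)"
  have row: "row (\<kappa> y n) = y" if "y \<in> Y" for y n
    unfolding row_def by (rule the_equality) (use that inj in blast)+
  have col: "col (\<kappa> y n) = n" if "y \<in> Y" for y n
    unfolding col_def by (rule the_equality) (use that inj in blast)+
  have KE: "\<exists>y n. i = \<kappa> y n \<and> y \<in> Y" if "i \<in> K" for i using that by (auto simp: K_def)
  have KI: "\<kappa> y n \<in> K" if "y \<in> Y" for y n using that by (auto simp: K_def)
  have YK: "Y \<subseteq> K" using KI[of _ 0] \<kappa>0 by auto
  have K: "K \<subseteq> I" using \<kappa>I by (auto simp: K_def)
  have rowY: "row i \<in> Y" "\<kappa> (row i) (col i) = i" if "i \<in> K" for i
    using KE[OF that] row col by auto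
  have Y0: "row y = y" "col y = 0" if "y \<in> Y" for y
    using row[OF that, of 0] col[OF that, of 0] \<kappa>0 by auto
  have col0: "i \<in> Y" if "i \<in> K" "col i = 0" for i
    using rowY[OF that(1)] that(2) \<kappa>0 by metis
  \<comment> \<open>The copies of \<open>f\<close> have disjoint supports and each row meets a
    single column, so their infinite sum is again a tensor.\<close>
  define F where "F = (\<lambda>i j k. if i \<in> K \<and> j \<in> K \<and> k \<in> K \<and> col i = col j \<and> col i = col k
    then f (row i) (row j) (row k) else 0)"
  have F: "F \<in> tensors K"
  proof (rule tensorsI)
    fix i
    show "finite {(j, k). F i j k \<noteq> 0}"
    proof (rule finite_subset)
      show "{(j, k). F i j k \<noteq> 0} \<subseteq>
        (\<lambda>(y, z). (\<kappa> y (col i), \<kappa> z (col i))) ` {(y, z). f (row i) y z \<noteq> 0}"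
      proof clarify
        fix j k assume "F i j k \<noteq> 0"
        then have "j \<in> K" "k \<in> K" "col j = col i" "col k = col i" "f (row i) (row j) (row k) \<noteq> 0"
          by (auto simp: F_def split: if_splits)
        then show "(j, k) \<in> (\<lambda>(y, z). (\<kappa> y (col i), \<kappa> z (col i))) ` {(y, z). f (row i) y z \<noteq> 0}"
          using rowY(2)[of j] rowY(2)[of k] by (intro image_eqI[of _ _ "(row j, row k)"]) auto
      qed
      show "finite ((\<lambda>(y, z). (\<kappa> y (col i), \<kappa> z (col i))) ` {(y, z). f (row i) y z \<noteq> 0})"
        using tensors_finite[OF f] by blast
    qed
    fix j k
    show "F i j k \<noteq> 0 \<Longrightarrow> i \<in> K \<and> j \<in> K \<and> k \<in> K" by (simp add: F_def split: if_splits)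
    show "F i j k = - F i k j"
      using tensors_anti[OF f, of "row i" "row j" "row k"] by (simp add: F_def)
  qed
  have fF: "f i j k = (if i \<in> Y \<and> j \<in> Y \<and> k \<in> Y then F i j k else 0)" for i j k
    using Y0 YK tensors_out[OF f, of i j k] by (auto simp: F_def)
  let ?F' = "\<lambda>i j k. F i j k - f i j k"
  have FI: "F \<in> tensors I" and fI: "f \<in> tensors I" using tensors_mono K Y F f by blast+
  have F': "?F' \<in> tensors (K - Y)"
  proof (rule tensors_subsetI[OF tensors_diff[OF FI fI]])
    fix i j k assume nz: "F i j k - f i j k \<noteq> 0"
    then have "F i j k \<noteq> 0" using fF[of i j k] by (auto split: if_splits)
    then have K: "i \<in> K" "j \<in> K" "k \<in> K" and c: "col i = col j" "col i = col k"
      by (auto simp: F_def split: if_splits)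
    have "col i \<noteq> 0"
    proof
      assume "col i = 0"
      then have "i \<in> Y" "j \<in> Y" "k \<in> Y" using col0 K c by auto
      then show False using nz fF[of i j k] by simp
    qed
    then show "i \<in> K - Y \<and> j \<in> K - Y \<and> k \<in> K - Y" using K c Y0(2) by auto
  qed
  have inf1: "infinite (I - K)" using inf by (simp add: K_def)
  have inf2: "infinite (I - Y)" "infinite (I - (K - Y))"
    using inf1 YK by (meson Diff_mono finite_subset order_refl Diff_subset)+
  \<comment> \<open>The row \<open>w\<close> of all tensors in this argument vanishes, so for
    \<open>y\<close> in \<open>K\<close> the entry of an image at \<open>(w, y, w)\<close> is just
    the component at \<open>y\<close> of its inner part.\<close>
  obtain w where w: "w \<in> I" "w \<notin> K" using inf1 by (metis DiffE ex_in_conv finite.emptyI)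
  obtain b where b: "b \<in> fin_vec K" "\<Phi> F = (\<lambda>i j k. c * F i j k + inner_tensor I b i j k)"
    using local_scalar[OF c K inf1 F] by blast
  obtain b' where b': "b' \<in> fin_vec (K - Y)"
      "\<Phi> ?F' = (\<lambda>i j k. c * ?F' i j k + inner_tensor I b' i j k)"
    using local_scalar[OF c _ inf2(2) F'] K by blast
  obtain a where a: "a \<in> fin_vec Y" "\<Phi> f = (\<lambda>i j k. c * f i j k + inner_tensor I a i j k)"
    using local_scalar[OF c Y inf2(1) f] by blast
  have bY: "b y = 0" if y: "y \<in> Y" for y
  proof -
    have "b (\<kappa> y n) = b y" for n
    proof -
      \<comment> \<open>The involution exchanging the columns \<open>0\<close> and \<open>n\<close>;
        it is trivial when \<open>n = 0\<close>.\<close>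
      define p where "p = (\<lambda>i. if i \<in> K \<and> col i = 0 then \<kappa> (row i) n
        else if i \<in> K \<and> col i = n then row i else i)"
      have pK: "p i \<in> K \<longleftrightarrow> i \<in> K" for i using rowY KI YK by (auto simp: p_def)
      have prow: "row (p i) = row i" if "i \<in> K" for i using rowY[OF that] row Y0 by (auto simp: p_def)
      have pcol: "col (p i) = (if col i = 0 then n else if col i = n then 0 else col i)" if "i \<in> K" for i
        using rowY[OF that] that col Y0 by (auto simp: p_def)
      have pp: "p (p i) = i" for i
      proof (cases "i \<in> K")
        case True
        have "p (p i) \<in> K" "row (p (p i)) = row i" "col (p (p i)) = col i"
          using True pK prow[of "p i"] prow[of i] pcol[of "p i"] pcol[of i] by auto
        then show ?thesis using rowY(2)[of "p (p i)"] rowY(2)[OF True] by simp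
      qed (simp add: p_def)
      have pI: "p ` I \<subseteq> I"
      proof
        fix x assume "x \<in> p ` I"
        then obtain i where i: "x = p i" "i \<in> I" by blast
        then show "x \<in> I" using pK[of i] K by (cases "i \<in> K") (auto simp: p_def)
      qed
      have "F (p i) (p j) (p k) = F i j k" for i j k
      proof (cases "i \<in> K \<and> j \<in> K \<and> k \<in> K")
        case True
        then have "(col (p i) = col (p j)) = (col i = col j)" "(col (p i) = col (p k)) = (col i = col k)"
          using pcol by auto
        then show ?thesis using True prow pK by (simp add: F_def)
      qed (auto simp: F_def pK)
      then have "permute p F = F" by (simp add: permute_def)
      then have "permute p (\<Phi> F) = \<Phi> F" using permute[OF pp pI FI] by simp
      from fun_cong[OF fun_cong[OF fun_cong[OF this, of w], of y], of w]
      have "\<Phi> F w (p y) w = \<Phi> F w y w" using w by (simp add: permute_def p_def)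
      moreover have "p y = \<kappa> y n" using y YK Y0 by (auto simp: p_def)
      moreover have "F w j w = 0" for j using w by (simp add: F_def)
      moreover have "\<kappa> y n \<noteq> w" "y \<noteq> w" using w KI[OF y] YK y by auto
      ultimately show ?thesis using w by (simp add: b(2) inner_tensor_def)
    qed
    moreover have "finite {i. b i \<noteq> 0}" using b(1) by (simp add: fin_vec_def)
    moreover have "inj (\<kappa> y)" using inj[OF y y] by (auto intro: injI)
    ultimately show ?thesis
    proof (intro notI ccontr[of "b y = 0"])
      assume *: "\<And>n. b (\<kappa> y n) = b y" "finite {i. b i \<noteq> 0}" "inj (\<kappa> y)" "b y \<noteq> 0"
      have "range (\<kappa> y) \<subseteq> {i. b i \<noteq> 0}" using * by auto
      then show False using *(2,3) by (meson finite_subset finite_imageD infinite_UNIV_nat)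
    qed
  qed
  have "a y = 0" for y
  proof (cases "y \<in> Y")
    case True
    have "\<Phi> F = (\<lambda>i j k. \<Phi> ?F' i j k + \<Phi> f i j k)"
      using map_add[OF tensors_diff[OF FI fI] fI] by simp
    from fun_cong[OF fun_cong[OF fun_cong[OF this, of w], of y], of w]
    moreover have "w \<noteq> y" using w True YK by auto
    ultimately have "b y = b' y + a y"
      using w unfolding b(2) b'(2) a(2) by (auto simp: inner_tensor_def algebra_simps)
    moreover have "b' y = 0" using b'(1) True by (auto simp: fin_vec_def)
    ultimately show ?thesis using bY[OF True] by simp
  next
    case False
    then show ?thesis using a(1) by (auto simp: fin_vec_def)
  qed
  then show ?thesis using a(2) by (simp add: inner_tensor_def fun_eq_iff)
qed

text \<open>
  With four disjoint blocks of indices, each entry \<open>(i, j, k)\<close> avoids one of them. So a tensor is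
  killed by the composition of the four operators that remove the part avoiding one block.
\<close>

theorem tensor_map_trivial:
  assumes s: "s \<in> tensors I"
  shows "\<Phi> s = s"
proof -
  obtain c where c: "\<And>w s t. w \<in> I \<Longrightarrow> s \<in> I \<Longrightarrow> t \<in> I \<Longrightarrow> w \<noteq> s \<Longrightarrow> w \<noteq> t \<Longrightarrow> s \<noteq> t \<Longrightarrow>
    \<Phi> (elem_tensor w (wedge s t)) = (\<lambda>i j k. c * elem_tensor w (wedge s t) i j k)"
    using scalar_exists by blast
  \<comment> \<open>An infinite \<open>I\<close> splits into countably many copies of itself; the
    four blocks collect these copies by residue modulo 4.\<close>
  have "(card_of (I \<times> (UNIV :: nat set)), card_of I) \<in> ordIso"
    using infinite by (intro card_of_Times_infinite[THEN conjunct1]) (auto simp: infinite_iff_card_of_nat[symmetric])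
  then obtain \<beta> where \<beta>: "bij_betw \<beta> (I \<times> (UNIV :: nat set)) I"
    using card_of_ordIso by blast
  have inj: "x = y \<and> m = n" if "x \<in> I" "y \<in> I" "\<beta> (x, m) = \<beta> (y, n)" for x y m n
    using bij_betw_imp_inj_on[OF \<beta>] that by (auto dest: inj_onD)
  have \<beta>I: "\<beta> (x, n) \<in> I" if "x \<in> I" for x n using bij_betwE[OF \<beta>] that by auto
  define B where "B = (\<lambda>r. {\<beta> (x, n) | x n. x \<in> I \<and> n mod 4 = r})"
  obtain x0 where x0: "x0 \<in> I" using fresh[of "{}"] by auto
  have good: "\<Phi> f = (\<lambda>i j k. c * f i j k)" if f: "f \<in> tensors (I - B r)" and r: "r < 4" for f r
  proof (rule swindle[OF c _ f])
    \<comment> \<open>For positive \<open>n\<close> the copies of \<open>I - B r\<close> go to the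
      positions \<open>8 * n + r\<close> of the block that \<open>f\<close> avoids. Using only every
      second position of residue \<open>r\<close> modulo 4 leaves the positions
      \<open>8 * n + 4 + r\<close> free, which keeps the complement infinite.\<close>
    define \<kappa> where "\<kappa> = (\<lambda>y n. if n = 0 then y else \<beta> (y, 8 * n + r))"
    have \<kappa>B: "\<kappa> y n \<in> B r" if "n \<noteq> 0" "y \<in> I" for y n
    proof -
      have "(8 * n + r) mod 4 = r" using r by presburger
      then show ?thesis using that by (auto simp: \<kappa>_def B_def)
    qed
    show "y = z \<and> m = n" if yz: "y \<in> I - B r" "z \<in> I - B r" "\<kappa> y m = \<kappa> z n" for y z m n
    proof (cases "m = 0 \<or> n = 0")
      case True
      then show ?thesis using yz \<kappa>B[of m y] \<kappa>B[of n z] by (auto simp: \<kappa>_def split: if_splits)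
    next
      case False
      then show ?thesis using yz inj[of y z "8 * m + r" "8 * n + r"] by (auto simp: \<kappa>_def)
    qed
    show "\<kappa> y 0 = y" for y by (simp add: \<kappa>_def)
    show "\<kappa> y n \<in> I" if "y \<in> I - B r" for y n using that \<beta>I by (auto simp: \<kappa>_def)
    let ?g = "\<lambda>n. \<beta> (x0, 8 * n + 4 + r)"
    have "?g n \<in> I - {\<kappa> y n | y n. y \<in> I - B r}" for n
    proof -
      have "?g n \<noteq> \<kappa> y m" if y: "y \<in> I - B r" for y m
      proof (cases "m = 0")
        case True
        have "(8 * n + 4 + r) mod 4 = r" using r by presburger
        then have "?g n \<in> B r" using x0 by (auto simp: B_def)
        then show ?thesis using y True by (auto simp: \<kappa>_def)
      next
        case False
        have "8 * n + 4 + r \<noteq> 8 * m + r" by presburger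
        then show ?thesis using inj[of x0 y "8 * n + 4 + r" "8 * m + r"] False x0 y by (auto simp: \<kappa>_def)
      qed
      then show ?thesis using \<beta>I x0 by blast
    qed
    moreover have "inj ?g"
    proof (rule injI)
      fix m n assume "?g m = ?g n"
      then have "8 * m + 4 + r = 8 * n + 4 + r" using inj[OF x0 x0] by blast
      then show "m = n" by simp
    qed
    ultimately show "infinite (I - {\<kappa> y n | y n. y \<in> I - B r})"
      by (meson finite_subset finite_imageD image_subsetI infinite_UNIV_nat)
  qed auto
  define E where "E = (\<lambda>r (f :: 'i tensor) i j k. if i \<in> I - B r \<and> j \<in> I - B r \<and> k \<in> I - B r then f i j k else 0)"
  define D where "D = (\<lambda>r f i j k. f i j k - E r f i j k :: int)"
  have E: "E r f \<in> tensors I" "E r f \<in> tensors (I - B r)" if f: "f \<in> tensors I" for r f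
  proof -
    show 1: "E r f \<in> tensors I" unfolding E_def by (rule tensors_restrict[OF f])
    show "E r f \<in> tensors (I - B r)"
      by (rule tensors_subsetI[OF 1]) (simp add: E_def split: if_splits)
  qed
  have D: "D r f \<in> tensors I" if f: "f \<in> tensors I" for r f
    unfolding D_def by (rule tensors_diff[OF f E(1)[OF f]])
  have step: "\<Phi> f = (\<lambda>i j k. c * f i j k)"
    if f: "f \<in> tensors I" and r: "r < 4" and Df: "\<Phi> (D r f) = (\<lambda>i j k. c * D r f i j k)" for f r
  proof -
    have "f = (\<lambda>i j k. D r f i j k + E r f i j k)" by (simp add: D_def)
    then have "\<Phi> f = (\<lambda>i j k. \<Phi> (D r f) i j k + \<Phi> (E r f) i j k)"
      using map_add[OF D[OF f] E(1)[OF f], of r r] by simp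
    then show ?thesis
      using Df good[OF E(2)[OF f] r] by (simp add: D_def fun_eq_iff algebra_simps)
  qed
  have disj: "r = r'" if "i \<in> B r" "i \<in> B r'" for i r r'
    using that inj unfolding B_def by blast
  have sc: "\<Phi> s = (\<lambda>i j k. c * s i j k)" if s: "s \<in> tensors I" for s
  proof -
    have "D 3 (D 2 (D 1 (D 0 s))) i j k = 0" for i j k
    proof (rule ccontr)
      assume nz: "D 3 (D 2 (D 1 (D 0 s))) i j k \<noteq> 0"
      have in_s: "s i j k \<noteq> 0"
        using nz by (auto simp: D_def E_def split: if_splits)
      then have "i \<in> I" "j \<in> I" "k \<in> I" using tensors_in[OF s] by blast+
      then have "i \<in> B r \<or> j \<in> B r \<or> k \<in> B r" if "r = 0 \<or> r = 1 \<or> r = 2 \<or> r = 3" for r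
        using nz that by (auto simp: D_def E_def split: if_splits)
      then have "i \<in> B 0 \<or> j \<in> B 0 \<or> k \<in> B 0" "i \<in> B 1 \<or> j \<in> B 1 \<or> k \<in> B 1"
        "i \<in> B 2 \<or> j \<in> B 2 \<or> k \<in> B 2" "i \<in> B 3 \<or> j \<in> B 3 \<or> k \<in> B 3" by auto
      moreover have "B 0 \<inter> B 1 = {}" "B 0 \<inter> B 2 = {}" "B 0 \<inter> B 3 = {}" "B 1 \<inter> B 2 = {}"
        "B 1 \<inter> B 3 = {}" "B 2 \<inter> B 3 = {}" using disj by fastforce+
      ultimately show False by blast
    qed
    then have z: "D 3 (D 2 (D 1 (D 0 s))) = (\<lambda>i j k. 0)" by (intro ext)
    have 3: "\<Phi> (D 2 (D 1 (D 0 s))) = (\<lambda>i j k. c * D 2 (D 1 (D 0 s)) i j k)"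
      by (rule step[OF D[OF D[OF D[OF s]]], of 3]) (use z map_zero in simp_all)
    have 2: "\<Phi> (D 1 (D 0 s)) = (\<lambda>i j k. c * D 1 (D 0 s) i j k)"
      by (rule step[OF D[OF D[OF s]] _ 3]) simp
    have 1: "\<Phi> (D 0 s) = (\<lambda>i j k. c * D 0 s i j k)"
      by (rule step[OF D[OF s] _ 2]) simp
    show ?thesis by (rule step[OF s _ 1]) simp
  qed
  obtain w where w: "w \<in> I" "w \<noteq> x0" using fresh[of "{x0}"] by auto
  define a where "a = (\<lambda>i. if i = x0 then 1 else 0 :: int)"
  have a: "a \<in> fin_vec I" using x0 by (auto simp: fin_vec_def a_def)
  \<comment> \<open>The inner tensor of \<open>a\<close> is fixed, and its entry at
    \<open>(w, x0, w)\<close> is 1.\<close>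
  have "c = 1"
    using fun_cong[OF fun_cong[OF fun_cong[OF inner[OF a, unfolded sc[OF inner_tensor_tensors[OF a]]], of w], of x0], of w] w
    by (simp add: inner_tensor_def a_def)
  then show ?thesis using sc[OF s] by simp
qed

end


subsection \<open>Automorphisms of a free class two group\<close>

text \<open>
  \<open>e\<close> and \<open>q\<close> are the coefficients of degree one and two of the Magnus expansion
  \<open>x\<^sub>i \<mapsto> 1 + X\<^sub>i\<close>.
\<close>

locale free_class_two = group N for N (structure) +
  fixes I :: "'i set" and x :: "'i \<Rightarrow> 'a" and e :: "'a \<Rightarrow> 'i \<Rightarrow> int" and q :: "'a \<Rightarrow> 'i \<Rightarrow> 'i \<Rightarrow> int"
  assumes infinite_basis: "infinite I"
    and x_closed [simp]: "i \<in> I \<Longrightarrow> x i \<in> carrier N"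
    and generated: "carrier N \<subseteq> generate N (x ` I)"
    and e_mult [simp]: "m \<in> carrier N \<Longrightarrow> n \<in> carrier N \<Longrightarrow> e (m \<otimes> n) i = e m i + e n i"
    and q_mult [simp]: "m \<in> carrier N \<Longrightarrow> n \<in> carrier N \<Longrightarrow>
      q (m \<otimes> n) i j = q m i j + q n i j + e m i * e n j"
    and e_x [simp]: "i \<in> I \<Longrightarrow> e (x i) j = (if i = j then 1 else 0)"
    and q_x [simp]: "i \<in> I \<Longrightarrow> q (x i) j k = 0"
    and coordinates: "m \<in> carrier N \<Longrightarrow> n \<in> carrier N \<Longrightarrow> (\<And>i. e m i = e n i) \<Longrightarrow>
      (\<And>i j. q m i j = q n i j) \<Longrightarrow> m = n"
    and extend: "f \<in> I \<rightarrow> carrier N \<Longrightarrow> \<exists>h \<in> hom N N. \<forall>i\<in>I. h (x i) = f i"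
begin

section \<open>Coordinates of elements and of their images under endomorphisms\<close>

lemma fresh: "finite F \<Longrightarrow> \<exists>i\<in>I. i \<notin> F"
  using infinite_basis by (meson finite_subset subsetI)

lemma basis_induct [consumes 1, case_names one basis inv mult]:
  assumes "n \<in> carrier N" "P \<one>" "\<And>i. i \<in> I \<Longrightarrow> P (x i)"
    "\<And>m. m \<in> carrier N \<Longrightarrow> P m \<Longrightarrow> P (inv m)"
    "\<And>m n. m \<in> carrier N \<Longrightarrow> n \<in> carrier N \<Longrightarrow> P m \<Longrightarrow> P n \<Longrightarrow> P (m \<otimes> n)"
  shows "P n"
proof -
  have "n \<in> generate N (x ` I)" using generated assms(1) by blast
  then have "n \<in> carrier N \<and> P n"
    by (induction rule: generate.induct) (use assms in auto)
  then show ?thesis ..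
qed

lemma e_one [simp]: "e \<one> i = 0"
  using e_mult[of \<one> \<one> i] by simp

lemma q_one [simp]: "q \<one> i j = 0"
  using q_mult[of \<one> \<one> i j] by simp

lemma e_inv [simp]: "n \<in> carrier N \<Longrightarrow> e (inv n) i = - e n i"
  using e_mult[of n "inv n" i] by (simp del: e_mult)

lemma q_inv [simp]: "n \<in> carrier N \<Longrightarrow> q (inv n) i j = - q n i j + e n i * e n j"
  using q_mult[of n "inv n" i j] by (simp del: q_mult)

lemma q_conj: "m \<in> carrier N \<Longrightarrow> n \<in> carrier N \<Longrightarrow>
    q (m \<otimes> n \<otimes> inv m) i j = q n i j + e m i * e n j - e n i * e m j"
  by (simp add: algebra_simps)

lemma e_int_pow [simp]:
  assumes n: "n \<in> carrier N" shows "e (n [^] (c::int)) i = c * e n i"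
proof -
  have p: "e (n [^] (k::nat)) i = int k * e n i" for k
    by (induction k) (use n in \<open>auto simp: algebra_simps\<close>)
  show ?thesis using n p by (cases c rule: int_cases2) (auto simp: int_pow_int int_pow_neg_int)
qed

lemma q_int_pow:
  assumes n: "n \<in> carrier N" and z: "\<And>i. e n i = 0" shows "q (n [^] (c::int)) i j = c * q n i j"
proof -
  have p: "q (n [^] (k::nat)) i j = int k * q n i j" for k
    by (induction k) (use n z in \<open>auto simp: algebra_simps\<close>)
  have "e (n [^] (k::nat)) i = 0" for k i
    using e_int_pow[OF n, of "int k" i] z by (simp add: int_pow_int)
  then show ?thesis using n p by (cases c rule: int_cases2) (auto simp: int_pow_int int_pow_neg_int)
qed

lemma e_fin: "n \<in> carrier N \<Longrightarrow> e n \<in> fin_vec I"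
proof (induction rule: basis_induct)
  case (mult m n)
  then have f: "finite ({i. e m i \<noteq> 0} \<union> {i. e n i \<noteq> 0})" "{i. e m i \<noteq> 0} \<subseteq> I" "{i. e n i \<noteq> 0} \<subseteq> I"
    by (auto simp: fin_vec_def)
  have "{i. e (m \<otimes> n) i \<noteq> 0} \<subseteq> {i. e m i \<noteq> 0} \<union> {i. e n i \<noteq> 0}" using mult by auto
  then show ?case using f finite_subset unfolding fin_vec_def by blast
next
  case (basis i)
  have "{j. e (x i) j \<noteq> 0} \<subseteq> {i}" using basis by auto
  then show ?case using basis finite_subset unfolding fin_vec_def by blast
qed (auto simp: fin_vec_def)

lemma e_out: "n \<in> carrier N \<Longrightarrow> i \<notin> I \<Longrightarrow> e n i = 0"
  using e_fin by (auto simp: fin_vec_def)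

lemma e_finite: "n \<in> carrier N \<Longrightarrow> finite {i. e n i \<noteq> 0}"
  using e_fin by (auto simp: fin_vec_def)

lemma q_out: "n \<in> carrier N \<Longrightarrow> q n i j \<noteq> 0 \<Longrightarrow> i \<in> I \<and> j \<in> I"
proof (induction rule: basis_induct)
  case (mult m n)
  then have "q m i j \<noteq> 0 \<or> q n i j \<noteq> 0 \<or> e m i \<noteq> 0 \<and> e n j \<noteq> 0" by auto
  then show ?case using mult e_out by blast
next
  case (inv m)
  then have "q m i j \<noteq> 0 \<or> e m i \<noteq> 0 \<and> e m j \<noteq> 0" by auto
  then show ?case using inv e_out by blast
qed auto

lemma q_finite: "n \<in> carrier N \<Longrightarrow> finite {(i, j). q n i j \<noteq> 0}"
proof (induction rule: basis_induct)
  case (mult m n)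
  have "{(i, j). q (m \<otimes> n) i j \<noteq> 0} \<subseteq> {(i, j). q m i j \<noteq> 0} \<union> {(i, j). q n i j \<noteq> 0} \<union>
      {i. e m i \<noteq> 0} \<times> {i. e n i \<noteq> 0}"
    using mult by auto
  then show ?case by (rule finite_subset) (use mult e_finite in auto)
next
  case (inv m)
  have "{(i, j). q (inv m) i j \<noteq> 0} \<subseteq> {(i, j). q m i j \<noteq> 0} \<union> {i. e m i \<noteq> 0} \<times> {i. e m i \<noteq> 0}"
    using inv by auto
  then show ?case by (rule finite_subset) (use inv e_finite in auto)
qed auto

text \<open>The shuffle relation for Magnus coefficients; for \<open>i = j\<close> it says that
  \<open>q n i i\<close> is the binomial coefficient of \<open>e n i\<close> over 2. The symmetric
  part of \<open>q\<close> is determined by \<open>e\<close>, so changes of \<open>q\<close> that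
  leave \<open>e\<close> alone are antisymmetric.\<close>

lemma q_sym:
  "n \<in> carrier N \<Longrightarrow> q n i j + q n j i = e n i * e n j - (if i = j then e n i else 0)"
  by (induction rule: basis_induct) (auto simp: algebra_simps)

text \<open>The device behind the coordinate formulas for homomorphisms: a candidate with the right
  multiplication law and the right values on the basis must be the coordinate of the image, by
  induction over words. Its values on inverses follow from the multiplication law.\<close>

lemma coordinate_hom_e:
  assumes h: "h \<in> hom N N" and n: "n \<in> carrier N"
    and mult: "\<And>m n i. m \<in> carrier N \<Longrightarrow> n \<in> carrier N \<Longrightarrow> E (m \<otimes> n) i = E m i + E n i"
    and basis: "\<And>k i. k \<in> I \<Longrightarrow> E (x k) i = e (h (x k)) i"
  shows "e (h n) i = (E n i :: int)"
proof -
  interpret h: group_hom N N h by unfold_locales (rule h)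
  have one: "E \<one> i = 0" for i using mult[of \<one> \<one> i] by simp
  have inv: "E (inv n) i = - E n i" if "n \<in> carrier N" for n i
    using mult[of n "inv n" i] that one by simp
  show ?thesis using n
    by (induction rule: basis_induct) (auto simp: one inv mult basis)
qed

lemma coordinate_hom_q:
  assumes h: "h \<in> hom N N" and n: "n \<in> carrier N"
    and mult: "\<And>m n i j. m \<in> carrier N \<Longrightarrow> n \<in> carrier N \<Longrightarrow>
      Q (m \<otimes> n) i j = Q m i j + Q n i j + e (h m) i * e (h n) j"
    and basis: "\<And>k i j. k \<in> I \<Longrightarrow> Q (x k) i j = q (h (x k)) i j"
  shows "q (h n) i j = (Q n i j :: int)"
proof -
  interpret h: group_hom N N h by unfold_locales (rule h)
  have one: "Q \<one> i j = 0" for i j using mult[of \<one> \<one> i j] by simp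
  have inv: "Q (inv n) i j = - Q n i j + e (h n) i * e (h n) j" if "n \<in> carrier N" for n i j
    using mult[of n "inv n" i j] that one by simp
  show ?thesis using n
    by (induction rule: basis_induct) (auto simp: one inv mult basis)
qed

lemma hom_eqI:
  assumes h: "h \<in> hom N N" and h': "h' \<in> hom N N" and n: "n \<in> carrier N"
    and eq: "\<And>i. i \<in> I \<Longrightarrow> h (x i) = h' (x i)"
  shows "h n = h' n"
proof -
  interpret h: group_hom N N h by unfold_locales (rule h)
  interpret h': group_hom N N h' by unfold_locales (rule h')
  show ?thesis using n by (induction rule: basis_induct) (auto simp: eq)
qed

lemma finite_support_mult: "finite {i. e n i \<noteq> 0} \<Longrightarrow> finite {i. e n i * f i \<noteq> 0}"
  by (rule finite_subset) auto

lemma Sum_any_mult: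
  assumes "m \<in> carrier N" "n \<in> carrier N"
  shows "Sum_any (\<lambda>i. e (m \<otimes> n) i * f i) = Sum_any (\<lambda>i. e m i * f i) + Sum_any (\<lambda>i. e n i * f i)"
proof -
  have "Sum_any (\<lambda>i. e m i * f i + e n i * f i) = Sum_any (\<lambda>i. e m i * f i) + Sum_any (\<lambda>i. e n i * f i)"
    by (rule Sum_any.distrib) (use assms e_finite finite_support_mult in auto)
  then show ?thesis using assms by (simp add: distrib_right)
qed

lemma Sum_any_x: "k \<in> I \<Longrightarrow> Sum_any (\<lambda>i. e (x k) i * f i) = (f k :: int)"
proof -
  assume k: "k \<in> I"
  have "Sum_any (\<lambda>i. e (x k) i * f i) = (\<Sum>i\<in>{k}. e (x k) i * f i)"
    by (rule Sum_any.expand_superset) (use k in auto)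
  then show ?thesis using k by simp
qed

lemma e_hom:
  assumes h: "h \<in> hom N N" and n: "n \<in> carrier N"
  shows "e (h n) j = Sum_any (\<lambda>i. e n i * e (h (x i)) j)"
  by (rule coordinate_hom_e[OF h n]) (simp_all add: Sum_any_mult Sum_any_x del: e_mult e_x)

lemma e_hom_cong:
  assumes h: "h \<in> hom N N" and "n \<in> carrier N" "m \<in> carrier N" "\<And>i. e n i = e m i"
  shows "e (h n) j = e (h m) j"
  using assms by (simp add: e_hom)

text \<open>As \<open>h\<close> is the identity in degree one, it changes \<open>q\<close> by a
  correction that is additive in \<open>n\<close> and hence linear in \<open>e n\<close>.\<close>

lemma q_hom_unipotent:
  assumes h: "h \<in> hom N N" and u: "\<And>n i. n \<in> carrier N \<Longrightarrow> e (h n) i = e n i" and n: "n \<in> carrier N"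
  shows "q (h n) j k = q n j k + Sum_any (\<lambda>i. e n i * q (h (x i)) j k)"
  by (rule coordinate_hom_q[OF h n]) (simp_all add: u Sum_any_mult Sum_any_x del: e_mult e_x)

lemma unipotentI:
  assumes h: "h \<in> hom N N" and u: "\<And>k i. k \<in> I \<Longrightarrow> e (h (x k)) i = e (x k) i" and n: "n \<in> carrier N"
  shows "e (h n) i = e n i"
  by (rule coordinate_hom_e[OF h n]) (simp_all add: u del: e_x)

section \<open>The automorphism group and its elements\<close>

abbreviation A where "A \<equiv> AutoGroup N"

abbreviation A_times (infixl "\<star>" 70) where "g \<star> h \<equiv> g \<otimes>\<^bsub>A\<^esub> h"

lemma carrier_A: "carrier A = auto N" by (simp add: AutoGroup_def)

lemma auto_hom: "g \<in> auto N \<Longrightarrow> g \<in> hom N N" by (simp add: auto_def)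

lemma auto_closed [simp]: "g \<in> auto N \<Longrightarrow> n \<in> carrier N \<Longrightarrow> g n \<in> carrier N"
  using auto_hom by (auto simp: hom_def)

lemma auto_mult [simp]: "g \<in> auto N \<Longrightarrow> m \<in> carrier N \<Longrightarrow> n \<in> carrier N \<Longrightarrow> g (m \<otimes> n) = g m \<otimes> g n"
  using auto_hom by (auto simp: hom_def)

lemma auto_one [simp]: "g \<in> auto N \<Longrightarrow> g \<one> = \<one>"
  using hom_one[OF auto_hom] is_group by blast

lemma auto_inv [simp]: "g \<in> auto N \<Longrightarrow> n \<in> carrier N \<Longrightarrow> g (inv n) = inv (g n)"
  using group_hom.hom_inv[of N N g n] auto_hom by (simp add: group_hom_def group_hom_axioms_def is_group)

lemma auto_int_pow: "g \<in> auto N \<Longrightarrow> n \<in> carrier N \<Longrightarrow> g (n [^] (c::int)) = g n [^] c"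
  using hom_int_pow[OF auto_hom _ is_group is_group] by simp

sublocale A: group A by (rule AutoGroup)

lemma A_closed [simp]: "g \<in> auto N \<Longrightarrow> h \<in> auto N \<Longrightarrow> g \<star> h \<in> auto N"
  "g \<in> auto N \<Longrightarrow> inv\<^bsub>A\<^esub> g \<in> auto N" "\<one>\<^bsub>A\<^esub> \<in> auto N"
  using A.m_closed A.inv_closed A.one_closed by (simp_all add: carrier_A)

lemma A_mult [simp]:
  assumes "g \<in> auto N" "h \<in> auto N" "n \<in> carrier N" shows "(g \<star> h) n = g (h n)"
  using assms by (simp add: AutoGroup_def BijGroup_def auto_def compose_def)

lemma A_one [simp]: "n \<in> carrier N \<Longrightarrow> \<one>\<^bsub>A\<^esub> n = n"
  by (simp add: AutoGroup_def BijGroup_def)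

lemma A_inv [simp]:
  assumes "g \<in> auto N" "n \<in> carrier N" shows "g ((inv\<^bsub>A\<^esub> g) n) = n" "(inv\<^bsub>A\<^esub> g) (g n) = n"
  using A_mult[of g "inv\<^bsub>A\<^esub> g" n] A_mult[of "inv\<^bsub>A\<^esub> g" g n] assms A.r_inv[of g] A.l_inv[of g]
  by (simp_all add: carrier_A del: A_mult)

lemma auto_eqI:
  assumes "g \<in> auto N" "h \<in> auto N" "\<And>i. i \<in> I \<Longrightarrow> g (x i) = h (x i)"
  shows "g = h"
proof -
  have "g n = h n" if "n \<in> carrier N" for n
    using hom_eqI[OF auto_hom auto_hom that] assms by blast
  moreover have "g \<in> extensional (carrier N)" "h \<in> extensional (carrier N)"
    using assms by (auto simp: auto_def Bij_def)
  ultimately show ?thesis by (meson extensionalityI)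
qed

lemma auto_exists:
  assumes h: "h \<in> hom N N" and h': "h' \<in> hom N N"
    and l: "\<And>i. i \<in> I \<Longrightarrow> h' (h (x i)) = x i" and r: "\<And>i. i \<in> I \<Longrightarrow> h (h' (x i)) = x i"
  obtains g where "g \<in> auto N" "\<And>n. n \<in> carrier N \<Longrightarrow> g n = h n"
    "\<And>n. n \<in> carrier N \<Longrightarrow> (inv\<^bsub>A\<^esub> g) n = h' n"
proof -
  interpret h: group_hom N N h by unfold_locales (rule h)
  interpret h': group_hom N N h' by unfold_locales (rule h')
  have id: "(\<lambda>n. n) \<in> hom N N" by (auto simp: hom_def)
  have L: "h' (h n) = n" if n: "n \<in> carrier N" for n
  proof -
    have "compose (carrier N) h' h n = n"
      by (rule hom_eqI[OF hom_compose[OF h h'] id n]) (simp add: compose_def l)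
    then show ?thesis using n by (simp add: compose_def)
  qed
  have R: "h (h' n) = n" if n: "n \<in> carrier N" for n
  proof -
    have "compose (carrier N) h h' n = n"
      by (rule hom_eqI[OF hom_compose[OF h' h] id n]) (simp add: compose_def r)
    then show ?thesis using n by (simp add: compose_def)
  qed
  define g where "g = restrict h (carrier N)"
  have "bij_betw g (carrier N) (carrier N)"
    by (rule bij_betwI[of _ _ _ h']) (simp_all add: g_def L R)
  moreover have "g \<in> hom N N" by (rule homI) (simp_all add: g_def)
  moreover have "g \<in> extensional (carrier N)" by (simp add: g_def)
  ultimately have g: "g \<in> auto N" by (simp add: auto_def Bij_def)
  have gn: "g n = h n" if "n \<in> carrier N" for n using that by (simp add: g_def)
  have "(inv\<^bsub>A\<^esub> g) n = h' n" if "n \<in> carrier N" for n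
    using A_inv(2)[OF g, of "h' n"] gn[of "h' n"] R[OF that] that by simp
  then show thesis using that g gn by blast
qed

section \<open>Automorphisms acting trivially on the abelianisation, and their tensors\<close>

definition IA where "IA = {\<alpha> \<in> auto N. \<forall>n\<in>carrier N. \<forall>i. e (\<alpha> n) i = e n i}"

text \<open>Because \<open>\<alpha>\<close> fixes degree one and \<open>q (x i)\<close> vanishes,
  the row \<open>i\<close> consists of the degree two coordinates of
  \<open>inv (x i) \<otimes> \<alpha> (x i)\<close>, an element without degree one part.\<close>

definition tens :: "('a \<Rightarrow> 'a) \<Rightarrow> 'i tensor" where
  "tens \<alpha> = (\<lambda>i j k. if i \<in> I then q (\<alpha> (x i)) j k else 0)"

lemma IA_auto [simp]: "\<alpha> \<in> IA \<Longrightarrow> \<alpha> \<in> auto N"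
  unfolding IA_def by blast

lemma in_IA: "g \<in> auto N \<Longrightarrow> (\<And>n i. n \<in> carrier N \<Longrightarrow> e (g n) i = e n i) \<Longrightarrow> g \<in> IA"
  unfolding IA_def by blast

lemma extendE:
  assumes "\<And>i. i \<in> I \<Longrightarrow> f i \<in> carrier N"
  obtains h where "h \<in> hom N N" "\<And>i. i \<in> I \<Longrightarrow> h (x i) = f i"
  using extend[of f] assms by blast

lemma IA_e [simp]: "\<alpha> \<in> IA \<Longrightarrow> n \<in> carrier N \<Longrightarrow> e (\<alpha> n) i = e n i"
  unfolding IA_def by blast

lemma IA_I:
  assumes g: "g \<in> auto N" and u: "\<And>k i. k \<in> I \<Longrightarrow> e (g (x k)) i = (if k = i then 1 else 0)"
  shows "g \<in> IA"
proof -
  have "e (g n) i = e n i" if "n \<in> carrier N" for n i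
    by (rule unipotentI[OF auto_hom[OF g] _ that]) (simp add: u)
  then show ?thesis using in_IA[OF g] by blast
qed

lemma IA_q:
  assumes a: "\<alpha> \<in> IA" and n: "n \<in> carrier N"
  shows "q (\<alpha> n) j k = q n j k + Sum_any (\<lambda>i. e n i * tens \<alpha> i j k)"
proof -
  have "Sum_any (\<lambda>i. e n i * q (\<alpha> (x i)) j k) = Sum_any (\<lambda>i. e n i * tens \<alpha> i j k)"
    by (rule Sum_any.cong) (use e_out[OF n] in \<open>auto simp: tens_def\<close>)
  then show ?thesis using q_hom_unipotent[OF auto_hom _ n, of \<alpha> j k] a by simp
qed

lemma tens_tensors:
  assumes a: "\<alpha> \<in> IA" shows "tens \<alpha> \<in> tensors I"
proof (rule tensorsI)
  fix i j k
  show "tens \<alpha> i j k \<noteq> 0 \<Longrightarrow> i \<in> I \<and> j \<in> I \<and> k \<in> I"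
    using q_out[of "\<alpha> (x i)" j k] a by (auto simp: tens_def split: if_splits)
  show "tens \<alpha> i j k = - tens \<alpha> i k j"
    using q_sym[of "\<alpha> (x i)" j k] a by (auto simp: tens_def split: if_splits)
  show "finite {(j, k). tens \<alpha> i j k \<noteq> 0}"
    using q_finite[of "\<alpha> (x i)"] a by (cases "i \<in> I") (auto simp: tens_def)
qed

lemma IA_eqI:
  assumes "\<alpha> \<in> IA" "\<beta> \<in> IA" "tens \<alpha> = tens \<beta>" shows "\<alpha> = \<beta>"
proof (rule auto_eqI)
  fix i assume i: "i \<in> I"
  have "q (\<alpha> (x i)) j k = q (\<beta> (x i)) j k" for j k
    using fun_cong[OF fun_cong[OF fun_cong[OF assms(3), of i], of j], of k] i by (simp add: tens_def)
  then show "\<alpha> (x i) = \<beta> (x i)"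
    by (intro coordinates) (use assms i in simp_all)
qed (use assms in auto)

lemma IA_mult: "\<alpha> \<in> IA \<Longrightarrow> \<beta> \<in> IA \<Longrightarrow> \<alpha> \<star> \<beta> \<in> IA"
  by (rule IA_I) auto

lemma IA_inv: "\<alpha> \<in> IA \<Longrightarrow> inv\<^bsub>A\<^esub> \<alpha> \<in> IA"
proof -
  assume a: "\<alpha> \<in> IA"
  have "e ((inv\<^bsub>A\<^esub> \<alpha>) n) i = e n i" if "n \<in> carrier N" for n i
    using IA_e[OF a, of "(inv\<^bsub>A\<^esub> \<alpha>) n" i] a that by simp
  then show ?thesis using a by (intro in_IA) auto
qed

lemma IA_one: "\<one>\<^bsub>A\<^esub> \<in> IA"
  by (rule IA_I) auto

text \<open>\<open>\<alpha>\<close> changes \<open>q\<close> by an amount that depends only on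
  \<open>e\<close>, and \<open>\<beta>\<close> does not change \<open>e\<close>; so the corrections
  add up.\<close>

lemma tens_mult:
  assumes "\<alpha> \<in> IA" "\<beta> \<in> IA"
  shows "tens (\<alpha> \<star> \<beta>) = (\<lambda>i j k. tens \<alpha> i j k + tens \<beta> i j k)"
proof (intro ext)
  fix i j k
  show "tens (\<alpha> \<star> \<beta>) i j k = tens \<alpha> i j k + tens \<beta> i j k"
  proof (cases "i \<in> I")
    case True
    then have "q (\<alpha> (\<beta> (x i))) j k = q (\<beta> (x i)) j k + Sum_any (\<lambda>l. e (x i) l * tens \<alpha> l j k)"
      using assms by (simp add: IA_q[OF assms(1), of "\<beta> (x i)"] del: e_x)
    also have "Sum_any (\<lambda>l. e (x i) l * tens \<alpha> l j k) = tens \<alpha> i j k"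
      by (rule Sum_any_x[OF True])
    finally show ?thesis using True assms by (simp add: tens_def)
  qed (simp add: tens_def)
qed

lemma tens_one: "tens \<one>\<^bsub>A\<^esub> = (\<lambda>i j k. 0)"
  by (auto simp: tens_def fun_eq_iff)

lemma tens_inv:
  assumes "\<alpha> \<in> IA" shows "tens (inv\<^bsub>A\<^esub> \<alpha>) = (\<lambda>i j k. - tens \<alpha> i j k)"
proof (intro ext)
  fix i j k
  have "\<alpha> \<star> inv\<^bsub>A\<^esub> \<alpha> = \<one>\<^bsub>A\<^esub>" using A.r_inv assms by (simp add: carrier_A)
  then have "(\<lambda>i j k. tens \<alpha> i j k + tens (inv\<^bsub>A\<^esub> \<alpha>) i j k) = (\<lambda>i j k. 0)"
    using tens_mult[OF assms IA_inv[OF assms]] tens_one by simp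
  from fun_cong[OF fun_cong[OF fun_cong[OF this, of i], of j], of k]
  show "tens (inv\<^bsub>A\<^esub> \<alpha>) i j k = - tens \<alpha> i j k" by simp
qed

lemma IA_comm:
  assumes "\<alpha> \<in> IA" "\<beta> \<in> IA" shows "\<alpha> \<star> \<beta> = \<beta> \<star> \<alpha>"
  by (rule IA_eqI) (use assms in \<open>simp_all add: IA_mult tens_mult add.commute\<close>)

lemma tens_int_pow:
  assumes "\<alpha> \<in> IA" shows "\<alpha> [^]\<^bsub>A\<^esub> (c::int) \<in> IA \<and> tens (\<alpha> [^]\<^bsub>A\<^esub> c) = (\<lambda>i j k. c * tens \<alpha> i j k)"
proof -
  have a: "\<alpha> \<in> carrier A" using assms by (simp add: carrier_A)
  have p: "\<alpha> [^]\<^bsub>A\<^esub> (n::nat) \<in> IA \<and> tens (\<alpha> [^]\<^bsub>A\<^esub> n) = (\<lambda>i j k. int n * tens \<alpha> i j k)" for n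
    by (induction n) (use assms in \<open>auto simp: IA_one tens_one IA_mult tens_mult algebra_simps\<close>)
  show ?thesis
    using p a by (cases c rule: int_cases2)
      (auto simp: int_pow_int A.int_pow_neg_int IA_inv tens_inv)
qed

lemma IA_conj:
  assumes g: "g \<in> auto N" and a: "\<alpha> \<in> IA"
  shows "g \<star> \<alpha> \<star> inv\<^bsub>A\<^esub> g \<in> IA"
proof -
  have "e (g (\<alpha> ((inv\<^bsub>A\<^esub> g) n))) i = e (g ((inv\<^bsub>A\<^esub> g) n)) i" if "n \<in> carrier N" for n i
    by (rule e_hom_cong[OF auto_hom[OF g]]) (use g a that in auto)
  then show ?thesis using g a by (intro in_IA) auto
qed

section \<open>Elements and automorphisms with prescribed coordinates\<close>

lemma forms_realised:
  assumes "r \<in> forms I"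
  shows "\<exists>z\<in>carrier N. (\<forall>i. e z i = 0) \<and> q z = r"
  using assms
proof (induction rule: form_induct)
  case zero
  show ?case by (rule bexI[of _ \<one>]) auto
next
  case (add r c s t)
  then obtain z where z: "z \<in> carrier N" "\<And>i. e z i = 0" "q z = r" by blast
  \<comment> \<open>This commutator realises \<open>s \<and> t\<close>; its degree one part
    vanishes, so that taking powers multiplies \<open>q\<close>.\<close>
  let ?c = "x s \<otimes> x t \<otimes> inv (x s) \<otimes> inv (x t)"
  have c: "?c \<in> carrier N" "\<And>i. e ?c i = 0" using add.hyps by simp_all
  have "q ?c i j = wedge s t i j" for i j
    using add.hyps by (auto simp: wedge_def)
  then have "q (z \<otimes> ?c [^] c) = (\<lambda>j k. r j k + c * wedge s t j k)"
    using z c by (auto simp: fun_eq_iff q_int_pow[OF c])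
  then show ?case using z c by (intro bexI[of _ "z \<otimes> ?c [^] c"]) simp_all
qed

lemma vector_realised:
  assumes "a \<in> fin_vec I" shows "\<exists>n\<in>carrier N. e n = a"
proof -
  have "\<And>a. a \<in> fin_vec I \<Longrightarrow> {i. a i \<noteq> 0} \<subseteq> F \<Longrightarrow> \<exists>n\<in>carrier N. e n = a" if "finite F" for F
    using that
  proof (induction F)
    case empty
    then show ?case by (intro bexI[of _ \<one>]) auto
  next
    case (insert i F)
    show ?case
    proof (cases "i \<in> I")
      case True
      let ?a = "\<lambda>j. a j - a i * e (x i) j"
      have sub: "{j. ?a j \<noteq> 0} \<subseteq> {j. a j \<noteq> 0} - {i}" using True by auto
      then have "?a \<in> fin_vec I" using insert.prems(1) finite_subset unfolding fin_vec_def by blast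
      moreover have "{j. ?a j \<noteq> 0} \<subseteq> F" using sub insert.prems(2) by blast
      ultimately obtain n where "n \<in> carrier N" "e n = ?a" using insert.IH by blast
      then show ?thesis using True by (intro bexI[of _ "n \<otimes> x i [^] a i"]) auto
    next
      case False
      then show ?thesis using insert by (auto simp: fin_vec_def)
    qed
  qed
  then show ?thesis using assms by (auto simp: fin_vec_def)
qed

lemma tensors_realised:
  assumes s: "s \<in> tensors I" shows "\<exists>\<alpha>\<in>IA. tens \<alpha> = s"
proof -
  have "\<forall>i. \<exists>z. z \<in> carrier N \<and> (\<forall>j. e z j = 0) \<and> q z = s i"
    using forms_realised[OF forms_tensor[OF s]] by blast
  then obtain z where z: "\<And>i. z i \<in> carrier N" "\<And>i j. e (z i) j = 0" "\<And>i. q (z i) = s i" by metis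
  obtain h where h: "h \<in> hom N N" "\<And>i. i \<in> I \<Longrightarrow> h (x i) = x i \<otimes> z i"
    by (rule extendE[of "\<lambda>i. x i \<otimes> z i"]) (use z(1) in auto)
  obtain h' where h': "h' \<in> hom N N" "\<And>i. i \<in> I \<Longrightarrow> h' (x i) = x i \<otimes> inv (z i)"
    by (rule extendE[of "\<lambda>i. x i \<otimes> inv (z i)"]) (use z(1) in auto)
  interpret h: group_hom N N h by unfold_locales (rule h(1))
  interpret h': group_hom N N h' by unfold_locales (rule h'(1))
  have e: "e (h n) i = e n i" "e (h' n) i = e n i" if "n \<in> carrier N" for n i
    by (rule unipotentI[OF h(1) _ that] unipotentI[OF h'(1) _ that]; use h h' z in simp)+
  \<comment> \<open>The elements \<open>z i\<close> have no degree one part and are therefore fixed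
    by both homomorphisms, which makes these inverse to each other.\<close>
  have hz: "h (z i) = z i" "h' (z i) = z i" for i
    by (rule coordinates; use z e in \<open>simp add: q_hom_unipotent[OF h(1)] q_hom_unipotent[OF h'(1)]\<close>)+
  obtain \<alpha> where \<alpha>: "\<alpha> \<in> auto N" "\<And>n. n \<in> carrier N \<Longrightarrow> \<alpha> n = h n"
    by (rule auto_exists[OF h(1) h'(1)]) (use h h' hz z in \<open>auto simp: m_assoc\<close>)
  have "\<alpha> \<in> IA" by (rule in_IA[OF \<alpha>(1)]) (simp add: \<alpha> e)
  moreover have "tens \<alpha> = s"
    using \<alpha> h z tensors_out[OF s] by (auto simp: tens_def fun_eq_iff)
  ultimately show ?thesis by blast
qed

section \<open>Permutations, transvections and the inversion of the basis\<close>

lemma permutation_exists: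
  assumes pp: "\<And>i. p (p i) = i" and pI: "p ` I \<subseteq> I"
  obtains g where "g \<in> auto N" "inv\<^bsub>A\<^esub> g = g" "\<And>i. i \<in> I \<Longrightarrow> g (x i) = x (p i)"
    "\<And>n i. n \<in> carrier N \<Longrightarrow> e (g n) i = e n (p i)"
    "\<And>\<alpha>. \<alpha> \<in> IA \<Longrightarrow> tens (g \<star> \<alpha> \<star> inv\<^bsub>A\<^esub> g) = permute p (tens \<alpha>)"
proof -
  have pI': "p i \<in> I \<longleftrightarrow> i \<in> I" for i using pI pp by (metis image_subset_iff)
  obtain h where h: "h \<in> hom N N" "\<And>i. i \<in> I \<Longrightarrow> h (x i) = x (p i)"
    by (rule extendE[of "\<lambda>i. x (p i)"]) (use pI' in auto)
  obtain g where g: "g \<in> auto N" "\<And>n. n \<in> carrier N \<Longrightarrow> g n = h n"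
    "\<And>n. n \<in> carrier N \<Longrightarrow> (inv\<^bsub>A\<^esub> g) n = h n"
    by (rule auto_exists[OF h(1) h(1)]) (use h pI' pp in auto)
  have ginv: "inv\<^bsub>A\<^esub> g = g" by (rule auto_eqI) (use g in auto)
  have gx: "g (x i) = x (p i)" if "i \<in> I" for i using that g h by simp
  have eq: "k = p i \<longleftrightarrow> p k = i" for i k using pp by metis
  have ge: "e (g n) i = e n (p i)" if "n \<in> carrier N" for n i
    by (rule coordinate_hom_e[OF auto_hom[OF g(1)] that]) (simp_all add: gx pI' eq)
  have gq: "q (g n) i j = q n (p i) (p j)" if "n \<in> carrier N" for n i j
    by (rule coordinate_hom_q[OF auto_hom[OF g(1)] that]) (simp_all add: gx pI' ge)
  have "tens (g \<star> \<alpha> \<star> inv\<^bsub>A\<^esub> g) = permute p (tens \<alpha>)" if "\<alpha> \<in> IA" for \<alpha>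
    using g(1) that by (auto simp: tens_def permute_def fun_eq_iff ginv gx pI' gq)
  then show thesis using that g(1) ginv gx ge by blast
qed

lemma transvection_exists:
  assumes u: "u \<in> I" and v: "v \<in> I" and ne: "u \<noteq> v"
  obtains g where "g \<in> auto N"
    "\<And>n i. n \<in> carrier N \<Longrightarrow> e (g n) i = e n i + (if i = v then e n u else 0)"
    "\<And>n i. n \<in> carrier N \<Longrightarrow> e ((inv\<^bsub>A\<^esub> g) n) i = e n i - (if i = v then e n u else 0)"
    "\<And>\<alpha>. \<alpha> \<in> IA \<Longrightarrow> tens (g \<star> \<alpha> \<star> inv\<^bsub>A\<^esub> g) = transvect u v (tens \<alpha>)"
proof -
  obtain h where h: "h \<in> hom N N" "\<And>i. i \<in> I \<Longrightarrow> h (x i) = (if i = u then x u \<otimes> x v else x i)"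
    by (rule extendE[of "\<lambda>i. if i = u then x u \<otimes> x v else x i"]) (use u v in auto)
  obtain h' where h': "h' \<in> hom N N" "\<And>i. i \<in> I \<Longrightarrow> h' (x i) = (if i = u then x u \<otimes> inv (x v) else x i)"
    by (rule extendE[of "\<lambda>i. if i = u then x u \<otimes> inv (x v) else x i"]) (use u v in auto)
  interpret h: group_hom N N h by unfold_locales (rule h(1))
  interpret h': group_hom N N h' by unfold_locales (rule h'(1))
  obtain g where g: "g \<in> auto N" "\<And>n. n \<in> carrier N \<Longrightarrow> g n = h n"
    "\<And>n. n \<in> carrier N \<Longrightarrow> (inv\<^bsub>A\<^esub> g) n = h' n"
    by (rule auto_exists[OF h(1) h'(1)]) (use h h' u v ne in \<open>auto simp: m_assoc\<close>)
  have ge: "e (g n) i = e n i + (if i = v then e n u else 0)" if "n \<in> carrier N" for n i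
    by (rule coordinate_hom_e[OF auto_hom[OF g(1)] that]) (use u v ne in \<open>auto simp: g(2) h(2)\<close>)
  have gie: "e ((inv\<^bsub>A\<^esub> g) n) i = e n i - (if i = v then e n u else 0)" if "n \<in> carrier N" for n i
    by (rule coordinate_hom_e[OF auto_hom that]) (use g(1) u v ne in \<open>auto simp: g(3) h'(2)\<close>)
  \<comment> \<open>Besides the action on the tensor square there is a correction at
    \<open>(u, v)\<close>: the image \<open>x u \<otimes> x v\<close> of \<open>x u\<close> has the
    coordinate 1 there, although \<open>q (x u)\<close> vanishes.\<close>
  have gq: "q (g n) i j = q n i j + (if i = v then q n u j else 0) + (if j = v then q n i u else 0)
      + (if i = v \<and> j = v then q n u u else 0) + (if i = u \<and> j = v then e n u else 0)"
    if n: "n \<in> carrier N" for n i j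
  proof (rule coordinate_hom_q[OF auto_hom[OF g(1)] n])
    fix m n i j assume mn: "m \<in> carrier N" "n \<in> carrier N"
    show "q (m \<otimes> n) i j + (if i = v then q (m \<otimes> n) u j else 0) + (if j = v then q (m \<otimes> n) i u else 0)
        + (if i = v \<and> j = v then q (m \<otimes> n) u u else 0) + (if i = u \<and> j = v then e (m \<otimes> n) u else 0)
      = (q m i j + (if i = v then q m u j else 0) + (if j = v then q m i u else 0)
        + (if i = v \<and> j = v then q m u u else 0) + (if i = u \<and> j = v then e m u else 0))
      + (q n i j + (if i = v then q n u j else 0) + (if j = v then q n i u else 0)
        + (if i = v \<and> j = v then q n u u else 0) + (if i = u \<and> j = v then e n u else 0))
      + e (g m) i * e (g n) j"
      using mn ne by (cases "i = v"; cases "j = v"; cases "i = u") (simp_all add: ge algebra_simps)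
  next
    fix k i j assume k: "k \<in> I"
    show "q (x k) i j + (if i = v then q (x k) u j else 0) + (if j = v then q (x k) i u else 0)
        + (if i = v \<and> j = v then q (x k) u u else 0) + (if i = u \<and> j = v then e (x k) u else 0)
      = q (g (x k)) i j"
      using k u v ne by (cases "k = u") (auto simp: g(2) h(2))
  qed
  have "tens (g \<star> \<alpha> \<star> inv\<^bsub>A\<^esub> g) = transvect u v (tens \<alpha>)" if a: "\<alpha> \<in> IA" for \<alpha>
  proof (intro ext)
    fix i j k
    have d: "q (\<alpha> (x l)) m m = 0" if "l \<in> I" for l m
      using tensors_diag[OF tens_tensors[OF a], of l m] that by (simp add: tens_def)
    show "tens (g \<star> \<alpha> \<star> inv\<^bsub>A\<^esub> g) i j k = transvect u v (tens \<alpha>) i j k"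
    proof (cases "i \<in> I")
      case True
      show ?thesis
      proof (cases "i = u")
        case True
        then show ?thesis
          using u v ne a g(1) d
          by (cases "j = v"; cases "k = v"; cases "j = u")
            (simp_all add: tens_def transvect_def g(3) h'(2) gq ge)
      next
        case False
        then show ?thesis
          using True u v ne a g(1) d
          by (cases "j = v"; cases "k = v") (simp_all add: tens_def transvect_def g(3) h'(2) gq ge)
      qed
    next
      case False
      then show ?thesis using u by (auto simp: tens_def transvect_def)
    qed
  qed
  then show thesis using that g(1) ge gie by blast
qed

text \<open>Inverting the basis acts as -1 on the abelianisation and hence trivially on its exterior
  square, so conjugation negates every homomorphism from the former to the latter. An automorphism
  that maps basis elements to basis elements also respects their inverses, whence the last
  clause.\<close>

lemma symmetry_exists:
  obtains \<theta> where "\<theta> \<in> auto N" "inv\<^bsub>A\<^esub> \<theta> = \<theta>" "\<And>n i. n \<in> carrier N \<Longrightarrow> e (\<theta> n) i = - e n i"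
    "\<And>\<alpha>. \<alpha> \<in> IA \<Longrightarrow> \<theta> \<star> \<alpha> \<star> inv\<^bsub>A\<^esub> \<theta> = inv\<^bsub>A\<^esub> \<alpha>"
    "\<And>p g. (\<And>i. i \<in> I \<Longrightarrow> p i \<in> I) \<Longrightarrow> g \<in> auto N \<Longrightarrow> (\<And>i. i \<in> I \<Longrightarrow> g (x i) = x (p i)) \<Longrightarrow>
       g \<star> \<theta> = \<theta> \<star> g"
proof -
  obtain h where h: "h \<in> hom N N" "\<And>i. i \<in> I \<Longrightarrow> h (x i) = inv (x i)"
    by (rule extendE[of "\<lambda>i. inv (x i)"]) auto
  interpret h: group_hom N N h by unfold_locales (rule h(1))
  obtain \<theta> where t: "\<theta> \<in> auto N" "\<And>n. n \<in> carrier N \<Longrightarrow> \<theta> n = h n"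
    "\<And>n. n \<in> carrier N \<Longrightarrow> (inv\<^bsub>A\<^esub> \<theta>) n = h n"
    by (rule auto_exists[OF h(1) h(1)]) (use h in auto)
  have tinv: "inv\<^bsub>A\<^esub> \<theta> = \<theta>" by (rule auto_eqI) (use t in auto)
  have tx: "\<theta> (x i) = inv (x i)" if "i \<in> I" for i using that t h by simp
  have te: "e (\<theta> n) i = - e n i" if "n \<in> carrier N" for n i
    by (rule coordinate_hom_e[OF auto_hom[OF t(1)] that]) (simp_all add: tx)
  \<comment> \<open>The inverse of \<open>x i\<close> has the coordinate 1 at \<open>(i, i)\<close>,
    whence the correction on the diagonal.\<close>
  have tq: "q (\<theta> n) i j = q n i j + (if i = j then e n i else 0)" if "n \<in> carrier N" for n i j
    by (rule coordinate_hom_q[OF auto_hom[OF t(1)] that]) (simp_all add: tx te)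
  have c: "\<theta> \<star> \<alpha> \<star> inv\<^bsub>A\<^esub> \<theta> = inv\<^bsub>A\<^esub> \<alpha>" if a: "\<alpha> \<in> IA" for \<alpha>
  proof (rule IA_eqI[OF IA_conj[OF t(1) a] IA_inv[OF a]])
    show "tens (\<theta> \<star> \<alpha> \<star> inv\<^bsub>A\<^esub> \<theta>) = tens (inv\<^bsub>A\<^esub> \<alpha>)"
      unfolding tens_inv[OF a] using t(1) a by (auto simp: tens_def fun_eq_iff tinv tx tq te)
  qed
  have "g \<star> \<theta> = \<theta> \<star> g"
    if "\<And>i. i \<in> I \<Longrightarrow> p i \<in> I" "g \<in> auto N" "\<And>i. i \<in> I \<Longrightarrow> g (x i) = x (p i)" for p g
    by (rule auto_eqI) (use that t(1) in \<open>auto simp: tx\<close>)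
  then show thesis using that t(1) tinv te c by blast
qed

section \<open>Conjugations and the centre of the automorphism group\<close>

definition conj_by :: "'a \<Rightarrow> 'a \<Rightarrow> 'a" where
  "conj_by n = (\<lambda>m\<in>carrier N. n \<otimes> m \<otimes> inv n)"

lemma conj_by_apply [simp]: "m \<in> carrier N \<Longrightarrow> conj_by n m = n \<otimes> m \<otimes> inv n"
  by (simp add: conj_by_def)

lemma conj_by_IA [simp]: "n \<in> carrier N \<Longrightarrow> conj_by n \<in> IA"
proof -
  assume n: "n \<in> carrier N"
  have c: "inv n \<otimes> (n \<otimes> y) = y" "n \<otimes> (inv n \<otimes> y) = y" if "y \<in> carrier N" for y
    using n that by (simp_all add: m_assoc[symmetric])
  have "bij_betw (conj_by n) (carrier N) (carrier N)"
    by (rule bij_betwI[of _ _ _ "\<lambda>m. inv n \<otimes> m \<otimes> n"]) (use n c in \<open>auto simp: m_assoc\<close>)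
  moreover have "conj_by n \<in> hom N N"
    using n c by (auto simp: hom_def m_assoc)
  ultimately have "conj_by n \<in> auto N" by (auto simp: auto_def Bij_def conj_by_def)
  then show ?thesis by (rule in_IA) (use n in \<open>simp add: conj_by_def\<close>)
qed

lemma tens_conj_by: "n \<in> carrier N \<Longrightarrow> tens (conj_by n) = inner_tensor I (e n)"
  by (auto simp: tens_def inner_tensor_def conj_by_def fun_eq_iff q_conj simp del: q_mult)

lemma conj_by_mult: "m \<in> carrier N \<Longrightarrow> n \<in> carrier N \<Longrightarrow> conj_by (m \<otimes> n) = conj_by m \<star> conj_by n"
  by (rule auto_eqI) (auto simp: m_assoc inv_mult_group simp del: auto_mult)

lemma conj_by_inv: "n \<in> carrier N \<Longrightarrow> inv\<^bsub>A\<^esub> (conj_by n) = conj_by (inv n)"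
proof -
  assume n: "n \<in> carrier N"
  have "conj_by (inv n) \<star> conj_by n = \<one>\<^bsub>A\<^esub>"
    unfolding conj_by_mult[OF inv_closed[OF n] n, symmetric]
    by (rule auto_eqI) (use n in auto)
  then show ?thesis using A.inv_equality[of "conj_by (inv n)" "conj_by n"] n by (simp add: carrier_A)
qed

lemma conj_by_conj:
  assumes g: "g \<in> auto N" and n: "n \<in> carrier N"
  shows "g \<star> conj_by n \<star> inv\<^bsub>A\<^esub> g = conj_by (g n)"
  by (rule auto_eqI) (use g n in simp_all)

text \<open>The tensor of a conjugation remembers exactly the degree one part: for
  \<open>w \<noteq> i\<close> the entry of \<open>a \<and> w\<close> at \<open>(w, i, w)\<close> is
  the component of \<open>a\<close> at \<open>i\<close>.\<close>

lemma conj_by_eq_iff: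
  assumes m: "m \<in> carrier N" and n: "n \<in> carrier N"
  shows "conj_by m = conj_by n \<longleftrightarrow> (\<forall>i. e m i = e n i)"
proof
  assume "conj_by m = conj_by n"
  then have eq: "inner_tensor I (e m) = inner_tensor I (e n)"
    using tens_conj_by m n by metis
  show "\<forall>i. e m i = e n i"
  proof
    fix i
    obtain w where w: "w \<in> I" "w \<noteq> i" using fresh[of "{i}"] by auto
    show "e m i = e n i"
      using fun_cong[OF fun_cong[OF fun_cong[OF eq, of w], of i], of w] w
      by (simp add: inner_tensor_def)
  qed
next
  assume "\<forall>i. e m i = e n i"
  then have "e m = e n" by auto
  then have "tens (conj_by m) = tens (conj_by n)" using m n by (simp add: tens_conj_by)
  then show "conj_by m = conj_by n" by (intro IA_eqI) (use m n in auto)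
qed

lemma conj_by_int_pow:
  assumes n: "n \<in> carrier N" shows "conj_by n [^]\<^bsub>A\<^esub> (c::int) = conj_by (n [^] c)"
  by (rule IA_eqI)
    (use n tens_int_pow[of "conj_by n" c] in \<open>auto simp: tens_conj_by inner_tensor_def fun_eq_iff\<close>)

text \<open>Commuting with all conjugations puts a central \<open>z\<close> into \<open>IA\<close>,
  commuting with \<open>\<theta>\<close> makes it equal to its inverse, and tensors have no
  2-torsion.\<close>

lemma centre_A: "centre A = {\<one>\<^bsub>A\<^esub>}"
proof
  show "{\<one>\<^bsub>A\<^esub>} \<subseteq> centre A" by (auto simp: centre_def carrier_A[symmetric])
  show "centre A \<subseteq> {\<one>\<^bsub>A\<^esub>}"
  proof
    fix z assume "z \<in> centre A"
    then have z: "z \<in> auto N" and c: "\<And>g. g \<in> auto N \<Longrightarrow> z \<star> g = g \<star> z"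
      by (auto simp: centre_def carrier_A)
    have cz: "g \<star> z \<star> inv\<^bsub>A\<^esub> g = z" if "g \<in> auto N" for g
      using c[OF that] z that A.inv_solve_right'[of z "g \<star> z" g] by (simp add: carrier_A)
    have "e (z n) i = e n i" if n: "n \<in> carrier N" for n i
    proof -
      have "z \<star> conj_by n \<star> inv\<^bsub>A\<^esub> z = conj_by n"
        using c[of "conj_by n"] n z A.inv_solve_right'[of "conj_by n" "z \<star> conj_by n" z]
        by (simp add: carrier_A)
      then show ?thesis using conj_by_conj[OF z n] conj_by_eq_iff[of "z n" n] z n by simp
    qed
    then have zIA: "z \<in> IA" using in_IA[OF z] by blast
    obtain \<theta> where t: "\<theta> \<in> auto N" "\<And>\<alpha>. \<alpha> \<in> IA \<Longrightarrow> \<theta> \<star> \<alpha> \<star> inv\<^bsub>A\<^esub> \<theta> = inv\<^bsub>A\<^esub> \<alpha>"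
      using symmetry_exists by metis
    have "inv\<^bsub>A\<^esub> z = z" using cz[OF t(1)] t(2)[OF zIA] by simp
    then have "tens z = (\<lambda>i j k. - tens z i j k)" using tens_inv[OF zIA] by simp
    then have "tens z i j k = - tens z i j k" for i j k by metis
    then have "tens z = tens \<one>\<^bsub>A\<^esub>" unfolding tens_one by (intro ext) (metis equal_neg_zero)
    then show "z \<in> {\<one>\<^bsub>A\<^esub>}" using IA_eqI[OF zIA IA_one] by blast
  qed
qed

section \<open>Abelian normal subgroups of the automorphism group\<close>

lemma A_conj_apply:
  assumes "g \<in> auto N" "\<alpha> \<in> auto N" "n \<in> carrier N"
  shows "(g \<star> \<alpha> \<star> inv\<^bsub>A\<^esub> g) (g n) = g (\<alpha> n)"
  using assms by simp

text \<open>The transvection from \<open>z\<close> to \<open>y\<close> changes \<open>w\<close> in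
  degree one by \<open>e w z\<close> times the basis vector \<open>y\<close>. As \<open>b\<close>
  fixes the degree one parts of \<open>w\<close> and of its image, it fixes that of their
  difference, and the nonzero integer cancels.\<close>

lemma fixes_basis_mod_centre:
  assumes b: "b \<in> auto N" and w: "w \<in> carrier N"
    and inv: "\<And>g j. g \<in> auto N \<Longrightarrow> e (b (g w)) j = e (g w) j"
    and z: "z \<in> I" "e w z \<noteq> 0" and y: "y \<in> I" "y \<noteq> z"
  shows "e (b (x y)) j = e (x y) j"
proof -
  obtain g where g: "g \<in> auto N"
    "\<And>n i. n \<in> carrier N \<Longrightarrow> e (g n) i = e n i + (if i = y then e n z else 0)"
    using transvection_exists[OF z(1) y(1)] y(2) by metis
  let ?m = "g w \<otimes> inv w"
  have "e (b w) j = e w j" using inv[of "\<one>\<^bsub>A\<^esub>" j] w by simp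
  then have 1: "e (b ?m) j = e ?m j" using inv[OF g(1), of j] b w g(1) by simp
  have m: "e ?m i = e (x y [^] e w z) i" for i using g w y by simp
  have "e (b ?m) j = e (b (x y [^] e w z)) j"
    by (rule e_hom_cong[OF auto_hom[OF b]]) (use w g(1) y m in auto)
  then have "e (b (x y [^] e w z)) j = e (x y [^] e w z) j" using 1 m[of j] by (simp only:)
  then have "e w z * e (b (x y)) j = e w z * e (x y) j"
    using b y by (simp only: auto_int_pow e_int_pow x_closed auto_closed)
  then show ?thesis using z(2) by simp
qed

text \<open>
  On the abelianisation, commuting with the conjugations in \<open>B\<close> gives \<open>(b - 1)\<^sup>2 = 0\<close> for \<open>b\<close> in \<open>B\<close>.
  Applied to \<open>b c\<close> this yields \<open>(b - 1) (c - 1) = 0\<close>, and taking for \<open>c\<close> the conjugates of \<open>b\<close> we get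
  \<open>(b - 1) g (b - 1) = 0\<close> for all \<open>g\<close>.
\<close>

lemma abelian_normal_subset_IA:
  assumes B: "B \<subseteq> auto N"
    and conj: "\<And>g b. g \<in> auto N \<Longrightarrow> b \<in> B \<Longrightarrow> g \<star> b \<star> inv\<^bsub>A\<^esub> g \<in> B"
    and mult: "\<And>b c. b \<in> B \<Longrightarrow> c \<in> B \<Longrightarrow> b \<star> c \<in> B"
    and inv: "\<And>b. b \<in> B \<Longrightarrow> inv\<^bsub>A\<^esub> b \<in> B"
    and comm: "\<And>b c. b \<in> B \<Longrightarrow> c \<in> B \<Longrightarrow> b \<star> c = c \<star> b"
  shows "B \<subseteq> IA"
proof
  fix b assume b: "b \<in> B"
  have comm': "b (c n) = c (b n)" if "b \<in> B" "c \<in> B" "n \<in> carrier N" for b c n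
    using A_mult[of b c n] A_mult[of c b n] comm[OF that(1,2)] that B by (simp add: subset_iff)
  have sq: "e (b (b n)) i = 2 * e (b n) i - e n i" if b: "b \<in> B" and n: "n \<in> carrier N" for b n i
  proof -
    have bA: "b \<in> auto N" using b B by blast
    let ?c = "conj_by (b n \<otimes> inv n)"
    have c: "?c \<in> IA" using bA n by simp
    \<comment> \<open>The commutator of \<open>b\<close> with a conjugation lies in \<open>B\<close>
      by normality and is itself a conjugation. Since it commutes with \<open>b\<close>, its degree
      one part is fixed by \<open>b\<close>.\<close>
    have "b \<star> (conj_by n \<star> inv\<^bsub>A\<^esub> b \<star> inv\<^bsub>A\<^esub> (conj_by n)) \<in> B"
      using mult[OF b conj[OF _ inv[OF b]]] n by simp
    also have "b \<star> (conj_by n \<star> inv\<^bsub>A\<^esub> b \<star> inv\<^bsub>A\<^esub> (conj_by n)) =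
        (b \<star> conj_by n \<star> inv\<^bsub>A\<^esub> b) \<star> inv\<^bsub>A\<^esub> (conj_by n)"
      using bA n by (simp add: A.m_assoc carrier_A)
    also have "\<dots> = conj_by (b n) \<star> conj_by (inv n)"
      using conj_by_conj[OF bA n] conj_by_inv[OF n] by simp
    also have "\<dots> = ?c" using conj_by_mult[of "b n" "inv n"] bA n by simp
    finally have cB: "?c \<in> B" .
    have "b \<star> ?c \<star> inv\<^bsub>A\<^esub> b = ?c"
      using comm[OF b cB] c bA by (simp add: A.m_assoc carrier_A)
    then have "conj_by (b (b n \<otimes> inv n)) = ?c" using conj_by_conj[OF bA, of "b n \<otimes> inv n"] bA n by simp
    then have "e (b (b n \<otimes> inv n)) i = e (b n \<otimes> inv n) i"
      using conj_by_eq_iff[of "b (b n \<otimes> inv n)" "b n \<otimes> inv n"] bA n by simp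
    then show ?thesis using bA n by simp
  qed
  have bA: "b \<in> auto N" using b B by blast
  have key: "e (b (g (b m \<otimes> inv m))) i = e (g (b m \<otimes> inv m)) i"
    if g: "g \<in> auto N" and m: "m \<in> carrier N" for g m i
  proof -
    define c where "c = g \<star> b \<star> inv\<^bsub>A\<^esub> g"
    have c: "c \<in> B" unfolding c_def by (rule conj[OF g b])
    have cA: "c \<in> auto N" using c B by blast
    define n where "n = g m"
    have n: "n \<in> carrier N" using g m by (simp add: n_def)
    have cn: "c n = g (b m)" using A_conj_apply[OF g bA m] by (simp add: c_def n_def)
    have bc: "b \<star> c \<in> B" by (rule mult[OF b c])
    have 1: "e (b (c (b (c n)))) i = 2 * e (b (c n)) i - e n i"
      using sq[OF bc n, of i] bA cA n by simp
    have 2: "e (b (c (b (c n)))) i = e (b (b (c (c n)))) i"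
      using comm'[OF b c, of "c n"] cA n by simp
    have 3: "e (b (b (c (c n)))) i = 2 * e (b (c (c n))) i - e (c (c n)) i"
      using sq[OF b, of "c (c n)" i] cA n by simp
    have 4: "e (b (c (c n))) i = e (c (c (b n))) i"
      using comm'[OF b c, of "c n"] comm'[OF b c n] cA n by simp
    have 5: "e (c (c (b n))) i = 2 * e (c (b n)) i - e (b n) i"
      using sq[OF c, of "b n" i] bA n by simp
    have 6: "e (c (b n)) i = e (b (c n)) i" using comm'[OF b c n] by simp
    have 7: "e (c (c n)) i = 2 * e (c n) i - e n i" by (rule sq[OF c n])
    \<comment> \<open>With \<open>\<beta> = b - 1\<close> and \<open>\<gamma> = c - 1\<close> the
      square of \<open>b c - 1 = \<beta> + \<gamma> + \<beta> \<gamma>\<close> is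
      \<open>2 \<beta> \<gamma>\<close>; the integers have no 2-torsion.\<close>
    have "e (b (c n)) i - e (b n) i - e (c n) i + e n i = 0"
      using 1 2 3 4 5 6 7 by linarith
    then have "e (b (g (b m))) i - e (b (g m)) i - e (g (b m)) i + e (g m) i = 0"
      unfolding cn unfolding n_def .
    then show ?thesis using bA g m by simp
  qed
  show "b \<in> IA"
  proof (rule ccontr)
    assume "b \<notin> IA"
    then obtain m z where m: "m \<in> carrier N" "e (b m) z \<noteq> e m z" using in_IA[OF bA] by blast
    define w where "w = b m \<otimes> inv m"
    have w: "w \<in> carrier N" using bA m by (simp add: w_def)
    have wz: "e w z \<noteq> 0" using bA m by (simp add: w_def)
    have z: "z \<in> I" using wz e_out[OF w] by blast
    have F: "e (b (x y)) j = e (x y) j" if "y \<in> I" "y \<noteq> z" for y j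
      by (rule fixes_basis_mod_centre[OF bA w _ z wz that]) (use key[OF _ m(1)] in \<open>simp add: w_def\<close>)
    \<comment> \<open>The orbit of \<open>w\<close> settles every basis vector except
      \<open>z\<close>. Adding the coordinate at \<open>z\<close> to the zero coordinate at a fresh
      \<open>y\<close> gives an orbit element that is nonzero at \<open>y\<close>, which settles
      \<open>z\<close> as well.\<close>
    obtain y where y: "y \<in> I" "y \<notin> insert z {i. e w i \<noteq> 0}"
      using fresh[of "insert z {i. e w i \<noteq> 0}"] e_finite[OF w] by auto
    obtain g where g: "g \<in> auto N"
      "\<And>n i. n \<in> carrier N \<Longrightarrow> e (g n) i = e n i + (if i = y then e n z else 0)"
      using transvection_exists[OF z y(1)] y(2) by (metis insertI1)
    have "e (b (x z)) j = e (x z) j" for j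
    proof (rule fixes_basis_mod_centre[OF bA _ _ y(1) _ z])
      show "g w \<in> carrier N" using g w by simp
      show "e (b (h (g w))) j = e (h (g w)) j" if h: "h \<in> auto N" for h j
        using key[of "h \<star> g" m j] h g m w by (simp add: w_def[symmetric] del: auto_mult)
      show "e (g w) y \<noteq> 0" using g w y wz by simp
      show "z \<noteq> y" using y by auto
    qed
    then have "b \<in> IA" using F by (intro IA_I[OF bA]) (metis e_x)
    then show False using m by simp
  qed
qed

text \<open>The Euclidean algorithm, carried out by transvections.\<close>

lemma primitive_form:
  assumes "n \<in> carrier N"
  shows "\<exists>g\<in>auto N. \<exists>i\<in>I. \<exists>d. \<forall>j. e (g n) j = d * e (x i) j"
  using assms
proof (induction "\<Sum>i\<in>{i. e n i \<noteq> 0}. nat \<bar>e n i\<bar>" arbitrary: n rule: less_induct)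
  case less
  note n = less.prems
  note fin = e_finite[OF n]
  show ?case
  proof (cases "\<exists>i j. i \<noteq> j \<and> e n i \<noteq> 0 \<and> e n j \<noteq> 0")
    case True
    then obtain i j where ij: "i \<noteq> j" "e n i \<noteq> 0" "e n j \<noteq> 0" "\<bar>e n j\<bar> \<le> \<bar>e n i\<bar>"
      by (metis linear)
    have I: "i \<in> I" "j \<in> I" using ij e_out[OF n] by blast+
    obtain g where g: "g \<in> auto N"
      "\<And>n k. n \<in> carrier N \<Longrightarrow> e (g n) k = e n k + (if k = i then e n j else 0)"
      "\<And>n k. n \<in> carrier N \<Longrightarrow> e ((inv\<^bsub>A\<^esub> g) n) k = e n k - (if k = i then e n j else 0)"
      using transvection_exists[OF I(2,1)] ij(1) by metis
    \<comment> \<open>Subtracting or adding the coordinate at \<open>j\<close>, according to the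
      signs, reduces the absolute value of the coordinate at \<open>i\<close>, which is at least as
      large.\<close>
    define h where "h = (if sgn (e n i) = sgn (e n j) then inv\<^bsub>A\<^esub> g else g)"
    have h: "h \<in> auto N" using g by (simp add: h_def)
    have hk: "e (h n) k = e n k" if "k \<noteq> i" for k using that g n by (simp add: h_def)
    have hi: "\<bar>e (h n) i\<bar> < \<bar>e n i\<bar>" using g n ij by (auto simp: h_def sgn_if split: if_splits)
    have sub: "{k. e (h n) k \<noteq> 0} \<subseteq> {k. e n k \<noteq> 0}" using hk ij(2) by (auto) (metis)
    have "(\<Sum>k\<in>{k. e (h n) k \<noteq> 0}. nat \<bar>e (h n) k\<bar>) = (\<Sum>k\<in>{k. e n k \<noteq> 0}. nat \<bar>e (h n) k\<bar>)"
      by (rule sum.mono_neutral_left[OF fin sub]) auto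
    also have "\<dots> < (\<Sum>k\<in>{k. e n k \<noteq> 0}. nat \<bar>e n k\<bar>)"
    proof (rule sum_strict_mono_ex1[OF fin])
      show "\<forall>k\<in>{k. e n k \<noteq> 0}. nat \<bar>e (h n) k\<bar> \<le> nat \<bar>e n k\<bar>"
        using hk hi by (metis le_less nat_mono order_refl)
      show "\<exists>k\<in>{k. e n k \<noteq> 0}. nat \<bar>e (h n) k\<bar> < nat \<bar>e n k\<bar>"
        using hi ij(2) by (intro bexI[of _ i]) auto
    qed
    finally obtain g' l d where g': "g' \<in> auto N" "l \<in> I" "\<And>j. e (g' (h n)) j = d * e (x l) j"
      using less.hyps[of "h n"] h n by auto
    then show ?thesis using h n by (intro bexI[of _ "g' \<star> h"] bexI[of _ l] exI[of _ d]) auto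
  next
    case False
    obtain l where l: "l \<in> I" "\<And>j. j \<noteq> l \<Longrightarrow> e n j = 0"
    proof (cases "\<exists>l. e n l \<noteq> 0")
      case True
      then obtain l where "e n l \<noteq> 0" by blast
      then show thesis using that[of l] False e_out[OF n] by blast
    next
      case no: False
      then show thesis using that fresh[of "{}"] by auto
    qed
    then have "e (\<one>\<^bsub>A\<^esub> n) j = e n l * e (x l) j" for j using n by auto
    then show ?thesis using l by (intro bexI[of _ "\<one>\<^bsub>A\<^esub>"] bexI[of _ l] exI[of _ "e n l"]) auto
  qed
qed

section \<open>Characterising the conjugations inside IA\<close>

lemma inner_is_conjugate_power:
  assumes i0: "i0 \<in> I" and n: "n \<in> carrier N"
  shows "\<exists>k\<in>auto N. \<exists>m::int. conj_by n = (k \<star> conj_by (x i0) \<star> inv\<^bsub>A\<^esub> k) [^]\<^bsub>A\<^esub> m"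
proof -
  obtain g i d where g: "g \<in> auto N" "i \<in> I" "\<And>j. e (g n) j = d * e (x i) j"
    using primitive_form[OF n] by blast
  \<comment> \<open>The transposition of \<open>i\<close> and \<open>i0\<close> moves the power of
    \<open>x i\<close> onto the prescribed basis element.\<close>
  define p where "p = (\<lambda>j. if j = i then i0 else if j = i0 then i else j)"
  have pp: "p (p j) = j" for j by (simp add: p_def)
  have pI: "p ` I \<subseteq> I" using i0 g(2) by (auto simp: p_def)
  obtain \<pi> where \<pi>: "\<pi> \<in> auto N" "\<And>i. i \<in> I \<Longrightarrow> \<pi> (x i) = x (p i)"
    using permutation_exists[of p] pp pI by metis
  define h where "h = \<pi> \<star> g"
  have h: "h \<in> auto N" using \<pi> g by (simp add: h_def)
  define k where "k = inv\<^bsub>A\<^esub> h"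
  have k: "k \<in> auto N" using h by (simp add: k_def)
  have "e (\<pi> (g n)) j = e (\<pi> (x i [^] d)) j" for j
    by (rule e_hom_cong[OF auto_hom[OF \<pi>(1)]]) (use g n in \<open>simp_all del: e_x\<close>)
  then have hn: "e (h n) j = d * e (x i0) j" for j
    using g n \<pi> i0 by (simp add: h_def auto_int_pow p_def del: e_x)
  have "e (k (h n)) j = e (k (x i0 [^] d)) j" for j
    by (rule e_hom_cong[OF auto_hom[OF k]]) (use h n i0 hn in \<open>simp_all del: e_x\<close>)
  then have "e n j = e (k (x i0) [^] d) j" for j
    using h k n i0 by (simp add: auto_int_pow k_def)
  then have "conj_by n = conj_by (k (x i0) [^] d)"
    using conj_by_eq_iff[of n "k (x i0) [^] d"] n k i0 by simp
  then show ?thesis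
    using conj_by_conj[OF k, of "x i0"] conj_by_int_pow[of "k (x i0)" d] k i0
    by (intro bexI[of _ k] exI[of _ d]) simp_all
qed

text \<open>By \<open>0\<close> each \<open>t y\<close> is of the form \<open>a \<and> y\<close>,
  with \<open>a\<close> determined up to multiples of \<open>y\<close>. That this persists under the
  transvection from \<open>y\<close> to \<open>z\<close> forces the vectors for \<open>y\<close> and
  \<open>z\<close> to agree.\<close>

lemma inner_tensorI:
  assumes t: "t \<in> tensors I"
    and 0: "\<And>y w z. w \<noteq> y \<Longrightarrow> z \<noteq> y \<Longrightarrow> t y w z = 0"
    and 1: "\<And>u v y w z. u \<in> I \<Longrightarrow> v \<in> I \<Longrightarrow> u \<noteq> v \<Longrightarrow> w \<noteq> y \<Longrightarrow> z \<noteq> y \<Longrightarrow> transvect u v t y w z = 0"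
  obtains a where "a \<in> fin_vec I" "t = inner_tensor I a"
proof -
  obtain w0 where w0: "w0 \<in> I" using fresh[of "{}"] by auto
  obtain w1 where w1: "w1 \<in> I" "w1 \<noteq> w0" using fresh[of "{w0}"] by auto
  have same: "t z w z = t y w y" if "y \<in> I" "z \<in> I" "w \<noteq> y" "w \<noteq> z" for y z w
  proof (cases "y = z")
    case False
    have "transvect y z t y w z = 0" using 1[of y z w y z] that False by auto
    then show ?thesis
      using False that 0[of w y z] 0[of w z y] by (simp add: transvect_def)
  qed simp
  \<comment> \<open>The row \<open>w0\<close> does not determine the component at \<open>w0\<close>;
    a second row supplies it.\<close>
  define a where "a = (\<lambda>w. if w = w0 then t w1 w w1 else t w0 w w0)"
  have aw: "t y w y = a w" if "y \<in> I" "w \<noteq> y" for y w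
    using same[of w0 y w] same[of w1 y w] that w0 w1 by (auto simp: a_def)
  have "{w. a w \<noteq> 0} \<subseteq> insert w0 {j. \<exists>k. t w0 j k \<noteq> 0}" by (auto simp: a_def)
  then have "finite {w. a w \<noteq> 0}"
    by (rule finite_subset) (use tensors_finite_support[OF t] in simp)
  moreover have "{w. a w \<noteq> 0} \<subseteq> I"
    using tensors_in[OF t] by (auto simp: a_def split: if_splits)
  ultimately have a: "a \<in> fin_vec I" by (simp add: fin_vec_def)
  have "t i j k = inner_tensor I a i j k" for i j k
  proof (cases "i \<in> I")
    case i: True
    consider "j = i" "k = i" | "j \<noteq> i" "k \<noteq> i" | "j \<noteq> i" "k = i" | "j = i" "k \<noteq> i" by blast
    then show ?thesis
    proof cases
      case 4
      then show ?thesis using aw[OF i, of k] tensors_anti[OF t, of i i k] i by (simp add: inner_tensor_def)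
    qed (use i aw[OF i] 0 tensors_diag[OF t] in \<open>auto simp: inner_tensor_def\<close>)
  next
    case False
    then show ?thesis using tensors_out[OF t] by (simp add: inner_tensor_def)
  qed
  then show thesis using that a by blast
qed

text \<open>
  If \<open>f y\<close> is not of the form \<open>a \<and> y\<close>, the iterated commutator of \<open>f\<close> with the transvections
  \<open>u \<mapsto> u + y\<close> (\<open>u\<close> fresh) and \<open>w \<mapsto> w + y\<close> has rank one, so \<open>f\<close> has rank one. Then the product of \<open>f\<close>
  with a translate of disjoint support has rank two and is not a power of a conjugate of \<open>f\<close>.
\<close>

lemma inner_of_conjugate_powers:
  assumes J: "J \<subseteq> IA"
    and conj: "\<And>g b. g \<in> auto N \<Longrightarrow> b \<in> J \<Longrightarrow> g \<star> b \<star> inv\<^bsub>A\<^esub> g \<in> J"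
    and mult: "\<And>b c. b \<in> J \<Longrightarrow> c \<in> J \<Longrightarrow> b \<star> c \<in> J"
    and inv: "\<And>b. b \<in> J \<Longrightarrow> inv\<^bsub>A\<^esub> b \<in> J"
    and f: "f \<in> J"
    and pow: "\<And>h. h \<in> J \<Longrightarrow> \<exists>k\<in>auto N. \<exists>m::int. h = (k \<star> f \<star> inv\<^bsub>A\<^esub> k) [^]\<^bsub>A\<^esub> m"
  shows "\<exists>n\<in>carrier N. f = conj_by n"
proof -
  define C where "C = {k \<star> f \<star> inv\<^bsub>A\<^esub> k | k. k \<in> auto N}"
  have CJ: "C \<subseteq> J" using conj[OF _ f] by (auto simp: C_def)
  have powC: "\<exists>f'\<in>C. \<exists>m::int. h = f' [^]\<^bsub>A\<^esub> m" if "h \<in> J" for h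
    using pow[OF that] by (auto simp: C_def)
  have fA: "f \<in> auto N" using f J by auto
  have cc: "g \<star> (k \<star> f \<star> inv\<^bsub>A\<^esub> k) \<star> inv\<^bsub>A\<^esub> g =
      (g \<star> k) \<star> f \<star> inv\<^bsub>A\<^esub> (g \<star> k)"
    if "g \<in> auto N" "k \<in> auto N" for g k
    using that fA by (simp add: A.m_assoc A.inv_mult_group carrier_A)
  have conjC: "g \<star> f' \<star> inv\<^bsub>A\<^esub> g \<in> C" if "g \<in> auto N" "f' \<in> C" for g f'
    using that cc unfolding C_def by (smt (verit) A_closed(1) mem_Collect_eq)
  have transC: "\<exists>k\<in>auto N. f'' = k \<star> f' \<star> inv\<^bsub>A\<^esub> k" if f': "f' \<in> C" and f'': "f'' \<in> C" for f' f''
  proof -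
    obtain k l where k: "k \<in> auto N" "f' = k \<star> f \<star> inv\<^bsub>A\<^esub> k"
      and l: "l \<in> auto N" "f'' = l \<star> f \<star> inv\<^bsub>A\<^esub> l" using f' f'' by (auto simp: C_def)
    have "(l \<star> inv\<^bsub>A\<^esub> k) \<star> k = l" using k l by (simp add: A.m_assoc carrier_A)
    then have "f'' = (l \<star> inv\<^bsub>A\<^esub> k) \<star> f' \<star> inv\<^bsub>A\<^esub> (l \<star> inv\<^bsub>A\<^esub> k)"
      using cc[of "l \<star> inv\<^bsub>A\<^esub> k" k] k l by simp
    then show ?thesis using k l by (intro bexI[of _ "l \<star> inv\<^bsub>A\<^esub> k"]) auto
  qed
  have main: "tens f' y w z = 0" if f': "f' \<in> C" and wz: "w \<noteq> y" "z \<noteq> y" for f' y w z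
  proof (rule ccontr)
    define t where "t = tens f'"
    have f'J: "f' \<in> J" and f'IA: "f' \<in> IA" using f' CJ J by auto
    have t: "t \<in> tensors I" unfolding t_def by (rule tens_tensors[OF f'IA])
    assume "tens f' y w z \<noteq> 0"
    then have nz: "t y w z \<noteq> 0" by (simp add: t_def)
    have I: "y \<in> I" "w \<in> I" "z \<in> I" using tensors_in[OF t nz] by auto
    let ?F = "{y, w, z} \<union> {j. \<exists>k. t y j k \<noteq> 0}"
    obtain u where u: "u \<in> I" "u \<notin> ?F"
      using fresh[of ?F] tensors_finite_support[OF t] by auto
    have tu: "t y u k = 0" "t y k u = 0" for k
      using u tensors_anti[OF t, of y k u] by auto
    have comm: "\<exists>h'\<in>J. tens h' = (\<lambda>i j k. transvect v y (tens h) i j k - tens h i j k)"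
      if h: "h \<in> J" and v: "v \<in> I" "v \<noteq> y" for h v
    proof -
      obtain g where g: "g \<in> auto N"
        "\<And>\<alpha>. \<alpha> \<in> IA \<Longrightarrow> tens (g \<star> \<alpha> \<star> inv\<^bsub>A\<^esub> g) = transvect v y (tens \<alpha>)"
        using transvection_exists[OF v(1) I(1) v(2)] by metis
      have hIA: "h \<in> IA" using h J by auto
      have "tens ((g \<star> h \<star> inv\<^bsub>A\<^esub> g) \<star> inv\<^bsub>A\<^esub> h) =
          (\<lambda>i j k. transvect v y (tens h) i j k - tens h i j k)"
        using tens_mult[OF IA_conj[OF g(1) hIA] IA_inv[OF hIA]] g(2)[OF hIA] tens_inv[OF hIA] by simp
      then show ?thesis using mult[OF conj[OF g(1) h] inv[OF h]] by blast
    qed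
    have uy: "u \<noteq> y" using u by auto
    obtain h1 where h1: "h1 \<in> J" "tens h1 = (\<lambda>i j k. transvect u y t i j k - t i j k)"
      using comm[OF f'J u(1) uy] by (auto simp: t_def)
    obtain h2 where h2: "h2 \<in> J" "tens h2 = (\<lambda>i j k. transvect w y (tens h1) i j k - tens h1 i j k)"
      using comm[OF h1(1) I(2) wz(1)] by auto
    have s1: "tens h1 i j k = (if j = y then t i u k else 0) + (if k = y then t i j u else 0)
        - (if i = u then t y j k else 0)" for i j k
      using uy tu by (simp add: h1(2) transvect_def)
    \<comment> \<open>The double commutator lives in the row \<open>u\<close> alone, where it is, up
      to sign, the wedge of \<open>y\<close> with the contraction of \<open>t y\<close> by
      \<open>w\<close>. The freshness of \<open>u\<close> removes all other terms.\<close>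
    have s2: "tens h2 i j k = - (if i = u then (if j = y then t y w k else 0) + (if k = y then t y j w else 0) else 0)"
      for i j k
      using uy wz tu tensors_anti[OF t, of i w u] u by (auto simp: h2(2) transvect_def s1)
    obtain f2 and m :: int where f2: "f2 \<in> C" "h2 = f2 [^]\<^bsub>A\<^esub> m" using powC[OF h2(1)] by blast
    have f2IA: "f2 \<in> IA" using f2 CJ J by auto
    define t2 where "t2 = tens f2"
    have t2: "t2 \<in> tensors I" unfolding t2_def by (rule tens_tensors[OF f2IA])
    have mt2: "tens h2 i j k = m * t2 i j k" for i j k
      using tens_int_pow[OF f2IA, of m] by (simp add: f2(2) t2_def)
    have "tens h2 u y z \<noteq> 0" using s2[of u y z] nz wz by simp
    then have m0: "m \<noteq> 0" and t2nz: "t2 u y z \<noteq> 0" using mt2[of u y z] by auto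
    have t2_0: "t2 i j k = 0" if "i \<noteq> u" for i j k
      using mt2[of i j k] s2[of i j k] that m0 by simp
    let ?S = "{u, y} \<union> {j. \<exists>k. t2 u j k \<noteq> 0}"
    have finS: "finite ?S" using tensors_finite_support[OF t2] by simp
    obtain u' where u': "u' \<in> I" "u' \<notin> ?S" using fresh[OF finS] by blast
    obtain y' where y': "y' \<in> I" "y' \<notin> insert u' ?S" using fresh[of "insert u' ?S"] finS by blast
    \<comment> \<open>The translate by \<open>p\<close> occupies the row \<open>u'\<close> and has
      an entry involving \<open>y'\<close>, an index absent from the row \<open>u\<close> of
      \<open>t2\<close>.\<close>
    define p where "p = (\<lambda>i. if i = u then u' else if i = u' then u else if i = y then y' else if i = y' then y else i)"
    have pp: "p (p i) = i" for i using u' y' uy by (auto simp: p_def)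
    have pI: "p ` I \<subseteq> I" using u u' y' I by (auto simp: p_def)
    obtain \<pi> where \<pi>: "\<pi> \<in> auto N"
      "\<And>\<alpha>. \<alpha> \<in> IA \<Longrightarrow> tens (\<pi> \<star> \<alpha> \<star> inv\<^bsub>A\<^esub> \<pi>) = permute p (tens \<alpha>)"
      using permutation_exists[of p] pp pI by metis
    have f2J: "f2 \<in> J" using f2 CJ by blast
    let ?h3 = "f2 \<star> (\<pi> \<star> f2 \<star> inv\<^bsub>A\<^esub> \<pi>)"
    have h3: "?h3 \<in> J" by (rule mult[OF f2J conj[OF \<pi>(1) f2J]])
    have s3: "tens ?h3 i j k = t2 i j k + t2 (p i) (p j) (p k)" for i j k
      using tens_mult[OF f2IA IA_conj[OF \<pi>(1) f2IA]] \<pi>(2)[OF f2IA] by (simp add: permute_def t2_def)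
    obtain f3 and m' :: int where f3: "f3 \<in> C" "?h3 = f3 [^]\<^bsub>A\<^esub> m'" using powC[OF h3] by blast
    have f3IA: "f3 \<in> IA" using f3 CJ J by auto
    obtain k where k: "k \<in> auto N" "f3 = k \<star> f2 \<star> inv\<^bsub>A\<^esub> k" using transC[OF f2(1) f3(1)] by blast
    \<comment> \<open>Every \<open>f2 n\<close> differs from \<open>n\<close> by a power of
      \<open>\<zeta>\<close>. This multiplicative form of having rank one passes to the conjugates
      of \<open>f2\<close>.\<close>
    define \<zeta> where "\<zeta> = inv (x u) \<otimes> f2 (x u)"
    have \<zeta>: "\<zeta> \<in> carrier N" "\<And>i. e \<zeta> i = 0" using f2IA u by (simp_all add: \<zeta>_def)
    have q\<zeta>: "q \<zeta> i j = t2 u i j" for i j using f2IA u by (simp add: \<zeta>_def t2_def tens_def)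
    have f2n: "f2 n = n \<otimes> \<zeta> [^] e n u" if n: "n \<in> carrier N" for n
    proof (rule coordinates)
      fix i j
      have "Sum_any (\<lambda>l. e n l * t2 l i j) = (\<Sum>l\<in>{u}. e n l * t2 l i j)"
        by (rule Sum_any.expand_superset) (use t2_0 in auto)
      then show "q (f2 n) i j = q (n \<otimes> \<zeta> [^] e n u) i j"
        using IA_q[OF f2IA n, of i j] n \<zeta> by (simp add: t2_def[symmetric] q_int_pow q\<zeta>)
    qed (use n \<zeta> f2IA in simp_all)
    define c where "c = (\<lambda>i. e ((inv\<^bsub>A\<^esub> k) (x i)) u)"
    have k\<zeta>: "k \<zeta> \<in> carrier N" "\<And>i. e (k \<zeta>) i = 0"
      using k \<zeta> e_hom_cong[OF auto_hom[OF k(1)], of \<zeta> \<one>] by simp_all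
    have t3: "tens f3 i a b = c i * q (k \<zeta>) a b" if i: "i \<in> I" for i a b
    proof -
      have "f3 (x i) = k (f2 ((inv\<^bsub>A\<^esub> k) (x i)))" using k f2IA i by simp
      also have "\<dots> = x i \<otimes> k \<zeta> [^] c i"
        using f2n[of "(inv\<^bsub>A\<^esub> k) (x i)"] k i \<zeta> by (simp add: c_def auto_int_pow)
      finally show ?thesis using i k\<zeta> by (simp add: tens_def q_int_pow)
    qed
    \<comment> \<open>For entries that factor in this way, nonzero values at
      \<open>(u, y, z)\<close> and \<open>(u', y', p z)\<close> force one at
      \<open>(u, y', p z)\<close>, where the entry of \<open>?h3\<close> is zero.\<close>
    have s3': "tens ?h3 i a b = m' * (c i * q (k \<zeta>) a b)" if "i \<in> I" for i a b
      using tens_int_pow[OF f3IA, of m'] t3[OF that] by (simp add: f3(2))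
    have pu: "p u = u'" "p u' = u" "p y = y'" "u' \<noteq> u" using u' uy by (auto simp: p_def)
    have "tens ?h3 u y z = t2 u y z" using s3[of u y z] t2_0[of u'] pu by simp
    then have "m' * c u \<noteq> 0" using s3'[of u y z] u t2nz by auto
    moreover have "tens ?h3 u' y' (p z) = t2 u y z"
      using s3[of u' y' "p z"] t2_0[of u'] pu pp pp[of y] by simp
    then have "q (k \<zeta>) y' (p z) \<noteq> 0" using s3'[of u' y' "p z"] u' t2nz by auto
    moreover have "tens ?h3 u y' (p z) = 0"
      using s3[of u y' "p z"] t2_0[of u'] pu y' by auto
    ultimately show False using s3'[of u y' "p z"] u by simp
  qed
  have fC: "f \<in> C"
    unfolding C_def using fA by (auto intro!: exI[of _ "\<one>\<^bsub>A\<^esub>"] simp: carrier_A[symmetric])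
  have fIA: "f \<in> IA" using f J by auto
  obtain a where a: "a \<in> fin_vec I" "tens f = inner_tensor I a"
  proof (rule inner_tensorI[OF tens_tensors[OF fIA]])
    show "tens f y w z = 0" if "w \<noteq> y" "z \<noteq> y" for y w z using main[OF fC that] .
    show "transvect u v (tens f) y w z = 0" if uv: "u \<in> I" "v \<in> I" "u \<noteq> v" and wz: "w \<noteq> y" "z \<noteq> y" for u v y w z
    proof -
      obtain g where g: "g \<in> auto N"
        "\<And>\<alpha>. \<alpha> \<in> IA \<Longrightarrow> tens (g \<star> \<alpha> \<star> inv\<^bsub>A\<^esub> g) = transvect u v (tens \<alpha>)"
        using transvection_exists[OF uv] by metis
      show ?thesis using main[OF conjC[OF g(1) fC] wz] g(2)[OF fIA] by simp
    qed
  qed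
  obtain n where n: "n \<in> carrier N" "e n = a" using vector_realised[OF a(1)] by blast
  have "f = conj_by n" by (rule IA_eqI) (use fIA n a in \<open>simp_all add: tens_conj_by\<close>)
  then show ?thesis using n by blast
qed

section \<open>Automorphisms of the automorphism group\<close>

lemma A_cancel [simp]:
  assumes "g \<in> auto N" "h \<in> auto N"
  shows "g \<star> (inv\<^bsub>A\<^esub> g \<star> h) = h" "inv\<^bsub>A\<^esub> g \<star> (g \<star> h) = h"
  using assms by (simp_all add: A.m_assoc[symmetric] carrier_A)

lemma A_left_cancel:
  assumes "g \<star> h = g \<star> h'" "g \<in> auto N" "h \<in> auto N" "h' \<in> auto N" shows "h = h'"
  using A_cancel(2)[of g h] A_cancel(2)[of g h'] assms by metis

text \<open>The tensor of \<open>h\<close> makes sense without invertibility, and the element of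
  \<open>IA\<close> realising it agrees with \<open>h\<close> on the basis. So triviality on the
  abelianisation makes an endomorphism invertible.\<close>

lemma unipotent_IA:
  assumes h: "h \<in> hom N N" and u: "\<And>n i. n \<in> carrier N \<Longrightarrow> e (h n) i = e n i"
  obtains \<alpha> where "\<alpha> \<in> IA" "\<And>n. n \<in> carrier N \<Longrightarrow> \<alpha> n = h n"
proof -
  have hc: "h n \<in> carrier N" if "n \<in> carrier N" for n using h that by (auto simp: hom_def)
  define s where "s = (\<lambda>i j k. if i \<in> I then q (h (x i)) j k else 0)"
  have "s \<in> tensors I"
  proof (rule tensorsI)
    fix i j k
    show "s i j k \<noteq> 0 \<Longrightarrow> i \<in> I \<and> j \<in> I \<and> k \<in> I"
      using q_out[of "h (x i)" j k] hc by (auto simp: s_def split: if_splits)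
    show "s i j k = - s i k j"
      using q_sym[of "h (x i)" j k] hc u by (auto simp: s_def split: if_splits)
    show "finite {(j, k). s i j k \<noteq> 0}"
      using q_finite[of "h (x i)"] hc by (cases "i \<in> I") (auto simp: s_def)
  qed
  then obtain \<alpha> where a: "\<alpha> \<in> IA" "tens \<alpha> = s" using tensors_realised by blast
  have "\<alpha> (x i) = h (x i)" if i: "i \<in> I" for i
  proof (rule coordinates)
    show "q (\<alpha> (x i)) j k = q (h (x i)) j k" for j k
      using fun_cong[OF fun_cong[OF fun_cong[OF a(2), of i], of j], of k] i by (simp add: tens_def s_def)
  qed (use a i hc u in auto)
  then have "\<alpha> n = h n" if "n \<in> carrier N" for n
    using hom_eqI[OF auto_hom h that] a(1) by auto
  then show thesis using that a(1) by blast
qed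

lemma iso_auto: "\<phi> \<in> iso A A \<Longrightarrow> g \<in> auto N \<Longrightarrow> \<phi> g \<in> auto N"
  by (auto simp: iso_def hom_def carrier_A)

lemma iso_mult: "\<phi> \<in> iso A A \<Longrightarrow> g \<in> auto N \<Longrightarrow> h \<in> auto N \<Longrightarrow>
    \<phi> (g \<star> h) = \<phi> g \<star> \<phi> h"
  by (auto simp: iso_def hom_def carrier_A)

lemma iso_group_hom: "\<phi> \<in> iso A A \<Longrightarrow> group_hom A A \<phi>"
  by (simp add: group_hom_def group_hom_axioms_def iso_def A.is_group)

lemma iso_inv: "\<phi> \<in> iso A A \<Longrightarrow> g \<in> auto N \<Longrightarrow> \<phi> (inv\<^bsub>A\<^esub> g) = inv\<^bsub>A\<^esub> (\<phi> g)"
  using group_hom.hom_inv[OF iso_group_hom] by (simp add: carrier_A)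

lemma iso_one: "\<phi> \<in> iso A A \<Longrightarrow> \<phi> \<one>\<^bsub>A\<^esub> = \<one>\<^bsub>A\<^esub>"
  using group_hom.hom_one[OF iso_group_hom] by simp

lemma iso_surj:
  assumes "\<phi> \<in> iso A A" "g \<in> auto N"
  shows "\<exists>g'\<in>auto N. \<phi> g' = g"
proof -
  have "\<phi> ` auto N = auto N" using assms(1) by (simp add: iso_def bij_betw_def carrier_A)
  then have "g \<in> \<phi> ` auto N" using assms(2) by simp
  then show ?thesis by (metis imageE)
qed

lemma iso_normal_image:
  assumes p: "\<phi> \<in> iso A A" and B: "B \<subseteq> auto N"
    and conj: "\<And>g b. g \<in> auto N \<Longrightarrow> b \<in> B \<Longrightarrow> g \<star> b \<star> inv\<^bsub>A\<^esub> g \<in> B"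
    and g: "g \<in> auto N" and b: "b \<in> \<phi> ` B"
  shows "g \<star> b \<star> inv\<^bsub>A\<^esub> g \<in> \<phi> ` B"
proof -
  obtain g' where g': "g' \<in> auto N" "\<phi> g' = g" using iso_surj[OF p g] by blast
  obtain b' where b': "b' \<in> B" "b = \<phi> b'" using b by blast
  have "\<phi> (g' \<star> b' \<star> inv\<^bsub>A\<^esub> g') = g \<star> b \<star> inv\<^bsub>A\<^esub> g"
    using g' b' B by (simp add: iso_mult[OF p] iso_inv[OF p] subset_iff)
  then show ?thesis using conj[OF g'(1) b'(1)] by (metis image_eqI)
qed

lemma iso_IA:
  assumes p: "\<phi> \<in> iso A A" and a: "\<alpha> \<in> IA"
  shows "\<phi> \<alpha> \<in> IA"
proof -
  have IA: "IA \<subseteq> auto N" by auto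
  have "\<phi> ` IA \<subseteq> IA"
  proof (rule abelian_normal_subset_IA)
    show "\<phi> ` IA \<subseteq> auto N" using iso_auto[OF p] by auto
    show "g \<star> b \<star> inv\<^bsub>A\<^esub> g \<in> \<phi> ` IA" if "g \<in> auto N" "b \<in> \<phi> ` IA" for g b
      using iso_normal_image[OF p IA IA_conj that] .
    fix b assume "b \<in> \<phi> ` IA"
    then obtain b' where b': "b' \<in> IA" "b = \<phi> b'" by blast
    show "inv\<^bsub>A\<^esub> b \<in> \<phi> ` IA"
      using b' IA_inv[OF b'(1)] iso_inv[OF p, of b'] by (metis IA_auto image_eqI)
    fix c assume "c \<in> \<phi> ` IA"
    then obtain c' where c': "c' \<in> IA" "c = \<phi> c'" by blast
    show "b \<star> c \<in> \<phi> ` IA"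
      using b' c' IA_mult iso_mult[OF p, of b' c'] by (metis IA_auto image_eqI)
    show "b \<star> c = c \<star> b"
      using b' c' IA_comm[of b' c'] iso_mult[OF p, of b' c'] iso_mult[OF p, of c' b'] by simp
  qed
  then show ?thesis using a by blast
qed

text \<open>All conjugations are powers of conjugates of the single element
  \<open>conj_by (x i)\<close>; this property of the normal subgroup they form passes to its
  image.\<close>

lemma iso_inner_basis:
  assumes p: "\<phi> \<in> iso A A" and i: "i \<in> I"
  shows "\<exists>n\<in>carrier N. \<phi> (conj_by (x i)) = conj_by n"
proof -
  define B where "B = conj_by ` carrier N"
  have B: "B \<subseteq> auto N" by (auto simp: B_def)
  have conj: "g \<star> b \<star> inv\<^bsub>A\<^esub> g \<in> B" if "g \<in> auto N" "b \<in> B" for g b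
    using that conj_by_conj[OF that(1)] by (auto simp: B_def)
  show ?thesis
  proof (rule inner_of_conjugate_powers)
    show "\<phi> ` B \<subseteq> IA" using iso_IA[OF p] by (auto simp: B_def)
    show "g \<star> b \<star> inv\<^bsub>A\<^esub> g \<in> \<phi> ` B" if "g \<in> auto N" "b \<in> \<phi> ` B" for g b
      using iso_normal_image[OF p B conj that] .
    show "\<phi> (conj_by (x i)) \<in> \<phi> ` B" using i by (simp add: B_def)
    fix b assume "b \<in> \<phi> ` B"
    then obtain m where m: "m \<in> carrier N" "b = \<phi> (conj_by m)" by (auto simp: B_def)
    have "inv\<^bsub>A\<^esub> b = \<phi> (conj_by (inv m))"
      using m by (simp add: iso_inv[OF p, symmetric] conj_by_inv)
    then show "inv\<^bsub>A\<^esub> b \<in> \<phi> ` B" using m by (simp add: B_def)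
    show "\<exists>k\<in>auto N. \<exists>c::int. b = (k \<star> \<phi> (conj_by (x i)) \<star> inv\<^bsub>A\<^esub> k) [^]\<^bsub>A\<^esub> c"
    proof -
      obtain k and c :: int where k: "k \<in> auto N"
        "conj_by m = (k \<star> conj_by (x i) \<star> inv\<^bsub>A\<^esub> k) [^]\<^bsub>A\<^esub> c"
        using inner_is_conjugate_power[OF i m(1)] by blast
      have "b = (\<phi> (k \<star> conj_by (x i) \<star> inv\<^bsub>A\<^esub> k)) [^]\<^bsub>A\<^esub> c"
        unfolding m(2) k(2) using group_hom.hom_int_pow[OF iso_group_hom[OF p]] k i
        by (simp add: carrier_A)
      then show ?thesis
        using k i iso_auto[OF p k(1)] by (auto simp: iso_mult[OF p] iso_inv[OF p])
    qed
    fix c assume "c \<in> \<phi> ` B"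
    then obtain n where n: "n \<in> carrier N" "c = \<phi> (conj_by n)" by (auto simp: B_def)
    have "b \<star> c = \<phi> (conj_by (m \<otimes> n))"
      using m n by (simp add: iso_mult[OF p] conj_by_mult)
    then show "b \<star> c \<in> \<phi> ` B" using m n by (simp add: B_def)
  qed
qed

lemma conj_by_one: "conj_by \<one> = \<one>\<^bsub>A\<^esub>"
  by (rule auto_eqI) auto

text \<open>Elements inducing the images of the basis conjugations are unique only modulo the
  centre; freeness turns any choice of them into a homomorphism.\<close>

lemma iso_inner_hom:
  assumes p: "\<phi> \<in> iso A A"
  obtains h where "h \<in> hom N N" "\<And>n. n \<in> carrier N \<Longrightarrow> \<phi> (conj_by n) = conj_by (h n)"
proof -
  obtain f where f: "\<And>i. i \<in> I \<Longrightarrow> f i \<in> carrier N" "\<And>i. i \<in> I \<Longrightarrow> \<phi> (conj_by (x i)) = conj_by (f i)"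
    using iso_inner_basis[OF p] by metis
  obtain h where h: "h \<in> hom N N" "\<And>i. i \<in> I \<Longrightarrow> h (x i) = f i" by (rule extendE[of f]) (use f in auto)
  interpret h: group_hom N N h by unfold_locales (rule h(1))
  have "\<phi> (conj_by n) = conj_by (h n)" if "n \<in> carrier N" for n
    using that
  proof (induction rule: basis_induct)
    case one
    show ?case using iso_one[OF p] by (simp add: conj_by_one)
  next
    case (basis i)
    then show ?case using f h by simp
  next
    case (inv m)
    then show ?case using iso_inv[OF p, of "conj_by m"] by (simp add: conj_by_inv)
  next
    case (mult m n)
    then show ?case using iso_mult[OF p, of "conj_by m" "conj_by n"] by (simp add: conj_by_mult)
  qed
  then show thesis using that h(1) by blast
qed

text \<open>The homomorphisms induced by \<open>\<phi>\<close> and its inverse are inverse to each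
  other only modulo the centre. Both composites are trivial on the abelianisation, hence bijective,
  and so is the lift.\<close>

lemma iso_inner_auto:
  assumes p: "\<phi> \<in> iso A A"
  obtains \<gamma> where "\<gamma> \<in> auto N" "\<And>n. n \<in> carrier N \<Longrightarrow> \<phi> (conj_by n) = conj_by (\<gamma> n)"
proof -
  define \<psi> where "\<psi> = inv_into (carrier A) \<phi>"
  have ps: "\<psi> \<in> iso A A" unfolding \<psi>_def by (rule A.iso_set_sym[OF p])
  have bij: "bij_betw \<phi> (carrier A) (carrier A)" using p by (simp add: iso_def)
  have pp: "\<psi> (\<phi> g) = g" "\<phi> (\<psi> g) = g" if "g \<in> auto N" for g
    using bij that by (simp_all add: \<psi>_def carrier_A bij_betw_inv_into_left bij_betw_inv_into_right)
  obtain h where h: "h \<in> hom N N" "\<And>n. n \<in> carrier N \<Longrightarrow> \<phi> (conj_by n) = conj_by (h n)"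
    using iso_inner_hom[OF p] by blast
  obtain h' where h': "h' \<in> hom N N" "\<And>n. n \<in> carrier N \<Longrightarrow> \<psi> (conj_by n) = conj_by (h' n)"
    using iso_inner_hom[OF ps] by blast
  have hc: "h n \<in> carrier N" "h' n \<in> carrier N" if "n \<in> carrier N" for n
    using h(1) h'(1) that by (auto simp: hom_def)
  have u: "e (compose (carrier N) h' h n) i = e n i" if n: "n \<in> carrier N" for n i
  proof -
    have "conj_by (h' (h n)) = \<psi> (\<phi> (conj_by n))" using h(2)[OF n] h'(2)[OF hc(1)[OF n]] by simp
    then have "conj_by (h' (h n)) = conj_by n" using pp(1)[of "conj_by n"] n by simp
    then show ?thesis using conj_by_eq_iff[of "h' (h n)" n] hc n by (simp add: compose_def)
  qed
  have u': "e (compose (carrier N) h h' n) i = e n i" if n: "n \<in> carrier N" for n i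
  proof -
    have "conj_by (h (h' n)) = \<phi> (\<psi> (conj_by n))" using h'(2)[OF n] h(2)[OF hc(2)[OF n]] by simp
    then have "conj_by (h (h' n)) = conj_by n" using pp(2)[of "conj_by n"] n by simp
    then show ?thesis using conj_by_eq_iff[of "h (h' n)" n] hc n by (simp add: compose_def)
  qed
  obtain \<alpha> where a: "\<alpha> \<in> IA" "\<And>n. n \<in> carrier N \<Longrightarrow> \<alpha> n = h' (h n)"
    by (rule unipotent_IA[OF hom_compose[OF h(1) h'(1)] u]) (simp_all add: compose_def)
  obtain \<beta> where b: "\<beta> \<in> IA" "\<And>n. n \<in> carrier N \<Longrightarrow> \<beta> n = h (h' n)"
    by (rule unipotent_IA[OF hom_compose[OF h'(1) h(1)] u']) (simp_all add: compose_def)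
  define \<gamma> where "\<gamma> = restrict h (carrier N)"
  have "inj_on h (carrier N)"
  proof (rule inj_onI)
    fix m n assume mn: "m \<in> carrier N" "n \<in> carrier N" "h m = h n"
    then have "\<alpha> m = \<alpha> n" using a by simp
    then show "m = n"
      using A_inv(2)[OF IA_auto[OF a(1)] mn(1)] A_inv(2)[OF IA_auto[OF a(1)] mn(2)] by metis
  qed
  moreover have "h ` carrier N = carrier N"
  proof
    show "h ` carrier N \<subseteq> carrier N" using hc by blast
    show "carrier N \<subseteq> h ` carrier N"
    proof
      fix n assume n: "n \<in> carrier N"
      let ?m = "(inv\<^bsub>A\<^esub> \<beta>) n"
      have m: "?m \<in> carrier N" using b(1) n by simp
      then have "n = h (h' ?m)" using A_inv(1)[OF IA_auto[OF b(1)] n] b(2)[OF m] by metis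
      then show "n \<in> h ` carrier N" using hc m by blast
    qed
  qed
  ultimately have "bij_betw \<gamma> (carrier N) (carrier N)"
    by (simp add: \<gamma>_def bij_betw_def inj_on_def image_def)
  moreover have "\<gamma> \<in> hom N N" using h(1) by (auto simp: \<gamma>_def hom_def)
  moreover have "\<gamma> \<in> extensional (carrier N)" by (simp add: \<gamma>_def)
  ultimately have "\<gamma> \<in> auto N" by (simp add: auto_def Bij_def)
  then show thesis using that h(2) by (simp add: \<gamma>_def)
qed

text \<open>Being -1 on the abelianisation, \<open>\<theta>\<close> commutes there with every
  \<open>g\<close>.\<close>

lemma symmetry_commutator_IA:
  assumes t: "\<theta> \<in> auto N" "\<And>n i. n \<in> carrier N \<Longrightarrow> e (\<theta> n) i = - e n i" "inv\<^bsub>A\<^esub> \<theta> = \<theta>"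
    and g: "g \<in> auto N"
  shows "\<theta> \<star> (g \<star> \<theta> \<star> inv\<^bsub>A\<^esub> g) \<in> IA"
proof (rule in_IA)
  show "\<theta> \<star> (g \<star> \<theta> \<star> inv\<^bsub>A\<^esub> g) \<in> auto N" using t g by simp
  fix n i assume n: "n \<in> carrier N"
  let ?m = "(inv\<^bsub>A\<^esub> g) n"
  have m: "?m \<in> carrier N" using g n by simp
  have "e (g (\<theta> ?m)) i = e (g (inv ?m)) i"
    by (rule e_hom_cong[OF auto_hom[OF g]]) (use t m in auto)
  then have "e (g (\<theta> ?m)) i = - e n i" using g n by simp
  then show "e ((\<theta> \<star> (g \<star> \<theta> \<star> inv\<^bsub>A\<^esub> g)) n) i = e n i"
    using t g n by simp
qed

text \<open>Exchange \<open>j\<close> with an index \<open>l\<close> absent from the finitely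
  supported row \<open>i\<close>: the entry at \<open>(i, l, k)\<close> is zero, so the one at
  \<open>(i, j, k)\<close> is even. The row stays in place only if \<open>j \<noteq> i\<close>;
  otherwise antisymmetry lets \<open>k\<close> take the part of \<open>j\<close>.\<close>

lemma even_if_symmetric:
  assumes t: "t \<in> tensors I"
    and sym: "\<And>p. (\<And>i. p (p i) = i) \<Longrightarrow> p ` I \<subseteq> I \<Longrightarrow>
      \<exists>v. \<forall>i j k. t i j k - t (p i) (p j) (p k) = 2 * (v i j k :: int)"
  shows "even (t i j k)"
proof (rule ccontr)
  have main: False if odd: "odd (t i j k)" and ne: "j \<noteq> i" for i j k
  proof -
    have nz: "t i j k \<noteq> 0" using odd by auto
    have I: "j \<in> I" using tensors_in[OF t nz] by blast
    have jk: "j \<noteq> k" using nz tensors_diag[OF t] by auto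
    let ?F = "{i, j, k} \<union> {j. \<exists>k. t i j k \<noteq> 0}"
    obtain l where l: "l \<in> I" "l \<notin> ?F" using fresh[of ?F] tensors_finite_support[OF t] by auto
    define p where "p = (\<lambda>a. if a = j then l else if a = l then j else a)"
    have pp: "p (p a) = a" for a by (simp add: p_def)
    have pI: "p ` I \<subseteq> I" using l I by (auto simp: p_def)
    obtain v where v: "\<And>i j k. t i j k - t (p i) (p j) (p k) = 2 * v i j k"
      using sym[OF pp pI] by blast
    have "p i = i" "p j = l" "p k = k" using l ne jk by (auto simp: p_def)
    then have "t i j k = 2 * v i j k" using v[of i j k] l by simp
    then show False using odd by simp
  qed
  assume odd: "odd (t i j k)"
  then have nz: "t i j k \<noteq> 0" by auto
  then have "j \<noteq> k" using tensors_diag[OF t] by auto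
  then consider "j \<noteq> i" | "k \<noteq> i" by auto
  then show False
  proof cases
    case 2
    moreover have "odd (t i k j)" using odd tensors_anti[OF t, of i j k] by simp
    ultimately show False using main by blast
  qed (use main odd in blast)
qed

lemma iso_fixing_inner:
  assumes p: "\<phi> \<in> iso A A" and fix_inner: "\<And>n. n \<in> carrier N \<Longrightarrow> \<phi> (conj_by n) = conj_by n"
  obtains \<beta> where "\<beta> \<in> auto N" "\<And>g. g \<in> auto N \<Longrightarrow> \<phi> g = \<beta> \<star> g \<star> inv\<^bsub>A\<^esub> \<beta>"
proof -
  \<comment> \<open>\<open>g\<close> and \<open>\<phi> g\<close> act in the same way on the
    conjugations, hence on the abelianisation, so \<open>v\<close> takes values in
    \<open>IA\<close>.\<close>
  define v where "v = (\<lambda>g. inv\<^bsub>A\<^esub> g \<star> \<phi> g)"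
  note pA [simp] = iso_auto[OF p]
  have v: "v g \<in> IA" if g: "g \<in> auto N" for g
  proof (rule in_IA)
    show "v g \<in> auto N" using g by (simp add: v_def)
    fix n i assume n: "n \<in> carrier N"
    have "conj_by (\<phi> g n) = \<phi> g \<star> conj_by n \<star> inv\<^bsub>A\<^esub> (\<phi> g)"
      using conj_by_conj[OF pA[OF g] n] by simp
    also have "\<dots> = \<phi> (g \<star> conj_by n \<star> inv\<^bsub>A\<^esub> g)"
      using g n by (simp add: iso_mult[OF p] iso_inv[OF p] fix_inner)
    also have "\<dots> = conj_by (g n)" using g n by (simp add: conj_by_conj fix_inner)
    finally have eq: "e (\<phi> g n) j = e (g n) j" for j
      using conj_by_eq_iff[of "\<phi> g n" "g n"] g n by simp
    have "inv\<^bsub>A\<^esub> g \<in> auto N" using g by simp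
    then have "e ((inv\<^bsub>A\<^esub> g) (\<phi> g n)) i = e ((inv\<^bsub>A\<^esub> g) (g n)) i"
      by (rule e_hom_cong[OF auto_hom _ _ eq]) (use g n in simp_all)
    then show "e (v g n) i = e n i" using g n by (simp add: v_def)
  qed
  have pv: "\<phi> g = g \<star> v g" if "g \<in> auto N" for g using that by (simp add: v_def)
  have pIA: "\<phi> \<alpha> \<in> IA" if "\<alpha> \<in> IA" for \<alpha> using iso_IA[OF p that] .
  \<comment> \<open>\<open>v g\<close> and \<open>\<phi> \<alpha>\<close> both lie in the abelian
    group \<open>IA\<close>, so conjugating by \<open>\<phi> g\<close> or by \<open>g\<close> makes
    no difference.\<close>
  have equiv: "\<phi> (g \<star> \<alpha> \<star> inv\<^bsub>A\<^esub> g) = g \<star> \<phi> \<alpha> \<star> inv\<^bsub>A\<^esub> g"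
    if g: "g \<in> auto N" and a: "\<alpha> \<in> IA" for g \<alpha>
  proof -
    have "\<phi> (g \<star> \<alpha> \<star> inv\<^bsub>A\<^esub> g) = \<phi> g \<star> \<phi> \<alpha> \<star> inv\<^bsub>A\<^esub> (\<phi> g)"
      using g a by (simp add: iso_mult[OF p] iso_inv[OF p])
    also have "\<dots> = g \<star> (v g \<star> \<phi> \<alpha>) \<star> inv\<^bsub>A\<^esub> (v g) \<star> inv\<^bsub>A\<^esub> g"
      unfolding pv[OF g] using g v[OF g] pIA[OF a]
      by (simp add: A.m_assoc A.inv_mult_group carrier_A)
    also have "\<dots> = g \<star> \<phi> \<alpha> \<star> inv\<^bsub>A\<^esub> g"
      unfolding IA_comm[OF v[OF g] pIA[OF a]] using g v[OF g] pIA[OF a]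
      by (simp add: A.m_assoc carrier_A)
    finally show ?thesis .
  qed
  \<comment> \<open>An inverse of \<open>tens\<close> on tensors, with arbitrary values
    elsewhere.\<close>
  define real where "real = (\<lambda>s. SOME \<alpha>. \<alpha> \<in> IA \<and> tens \<alpha> = s)"
  have real: "real s \<in> IA" "tens (real s) = s" if "s \<in> tensors I" for s
    using someI_ex[of "\<lambda>\<alpha>. \<alpha> \<in> IA \<and> tens \<alpha> = s"] tensors_realised[OF that] by (auto simp: real_def)
  have real_tens: "real (tens \<alpha>) = \<alpha>" if "\<alpha> \<in> IA" for \<alpha>
    using real[OF tens_tensors[OF that]] IA_eqI that by blast
  define \<Phi> where "\<Phi> = (\<lambda>s. tens (\<phi> (real s)))"
  interpret T: tensor_map I \<Phi>
  proof
    show "infinite I" by (rule infinite_basis)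
    fix s assume s: "s \<in> tensors I"
    show "\<Phi> s \<in> tensors I" unfolding \<Phi>_def by (rule tens_tensors[OF pIA[OF real(1)[OF s]]])
    show "\<Phi> (\<lambda>i j k. s i j k + t i j k) = (\<lambda>i j k. \<Phi> s i j k + \<Phi> t i j k)" if t: "t \<in> tensors I" for t
    proof -
      have "real (\<lambda>i j k. s i j k + t i j k) = real s \<star> real t"
        using real_tens[OF IA_mult[OF real(1)[OF s] real(1)[OF t]]] real s t by (simp add: tens_mult)
      then show ?thesis
        unfolding \<Phi>_def using real s t by (simp add: iso_mult[OF p] tens_mult pIA)
    qed
    show "\<Phi> (transvect u w s) = transvect u w (\<Phi> s)" if uw: "u \<in> I" "w \<in> I" "u \<noteq> w" for u w
    proof -
      obtain g where g: "g \<in> auto N"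
        "\<And>\<alpha>. \<alpha> \<in> IA \<Longrightarrow> tens (g \<star> \<alpha> \<star> inv\<^bsub>A\<^esub> g) = transvect u w (tens \<alpha>)"
        using transvection_exists[OF uw] by metis
      have "real (transvect u w s) = g \<star> real s \<star> inv\<^bsub>A\<^esub> g"
        using real_tens[OF IA_conj[OF g(1) real(1)[OF s]]] g(2)[OF real(1)[OF s]] real(2)[OF s] by simp
      then show ?thesis
        unfolding \<Phi>_def using equiv[OF g(1) real(1)[OF s]] g(2)[OF pIA[OF real(1)[OF s]]] by simp
    qed
    show "\<Phi> (permute r s) = permute r (\<Phi> s)" if r: "\<And>i. r (r i) = i" "r ` I \<subseteq> I" for r
    proof -
      obtain g where g: "g \<in> auto N"
        "\<And>\<alpha>. \<alpha> \<in> IA \<Longrightarrow> tens (g \<star> \<alpha> \<star> inv\<^bsub>A\<^esub> g) = permute r (tens \<alpha>)"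
        using permutation_exists[OF r] by metis
      have "real (permute r s) = g \<star> real s \<star> inv\<^bsub>A\<^esub> g"
        using real_tens[OF IA_conj[OF g(1) real(1)[OF s]]] g(2)[OF real(1)[OF s]] real(2)[OF s] by simp
      then show ?thesis
        unfolding \<Phi>_def using equiv[OF g(1) real(1)[OF s]] g(2)[OF pIA[OF real(1)[OF s]]] by simp
    qed
  next
    fix a assume a: "a \<in> fin_vec I"
    obtain n where n: "n \<in> carrier N" "e n = a" using vector_realised[OF a] by blast
    have "real (inner_tensor I a) = conj_by n"
      using real_tens[of "conj_by n"] n by (simp add: tens_conj_by)
    then show "\<Phi> (inner_tensor I a) = inner_tensor I a"
      unfolding \<Phi>_def using n by (simp add: fix_inner tens_conj_by)
  qed
  have fixIA: "\<phi> \<alpha> = \<alpha>" if a: "\<alpha> \<in> IA" for \<alpha>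
  proof (rule IA_eqI[OF pIA[OF a] a])
    show "tens (\<phi> \<alpha>) = tens \<alpha>"
      using T.tensor_map_trivial[OF tens_tensors[OF a]] by (simp add: \<Phi>_def real_tens[OF a])
  qed
  obtain \<theta> where t: "\<theta> \<in> auto N" "inv\<^bsub>A\<^esub> \<theta> = \<theta>" "\<And>n i. n \<in> carrier N \<Longrightarrow> e (\<theta> n) i = - e n i"
    and tIA: "\<And>\<alpha>. \<alpha> \<in> IA \<Longrightarrow> \<theta> \<star> \<alpha> \<star> inv\<^bsub>A\<^esub> \<theta> = inv\<^bsub>A\<^esub> \<alpha>"
    and tperm: "\<And>p g. (\<And>i. i \<in> I \<Longrightarrow> p i \<in> I) \<Longrightarrow> g \<in> auto N \<Longrightarrow> (\<And>i. i \<in> I \<Longrightarrow> g (x i) = x (p i)) \<Longrightarrow>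
       g \<star> \<theta> = \<theta> \<star> g"
    using symmetry_exists by metis
  have tswap: "\<alpha> \<star> \<theta> = \<theta> \<star> inv\<^bsub>A\<^esub> \<alpha>" if a: "\<alpha> \<in> IA" for \<alpha>
  proof -
    have "inv\<^bsub>A\<^esub> (inv\<^bsub>A\<^esub> \<alpha>) = \<theta> \<star> inv\<^bsub>A\<^esub> \<alpha> \<star> inv\<^bsub>A\<^esub> \<theta>"
      using tIA[OF IA_inv[OF a]] by simp
    then have "\<alpha> = \<theta> \<star> inv\<^bsub>A\<^esub> \<alpha> \<star> inv\<^bsub>A\<^esub> \<theta>" using a by (simp add: carrier_A)
    then have "\<alpha> \<star> \<theta> = \<theta> \<star> inv\<^bsub>A\<^esub> \<alpha> \<star> inv\<^bsub>A\<^esub> \<theta> \<star> \<theta>" by simp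
    then show ?thesis using a t(1) by (simp add: A.m_assoc carrier_A)
  qed
  define a where "a = v \<theta>"
  have a: "a \<in> IA" and pt: "\<phi> \<theta> = \<theta> \<star> a" using v pv t(1) by (simp_all add: a_def)
  have "even (tens a i j k)" for i j k
  proof (rule even_if_symmetric[OF tens_tensors[OF a]])
    fix r :: "'i \<Rightarrow> 'i" assume r: "\<And>i. r (r i) = i" "r ` I \<subseteq> I"
    obtain g where g: "g \<in> auto N" "inv\<^bsub>A\<^esub> g = g" "\<And>i. i \<in> I \<Longrightarrow> g (x i) = x (r i)"
      "\<And>\<alpha>. \<alpha> \<in> IA \<Longrightarrow> tens (g \<star> \<alpha> \<star> inv\<^bsub>A\<^esub> g) = permute r (tens \<alpha>)"
      using permutation_exists[OF r] by metis
    \<comment> \<open>Applying \<open>\<phi>\<close> to this commutation shows, in additive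
      notation, that \<open>a\<close> minus its translate by \<open>g\<close> is twice
      \<open>v g\<close>.\<close>
    have gt: "g \<star> \<theta> = \<theta> \<star> g" using tperm[OF _ g(1,3)] r by blast
    have vg: "v g \<in> IA" by (rule v[OF g(1)])
    have "\<phi> g \<star> \<phi> \<theta> = \<phi> \<theta> \<star> \<phi> g"
      using gt g(1) t(1) by (simp add: iso_mult[OF p, symmetric])
    then have "(g \<star> v g) \<star> (\<theta> \<star> a) = (\<theta> \<star> a) \<star> (g \<star> v g)"
      using pv[OF g(1)] pt by simp
    moreover have "(g \<star> v g) \<star> (\<theta> \<star> a) = g \<star> (v g \<star> \<theta>) \<star> a"
      using g(1) vg t(1) a by (simp add: A.m_assoc carrier_A)
    moreover have "\<dots> = (g \<star> \<theta>) \<star> (inv\<^bsub>A\<^esub> (v g) \<star> a)"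
      unfolding tswap[OF vg] using g(1) vg t(1) a by (simp add: A.m_assoc carrier_A)
    moreover have "\<dots> = \<theta> \<star> (g \<star> (inv\<^bsub>A\<^esub> (v g) \<star> a))"
      unfolding gt using g(1) vg t(1) a by (simp add: A.m_assoc carrier_A)
    moreover have "(\<theta> \<star> a) \<star> (g \<star> v g) = \<theta> \<star> (a \<star> (g \<star> v g))"
      using g(1) vg t(1) a by (simp add: A.m_assoc carrier_A)
    ultimately have "\<theta> \<star> (g \<star> (inv\<^bsub>A\<^esub> (v g) \<star> a)) = \<theta> \<star> (a \<star> (g \<star> v g))"
      by metis
    then have "g \<star> (inv\<^bsub>A\<^esub> (v g) \<star> a) = a \<star> (g \<star> v g)"
      by (rule A_left_cancel) (use g(1) vg t(1) a in auto)
    then have "g \<star> (g \<star> (inv\<^bsub>A\<^esub> (v g) \<star> a)) = (g \<star> a \<star> g) \<star> v g"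
      using g(1) vg a by (simp add: A.m_assoc carrier_A)
    then have "inv\<^bsub>A\<^esub> (v g) \<star> a = (g \<star> a \<star> inv\<^bsub>A\<^esub> g) \<star> v g"
      using A_cancel(1)[of g "inv\<^bsub>A\<^esub> (v g) \<star> a"] g(1,2) vg a by simp
    then have "tens (inv\<^bsub>A\<^esub> (v g) \<star> a) = tens ((g \<star> a \<star> inv\<^bsub>A\<^esub> g) \<star> v g)"
      by (rule arg_cong)
    then have eq: "(\<lambda>i j k. - tens (v g) i j k + tens a i j k) = (\<lambda>i j k. permute r (tens a) i j k + tens (v g) i j k)"
      using tens_mult[OF IA_inv[OF vg] a] tens_mult[OF IA_conj[OF g(1) a] vg] tens_inv[OF vg] g(4)[OF a] by simp
    have "tens a i j k - tens a (r i) (r j) (r k) = 2 * tens (v g) i j k" for i j k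
      using fun_cong[OF fun_cong[OF fun_cong[OF eq, of i], of j], of k] by (simp add: permute_def)
    then show "\<exists>v. \<forall>i j k. tens a i j k - tens a (r i) (r j) (r k) = 2 * v i j k" by blast
  qed
  then have half: "tens a i j k = 2 * (tens a i j k div 2)" for i j k by simp
  let ?s = "\<lambda>i j k. tens a i j k div 2"
  have "?s \<in> tensors I"
  proof (rule tensorsI)
    fix i j k
    show "?s i j k \<noteq> 0 \<Longrightarrow> i \<in> I \<and> j \<in> I \<and> k \<in> I"
      using tensors_in[OF tens_tensors[OF a], of i j k] by auto
    show "?s i j k = - ?s i k j"
      using tensors_anti[OF tens_tensors[OF a], of i j k] half[of i j k] half[of i k j] by linarith
    show "finite {(j, k). ?s i j k \<noteq> 0}"
      by (rule finite_subset[OF _ tensors_finite[OF tens_tensors[OF a], of i]]) auto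
  qed
  then obtain \<beta> where b: "\<beta> \<in> IA" "tens \<beta> = ?s" using tensors_realised by blast
  have "a = \<beta> \<star> \<beta>"
  proof (rule IA_eqI[OF a IA_mult[OF b(1) b(1)]])
    show "tens a = tens (\<beta> \<star> \<beta>)" unfolding tens_mult[OF b(1) b(1)] b(2) using half by (intro ext) simp
  qed
  then have pt': "\<phi> \<theta> = \<theta> \<star> (\<beta> \<star> \<beta>)" using pt by simp
  have bA: "\<beta> \<in> auto N" using b by simp
  \<comment> \<open>As \<open>\<theta>\<close> inverts \<open>IA\<close>, conjugation by
    \<open>\<beta>\<close> absorbs exactly the square of \<open>\<beta>\<close> by which
    \<open>\<phi> \<theta>\<close> differs from \<open>\<theta>\<close>.\<close>
  define \<psi> where "\<psi> = (\<lambda>g. \<beta> \<star> \<phi> g \<star> inv\<^bsub>A\<^esub> \<beta>)"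
  have psA: "\<psi> g \<in> auto N" if "g \<in> auto N" for g using that bA by (simp add: \<psi>_def)
  have psm: "\<psi> (g \<star> h) = \<psi> g \<star> \<psi> h" if "g \<in> auto N" "h \<in> auto N" for g h
    using that bA by (simp add: \<psi>_def iso_mult[OF p] A.m_assoc carrier_A)
  have pst: "\<psi> \<theta> = \<theta>"
  proof -
    have "\<psi> \<theta> = (\<beta> \<star> \<theta>) \<star> \<beta>"
      using bA t(1) by (simp add: \<psi>_def pt' A.m_assoc carrier_A)
    then show ?thesis unfolding tswap[OF b(1)] using bA t(1) by (simp add: A.m_assoc carrier_A)
  qed
  have psIA: "\<psi> \<alpha> = \<alpha>" if al: "\<alpha> \<in> IA" for \<alpha>
    using IA_comm[OF b(1) al] al bA by (simp add: \<psi>_def fixIA A.m_assoc carrier_A)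
  have "\<psi> g = g" if g: "g \<in> auto N" for g
  proof -
    define u where "u = inv\<^bsub>A\<^esub> g \<star> \<psi> g"
    have "u = (inv\<^bsub>A\<^esub> g \<star> \<beta> \<star> inv\<^bsub>A\<^esub> (inv\<^bsub>A\<^esub> g)) \<star> (v g \<star> inv\<^bsub>A\<^esub> \<beta>)"
      unfolding u_def \<psi>_def pv[OF g] using g v[OF g] bA by (simp add: A.m_assoc carrier_A)
    then have u: "u \<in> IA"
      using IA_mult[OF IA_conj[of "inv\<^bsub>A\<^esub> g" \<beta>] IA_mult[OF v[OF g] IA_inv[OF b(1)]]] g b(1) by simp
    have gu: "\<psi> g = g \<star> u" using g psA by (simp add: u_def)
    \<comment> \<open>\<open>\<psi>\<close> fixes both \<open>\<theta>\<close> and the element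
      \<open>c\<close> of \<open>IA\<close>. Applying it to
      \<open>\<theta> \<star> c \<star> g = g \<star> \<theta>\<close> shows that \<open>u\<close>
      equals its inverse.\<close>
    define c where "c = \<theta> \<star> (g \<star> \<theta> \<star> inv\<^bsub>A\<^esub> g)"
    have c: "c \<in> IA" unfolding c_def by (rule symmetry_commutator_IA[OF t(1,3,2) g])
    have tc: "\<theta> \<star> c \<star> g = g \<star> \<theta>"
    proof -
      have "\<theta> \<star> c = inv\<^bsub>A\<^esub> \<theta> \<star> c" using t(2) by simp
      also have "\<dots> = g \<star> \<theta> \<star> inv\<^bsub>A\<^esub> g" unfolding c_def using g t(1) by simp
      finally show ?thesis using g t(1) by (simp add: A.m_assoc carrier_A)
    qed
    have "\<theta> \<star> c \<star> (g \<star> u) = g \<star> u \<star> \<theta>"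
      using arg_cong[OF tc, of \<psi>] g t(1) c by (simp add: psm pst psIA gu)
    moreover have "\<theta> \<star> c \<star> (g \<star> u) = g \<star> (\<theta> \<star> u)"
      using tc g t(1) c u by (simp add: A.m_assoc[symmetric] carrier_A)
    moreover have "g \<star> u \<star> \<theta> = g \<star> (\<theta> \<star> inv\<^bsub>A\<^esub> u)"
      using tswap[OF u] g t(1) u by (simp add: A.m_assoc carrier_A)
    ultimately have "g \<star> (\<theta> \<star> u) = g \<star> (\<theta> \<star> inv\<^bsub>A\<^esub> u)" by simp
    then have "\<theta> \<star> u = \<theta> \<star> inv\<^bsub>A\<^esub> u"
      by (rule A_left_cancel) (use g t(1) u in auto)
    then have ui: "u = inv\<^bsub>A\<^esub> u"
      by (rule A_left_cancel) (use t(1) u in auto)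
    have "tens u i j k = 0" for i j k
    proof -
      have "tens u i j k = - tens u i j k" using arg_cong[OF ui, of tens] tens_inv[OF u] by metis
      then show ?thesis by simp
    qed
    then have "u = \<one>\<^bsub>A\<^esub>" by (intro IA_eqI[OF u IA_one]) (simp add: tens_one fun_eq_iff)
    then show ?thesis using gu g by (simp add: carrier_A)
  qed
  then have "\<phi> g = inv\<^bsub>A\<^esub> \<beta> \<star> g \<star> inv\<^bsub>A\<^esub> (inv\<^bsub>A\<^esub> \<beta>)" if g: "g \<in> auto N" for g
  proof -
    have "inv\<^bsub>A\<^esub> \<beta> \<star> \<psi> g \<star> \<beta> = \<phi> g"
      using g bA by (simp add: \<psi>_def A.m_assoc carrier_A)
    then show ?thesis using \<open>\<And>g. g \<in> auto N \<Longrightarrow> \<psi> g = g\<close>[OF g] bA by (simp add: carrier_A)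
  qed
  then show thesis using that[of "inv\<^bsub>A\<^esub> \<beta>"] bA by simp
qed

theorem complete: "complete_group A"
  unfolding complete_group_def
proof (intro conjI ballI)
  show "group A" by (rule A.is_group)
  show "centre A = {\<one>\<^bsub>A\<^esub>}" by (rule centre_A)
  fix \<phi> assume "\<phi> \<in> auto A"
  then have p: "\<phi> \<in> iso A A" and ext: "\<phi> \<in> extensional (carrier A)"
    by (auto simp: auto_def iso_def Bij_def)
  obtain \<gamma> where g: "\<gamma> \<in> auto N" "\<And>n. n \<in> carrier N \<Longrightarrow> \<phi> (conj_by n) = conj_by (\<gamma> n)"
    using iso_inner_auto[OF p] by blast
  define \<psi> where "\<psi> = (\<lambda>h. inv\<^bsub>A\<^esub> \<gamma> \<star> \<phi> h \<star> \<gamma>)"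
  have "\<psi> \<in> hom A A"
    by (rule homI)
      (use g(1) iso_auto[OF p] in \<open>simp_all add: \<psi>_def iso_mult[OF p] A.m_assoc carrier_A\<close>)
  moreover have "bij_betw \<psi> (carrier A) (carrier A)"
  proof -
    have "bij_betw (\<lambda>h. inv\<^bsub>A\<^esub> \<gamma> \<star> h \<star> \<gamma>) (carrier A) (carrier A)"
      by (rule bij_betwI[of _ _ _ "\<lambda>h. \<gamma> \<star> h \<star> inv\<^bsub>A\<^esub> \<gamma>"])
        (use g(1) in \<open>simp_all add: A.m_assoc carrier_A\<close>)
    moreover have "bij_betw \<phi> (carrier A) (carrier A)" using p by (simp add: iso_def)
    ultimately show ?thesis using bij_betw_trans by (fastforce simp: \<psi>_def comp_def)
  qed
  ultimately have ps: "\<psi> \<in> iso A A" by (simp add: iso_def)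
  have "\<psi> (conj_by n) = conj_by n" if n: "n \<in> carrier N" for n
  proof -
    have "\<psi> (conj_by n) = inv\<^bsub>A\<^esub> \<gamma> \<star> (\<gamma> \<star> conj_by n \<star> inv\<^bsub>A\<^esub> \<gamma>) \<star> \<gamma>"
      unfolding \<psi>_def g(2)[OF n] conj_by_conj[OF g(1) n] ..
    then show ?thesis using g(1) n by (simp add: A.m_assoc carrier_A)
  qed
  then obtain \<beta> where b: "\<beta> \<in> auto N" "\<And>g. g \<in> auto N \<Longrightarrow> \<psi> g = \<beta> \<star> g \<star> inv\<^bsub>A\<^esub> \<beta>"
    using iso_fixing_inner[OF ps] by blast
  let ?d = "\<gamma> \<star> \<beta>"
  have "\<phi> h = ?d \<star> h \<star> inv\<^bsub>A\<^esub> ?d" if h: "h \<in> auto N" for h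
  proof -
    have "\<phi> h = \<gamma> \<star> \<psi> h \<star> inv\<^bsub>A\<^esub> \<gamma>"
      using g(1) iso_auto[OF p h] by (simp add: \<psi>_def A.m_assoc carrier_A)
    then show ?thesis
      using g(1) b h by (simp add: A.m_assoc A.inv_mult_group carrier_A)
  qed
  then have "\<phi> = (\<lambda>h\<in>carrier A. ?d \<star> h \<star> inv\<^bsub>A\<^esub> ?d)"
    by (intro extensionalityI[OF ext]) (auto simp: carrier_A)
  then show "\<phi> \<in> inner_auto A"
    unfolding inner_auto_def using g(1) b(1) by (auto simp: carrier_A)
qed

end


subsection \<open>Coordinates on the free class two group\<close>

definition class_two :: "('a, 'b) monoid_scheme \<Rightarrow> bool" where
  "class_two G \<longleftrightarrow> (\<forall>a\<in>carrier G. \<forall>b\<in>carrier G. \<forall>c\<in>carrier G.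
     (a \<otimes>\<^bsub>G\<^esub> b \<otimes>\<^bsub>G\<^esub> inv\<^bsub>G\<^esub> a \<otimes>\<^bsub>G\<^esub> inv\<^bsub>G\<^esub> b) \<otimes>\<^bsub>G\<^esub> c = c \<otimes>\<^bsub>G\<^esub> (a \<otimes>\<^bsub>G\<^esub> b \<otimes>\<^bsub>G\<^esub> inv\<^bsub>G\<^esub> a \<otimes>\<^bsub>G\<^esub> inv\<^bsub>G\<^esub> b))"

text \<open>The series with constant term 1 in noncommuting variables, truncated above degree two:
  \<open>a\<close> and \<open>q\<close> are the coefficients of degree one and two, with no bound on
  their supports.\<close>

definition coordinate_group :: "(('i \<Rightarrow> int) \<times> ('i \<Rightarrow> 'i \<Rightarrow> int)) monoid" where
  "coordinate_group = \<lparr>carrier = UNIV,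
     mult = (\<lambda>(a, q) (b, r). (\<lambda>i. a i + b i, \<lambda>i j. q i j + r i j + a i * b j)),
     one = (\<lambda>i. 0, \<lambda>i j. 0)\<rparr>"

lemma coordinate_group_inverse:
  "(\<lambda>i. - a i, \<lambda>i j. a i * a j - q i j) \<otimes>\<^bsub>coordinate_group\<^esub> (a, q) = \<one>\<^bsub>coordinate_group\<^esub>"
  by (simp add: coordinate_group_def)

lemma group_coordinate_group: "group coordinate_group"
proof (rule groupI)
  fix a b c :: "('i \<Rightarrow> int) \<times> ('i \<Rightarrow> 'i \<Rightarrow> int)"
  show "a \<otimes>\<^bsub>coordinate_group\<^esub> b \<otimes>\<^bsub>coordinate_group\<^esub> c = a \<otimes>\<^bsub>coordinate_group\<^esub> (b \<otimes>\<^bsub>coordinate_group\<^esub> c)"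
    by (cases a; cases b; cases c) (simp add: coordinate_group_def algebra_simps)
  show "\<one>\<^bsub>coordinate_group\<^esub> \<otimes>\<^bsub>coordinate_group\<^esub> a = a"
    by (cases a) (simp add: coordinate_group_def)
  show "\<exists>b\<in>carrier coordinate_group. b \<otimes>\<^bsub>coordinate_group\<^esub> a = \<one>\<^bsub>coordinate_group\<^esub>"
    using coordinate_group_inverse[of "fst a" "snd a"]
    by (intro bexI[of _ "(\<lambda>i. - fst a i, \<lambda>i j. fst a i * fst a j - snd a i j)"])
      (simp_all add: coordinate_group_def)
qed (auto simp: coordinate_group_def)

text \<open>A commutator has no degree one part, and such truncated series commute with all
  others.\<close>

lemma class_two_coordinate_group: "class_two coordinate_group"
proof -
  interpret group coordinate_group by (rule group_coordinate_group)
  have inv: "inv\<^bsub>coordinate_group\<^esub> (a, q) = (\<lambda>i. - a i, \<lambda>i j. a i * a j - q i j)"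
    for a :: "'i \<Rightarrow> int" and q
    by (rule inv_equality[OF coordinate_group_inverse]) (auto simp: coordinate_group_def)
  show ?thesis
    unfolding class_two_def
  proof (intro ballI)
    fix a b c :: "('i \<Rightarrow> int) \<times> ('i \<Rightarrow> 'i \<Rightarrow> int)"
    obtain a1 a2 b1 b2 c1 c2 where "a = (a1, a2)" "b = (b1, b2)" "c = (c1, c2)"
      by (cases a; cases b; cases c) auto
    then show "(a \<otimes>\<^bsub>coordinate_group\<^esub> b \<otimes>\<^bsub>coordinate_group\<^esub> inv\<^bsub>coordinate_group\<^esub> a \<otimes>\<^bsub>coordinate_group\<^esub> inv\<^bsub>coordinate_group\<^esub> b) \<otimes>\<^bsub>coordinate_group\<^esub> c
      = c \<otimes>\<^bsub>coordinate_group\<^esub> (a \<otimes>\<^bsub>coordinate_group\<^esub> b \<otimes>\<^bsub>coordinate_group\<^esub> inv\<^bsub>coordinate_group\<^esub> a \<otimes>\<^bsub>coordinate_group\<^esub> inv\<^bsub>coordinate_group\<^esub> b)"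
      unfolding \<open>a = _\<close> \<open>b = _\<close> \<open>c = _\<close> inv
      by (simp add: coordinate_group_def algebra_simps)
  qed
qed

section \<open>Detecting elements by additive coordinates\<close>

context group
begin

lemma generate_finite:
  assumes b: "b ` J \<subseteq> carrier G" and n: "n \<in> generate G (b ` J)"
  shows "\<exists>F. finite F \<and> F \<subseteq> J \<and> n \<in> generate G (b ` F)"
  using n
proof (induction rule: generate.induct)
  case one
  show ?case by (rule exI[of _ "{}"]) (auto intro: generate.one)
next
  case (incl h)
  then obtain j where "j \<in> J" "h = b j" by blast
  then show ?case by (intro exI[of _ "{j}"]) (auto intro: generate.incl)
next
  case (inv h)
  then obtain j where "j \<in> J" "h = b j" by blast
  then show ?case by (intro exI[of _ "{j}"]) (auto intro: generate.inv)
next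
  case (eng g h)
  then obtain F F' where F: "finite F" "F \<subseteq> J" "g \<in> generate G (b ` F)"
    and F': "finite F'" "F' \<subseteq> J" "h \<in> generate G (b ` F')" by blast
  have "g \<in> generate G (b ` (F \<union> F'))" "h \<in> generate G (b ` (F \<union> F'))"
    using F F' mono_generate[of "b ` F" "b ` (F \<union> F')"] mono_generate[of "b ` F'" "b ` (F \<union> F')"] b
    by auto
  then show ?case using F F' by (intro exI[of _ "F \<union> F'"]) (auto intro: generate.eng)
qed

text \<open>
  Modulo \<open>D\<close>, the group \<open>M\<close> is abelian with basis \<open>b\<close>. This is applied to the whole group modulo its
  derived subgroup and to the derived subgroup modulo \<open>1\<close>.
\<close>

lemma coordinates_detect:
  fixes \<epsilon> :: "'a \<Rightarrow> 'j \<Rightarrow> int"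
  assumes M: "subgroup M G" and D: "subgroup D G" and DM: "D \<subseteq> M"
    and central: "\<And>d m. d \<in> D \<Longrightarrow> m \<in> M \<Longrightarrow> d \<otimes> m = m \<otimes> d"
    and comm: "\<And>a c. a \<in> M \<Longrightarrow> c \<in> M \<Longrightarrow> \<exists>d\<in>D. a \<otimes> c = c \<otimes> a \<otimes> d"
    and b: "\<And>j. j \<in> J \<Longrightarrow> b j \<in> M"
    and add: "\<And>m n j. m \<in> M \<Longrightarrow> n \<in> M \<Longrightarrow> \<epsilon> (m \<otimes> n) j = \<epsilon> m j + \<epsilon> n j"
    and zero: "\<And>d j. d \<in> D \<Longrightarrow> \<epsilon> d j = 0"
    and basis: "\<And>i j. i \<in> J \<Longrightarrow> j \<in> J \<Longrightarrow> \<epsilon> (b i) j = (if i = j then 1 else 0)"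
    and n: "n \<in> generate G (b ` J)" and n0: "\<And>j. j \<in> J \<Longrightarrow> \<epsilon> n j = 0"
  shows "n \<in> D"
proof -
  have MG: "M \<subseteq> carrier G" using M by (rule subgroup.subset)
  have Mc [simp]: "m \<in> carrier G" if "m \<in> M" for m using that MG by blast
  have Dc [simp]: "d \<in> M" if "d \<in> D" for d using that DM by blast
  have Mm [simp]: "m \<otimes> n \<in> M" if "m \<in> M" "n \<in> M" for m n using M that by (rule subgroup.m_closed)
  have Mi [simp]: "inv m \<in> M" if "m \<in> M" for m using M that by (rule subgroup.m_inv_closed)
  have M1 [simp]: "\<one> \<in> M" using M by (rule subgroup.one_closed)
  have Dm [simp]: "m \<otimes> n \<in> D" if "m \<in> D" "n \<in> D" for m n using D that by (rule subgroup.m_closed)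
  have D1 [simp]: "\<one> \<in> D" using D by (rule subgroup.one_closed)
  have Mp [simp]: "m [^] (k::int) \<in> M" if "m \<in> M" for m k using M that by (rule subgroup_int_pow_closed)
  have e1 [simp]: "\<epsilon> \<one> j = 0" for j using zero by simp
  have ei [simp]: "\<epsilon> (inv m) j = - \<epsilon> m j" if "m \<in> M" for m j using add[of m "inv m" j] that by simp
  have ep: "\<epsilon> (m [^] (k::int)) j = k * \<epsilon> m j" if m: "m \<in> M" for m k j
  proof -
    have nat: "m [^] (i::nat) \<in> M \<and> \<epsilon> (m [^] i) j = int i * \<epsilon> m j" for i
      by (induction i) (use m in \<open>auto simp: add algebra_simps\<close>)
    show ?thesis using nat m by (cases k rule: int_cases2) (auto simp: int_pow_int int_pow_neg_int)
  qed
  have gM: "h \<in> M" if "F \<subseteq> J" "h \<in> generate G (b ` F)" for F h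
    using generate_subgroup_incl[OF _ M, of "b ` F"] that b by auto
  have gz: "\<epsilon> h i = 0" if F: "F \<subseteq> J" and i: "i \<in> J" "i \<notin> F" and h: "h \<in> generate G (b ` F)" for F h i
    using h
  proof (induction rule: generate.induct)
    case (incl h)
    then show ?case using F i basis by auto
  next
    case (inv h)
    then obtain j where j: "j \<in> F" "h = b j" by blast
    then have "\<epsilon> h i = 0" "h \<in> M" using F i basis b by auto
    then show ?case by simp
  next
    case (eng g h)
    then show ?case using gM[OF F] by (simp add: add)
  qed simp
  \<comment> \<open>Powers of \<open>b i\<close> are collected on the left, at the price of factors
    in \<open>D\<close>, which commute with all of \<open>M\<close>.\<close>
  have split: "\<exists>k::int. \<exists>h\<in>generate G (b ` F). \<exists>d\<in>D. n = b i [^] k \<otimes> h \<otimes> d"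
    if F: "insert i F \<subseteq> J" and n: "n \<in> generate G (b ` insert i F)" for i F n
    using n
  proof (induction rule: generate.induct)
    case one
    show ?case by (rule exI[of _ 0], rule bexI[of _ \<one>], rule bexI[of _ \<one>]) (auto intro: generate.one)
  next
    case (incl h)
    then consider "h = b i" | "h \<in> b ` F" by blast
    then show ?case
    proof cases
      case 1
      then show ?thesis using F b
        by (intro exI[of _ 1] bexI[of _ \<one>]) (auto intro: generate.one)
    next
      case 2
      then show ?thesis using F b
        by (intro exI[of _ 0] bexI[of _ h] bexI[of _ \<one>]) (auto intro: generate.incl)
    qed
  next
    case (inv h)
    then consider "h = b i" | "h \<in> b ` F" by blast
    then show ?case
    proof cases
      case 1
      then show ?thesis using F b
        by (intro exI[of _ "-1"] bexI[of _ \<one>]) (auto intro: generate.one simp: int_pow_neg)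
    next
      case 2
      then show ?thesis using F b
        by (intro exI[of _ 0] bexI[of _ "inv h"] bexI[of _ \<one>]) (auto intro: generate.inv)
    qed
  next
    case (eng g g')
    then obtain k k' :: int and h h' d d' where
      g: "h \<in> generate G (b ` F)" "d \<in> D" "g = b i [^] k \<otimes> h \<otimes> d" and
      g': "h' \<in> generate G (b ` F)" "d' \<in> D" "g' = b i [^] k' \<otimes> h' \<otimes> d'" by blast
    have FJ: "F \<subseteq> J" and iJ: "i \<in> J" using F by auto
    note hM = gM[OF FJ g(1)] gM[OF FJ g'(1)]
    let ?p = "b i [^] k" and ?p' = "b i [^] k'"
    have p: "?p \<in> M" "?p' \<in> M" using b[OF iJ] by auto
    obtain d'' where d'': "d'' \<in> D" "h \<otimes> ?p' = ?p' \<otimes> h \<otimes> d''" using comm[OF hM(1) p(2)] by blast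
    have "g \<otimes> g' = ?p \<otimes> h \<otimes> (d \<otimes> (?p' \<otimes> h' \<otimes> d'))"
      using g g' hM p by (simp add: m_assoc)
    also have "d \<otimes> (?p' \<otimes> h' \<otimes> d') = (?p' \<otimes> h' \<otimes> d') \<otimes> d"
      by (rule central) (use g g' hM p in auto)
    also have "?p \<otimes> h \<otimes> ((?p' \<otimes> h' \<otimes> d') \<otimes> d) = ?p \<otimes> (h \<otimes> ?p') \<otimes> (h' \<otimes> (d' \<otimes> d))"
      using g g' hM p by (simp add: m_assoc)
    also have "\<dots> = ?p \<otimes> ?p' \<otimes> h \<otimes> (d'' \<otimes> h') \<otimes> (d' \<otimes> d)"
      unfolding d''(2) using g g' hM p d'' by (simp add: m_assoc)
    also have "d'' \<otimes> h' = h' \<otimes> d''" by (rule central) (use d'' hM in auto)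
    also have "?p \<otimes> ?p' \<otimes> h \<otimes> (h' \<otimes> d'') \<otimes> (d' \<otimes> d) = b i [^] (k + k') \<otimes> (h \<otimes> h') \<otimes> (d'' \<otimes> (d' \<otimes> d))"
      using g g' hM p d'' b[OF iJ] by (simp add: m_assoc int_pow_mult)
    finally show ?case
      using generate.eng[OF g(1) g'(1)] g g' d'' by (meson Dm)
  qed
  obtain F where F: "finite F" "F \<subseteq> J" "n \<in> generate G (b ` F)"
    using generate_finite[OF _ n] b MG by blast
  have "F \<subseteq> J \<Longrightarrow> n \<in> generate G (b ` F) \<Longrightarrow> (\<And>j. j \<in> F \<Longrightarrow> \<epsilon> n j = 0) \<Longrightarrow> n \<in> D" for n
    using F(1)
  proof (induction F arbitrary: n)
    case empty
    then show ?case using generate_empty by simp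
  next
    case (insert i F)
    then obtain k :: int and h d where n: "h \<in> generate G (b ` F)" "d \<in> D" "n = b i [^] k \<otimes> h \<otimes> d"
      using split[OF insert.prems(1,2)] by blast
    have FJ: "F \<subseteq> J" and iJ: "i \<in> J" using insert.prems by auto
    have hM: "h \<in> M" by (rule gM[OF FJ n(1)])
    have ej: "\<epsilon> n j = k * \<epsilon> (b i) j + \<epsilon> h j" for j
      unfolding n(3) using hM n(2) b[OF iJ] by (simp add: add zero ep)
    \<comment> \<open>The coordinate at \<open>i\<close> sees only the exponent \<open>k\<close>,
      because \<open>h\<close> is generated by the other \<open>b j\<close>.\<close>
    have k0: "k = 0"
      using ej[of i] insert.prems(3)[of i] gz[OF FJ iJ insert.hyps(2) n(1)] basis[OF iJ iJ] by simp
    have "h \<in> D"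
      by (rule insert.IH[OF FJ n(1)]) (use ej insert.prems(3) k0 in auto)
    then show ?case using n(2,3) k0 by simp
  qed
  from this[OF F(2,3)] show ?thesis using n0 F(2) by blast
qed

abbreviation comm :: "'a \<Rightarrow> 'a \<Rightarrow> 'a" where
  "comm a b \<equiv> a \<otimes> b \<otimes> inv a \<otimes> inv b"

lemma comm_unique:
  assumes "a \<in> carrier G" "b \<in> carrier G" "z \<in> carrier G" "a \<otimes> b = z \<otimes> (b \<otimes> a)"
  shows "comm a b = z"
proof -
  have "comm a b = a \<otimes> b \<otimes> inv (b \<otimes> a)" using assms(1,2) by (simp add: inv_mult_group m_assoc)
  then show ?thesis using assms by (simp add: m_assoc)
qed

lemma comm_swap: "a \<in> carrier G \<Longrightarrow> b \<in> carrier G \<Longrightarrow> a \<otimes> b = comm a b \<otimes> (b \<otimes> a)"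
  by (simp add: m_assoc inv_solve_left inv_solve_left')

lemma comm_inv: "a \<in> carrier G \<Longrightarrow> b \<in> carrier G \<Longrightarrow> comm b a = inv (comm a b)"
  by (simp add: inv_mult_group m_assoc)

end

section \<open>Commutators in groups of class two\<close>

locale class_two_group = group G for G (structure) +
  assumes class_two: "class_two G"
begin

lemma comm_central:
  "a \<in> carrier G \<Longrightarrow> b \<in> carrier G \<Longrightarrow> c \<in> carrier G \<Longrightarrow> comm a b \<otimes> c = c \<otimes> comm a b"
  using class_two unfolding class_two_def by blast

lemma comm_mult_right:
  assumes a: "a \<in> carrier G" and b: "b \<in> carrier G" and c: "c \<in> carrier G"
  shows "comm a (b \<otimes> c) = comm a b \<otimes> comm a c"
proof (rule comm_unique)
  have "a \<otimes> (b \<otimes> c) = (a \<otimes> b) \<otimes> c" using assms by (simp add: m_assoc)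
  also have "\<dots> = (comm a b \<otimes> (b \<otimes> a)) \<otimes> c" using comm_swap[OF a b] by simp
  also have "\<dots> = comm a b \<otimes> (b \<otimes> (a \<otimes> c))" using assms by (simp add: m_assoc)
  also have "\<dots> = comm a b \<otimes> (b \<otimes> (comm a c \<otimes> (c \<otimes> a)))" using comm_swap[OF a c] by simp
  also have "\<dots> = comm a b \<otimes> ((b \<otimes> comm a c) \<otimes> (c \<otimes> a))" using assms by (simp add: m_assoc)
  also have "b \<otimes> comm a c = comm a c \<otimes> b" using comm_central[OF a c b] by simp
  also have "comm a b \<otimes> ((comm a c \<otimes> b) \<otimes> (c \<otimes> a)) = comm a b \<otimes> comm a c \<otimes> (b \<otimes> c \<otimes> a)"
    using assms by (simp add: m_assoc)
  finally show "a \<otimes> (b \<otimes> c) = comm a b \<otimes> comm a c \<otimes> (b \<otimes> c \<otimes> a)" .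
qed (use assms in auto)

lemma comm_one_right: "a \<in> carrier G \<Longrightarrow> comm a \<one> = \<one>"
  by simp

lemma comm_inv_right:
  assumes a: "a \<in> carrier G" and b: "b \<in> carrier G"
  shows "comm a (inv b) = inv (comm a b)"
proof -
  have "comm a b \<otimes> comm a (inv b) = \<one>"
    using comm_mult_right[OF a b inv_closed[OF b]] a b by simp
  then show ?thesis using a b inv_equality[of "comm a (inv b)" "comm a b"] inv_comm[of "comm a b"] by simp
qed

text \<open>Commutators are multiplicative in the second argument, so their values on generators
  suffice.\<close>

lemma comm_in_subgroup:
  assumes T: "subgroup T G" and a: "a \<in> carrier G" and y: "y ` S \<subseteq> carrier G"
    and basis: "\<And>s. s \<in> S \<Longrightarrow> comm a (y s) \<in> T" and n: "n \<in> generate G (y ` S)"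
  shows "comm a n \<in> T"
  using n
proof (induction rule: generate.induct)
  case one
  show ?case using comm_one_right[OF a] subgroup.one_closed[OF T] by simp
next
  case (incl h)
  then show ?case using basis by auto
next
  case (inv h)
  then show ?case using basis y comm_inv_right[OF a] subgroup.m_inv_closed[OF T] by auto
next
  case (eng g h)
  then show ?case
    using comm_mult_right[OF a] generate_in_carrier[OF y] subgroup.m_closed[OF T] by metis
qed

lemma derived_central:
  assumes "d \<in> derived G (carrier G)" "c \<in> carrier G"
  shows "d \<otimes> c = c \<otimes> d"
  using assms(1) unfolding derived_def
proof (induction rule: generate.induct)
  case (incl h)
  then show ?case using comm_central[OF _ _ assms(2)] by auto
next
  case (inv h)
  then obtain a b where ab: "a \<in> carrier G" "b \<in> carrier G" "h = comm a b" by auto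
  have "inv h = comm b a" using comm_inv[OF ab(1,2)] ab by simp
  then show ?case using comm_central[OF ab(2,1) assms(2)] by simp
next
  case (eng g h)
  have "(\<Union>h\<in>carrier G. \<Union>k\<in>carrier G. {h \<otimes> k \<otimes> inv h \<otimes> inv k}) \<subseteq> carrier G" by auto
  then have gh: "g \<in> carrier G" "h \<in> carrier G" using eng generate_in_carrier by blast+
  have "g \<otimes> h \<otimes> c = g \<otimes> (c \<otimes> h)" using gh eng assms(2) by (simp add: m_assoc)
  also have "\<dots> = c \<otimes> g \<otimes> h" using gh eng assms(2) by (simp add: m_assoc[symmetric])
  finally show ?case using gh assms(2) by (simp add: m_assoc)
qed (use assms(2) in simp)

text \<open>Vanishing of \<open>e\<close> puts \<open>n\<close> into the derived subgroup. There
  \<open>q\<close> becomes additive, and commutators of pairs of generators, which \<open>q\<close>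
  tells apart, generate this subgroup.\<close>

lemma coordinates_faithful:
  fixes y :: "'s \<Rightarrow> 'a" and e :: "'a \<Rightarrow> 's \<Rightarrow> int" and q :: "'a \<Rightarrow> 's \<Rightarrow> 's \<Rightarrow> int"
  assumes y: "y ` S \<subseteq> carrier G" and gen: "carrier G \<subseteq> generate G (y ` S)"
    and e_mult: "\<And>m n i. m \<in> carrier G \<Longrightarrow> n \<in> carrier G \<Longrightarrow> e (m \<otimes> n) i = e m i + e n i"
    and q_mult: "\<And>m n i j. m \<in> carrier G \<Longrightarrow> n \<in> carrier G \<Longrightarrow>
      q (m \<otimes> n) i j = q m i j + q n i j + e m i * e n j"
    and e_y: "\<And>s j. s \<in> S \<Longrightarrow> e (y s) j = (if s = j then 1 else 0)"
    and q_y: "\<And>s i j. s \<in> S \<Longrightarrow> q (y s) i j = 0"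
    and n: "n \<in> carrier G" and e0: "\<And>i. e n i = 0" and q0: "\<And>i j. q n i j = 0"
  shows "n = \<one>"
proof -
  define D where "D = derived G (carrier G)"
  have D: "subgroup D G" unfolding D_def by (rule derived_is_subgroup) simp
  have DG: "D \<subseteq> carrier G" using D by (rule subgroup.subset)
  have commD: "comm a b \<in> D" if "a \<in> carrier G" "b \<in> carrier G" for a b
    unfolding D_def derived_def by (rule generate.incl) (use that in auto)
  have e1: "e \<one> i = 0" for i using e_mult[of \<one> \<one> i] by simp
  have q1: "q \<one> i j = 0" for i j using q_mult[of \<one> \<one> i j] e1 by simp
  have ei: "e (inv m) i = - e m i" if "m \<in> carrier G" for m i
    using e_mult[of m "inv m" i] that e1 by simp
  have qi: "q (inv m) i j = - q m i j + e m i * e m j" if "m \<in> carrier G" for m i j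
    using q_mult[of m "inv m" i j] that q1 ei by simp
  have eD: "e d i = 0" if "d \<in> D" for d i
    using that unfolding D_def derived_def
  proof (induction rule: generate.induct)
    case (eng g h)
    have "(\<Union>h\<in>carrier G. \<Union>k\<in>carrier G. {h \<otimes> k \<otimes> inv h \<otimes> inv k}) \<subseteq> carrier G" by auto
    then have "g \<in> carrier G" "h \<in> carrier G" using eng generate_in_carrier by blast+
    then show ?case using eng by (simp add: e_mult)
  qed (auto simp: e1 e_mult ei)
  have nD: "n \<in> D"
  proof (rule coordinates_detect[where M = "carrier G" and J = S and b = y and \<epsilon> = e])
    show "subgroup (carrier G) G" by (rule subgroup_self)
    show "\<exists>d\<in>D. a \<otimes> c = c \<otimes> a \<otimes> d" if ac: "a \<in> carrier G" "c \<in> carrier G" for a c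
      using comm_swap[OF ac] comm_central[OF ac, of "c \<otimes> a"] commD[OF ac] ac by auto
    show "d \<otimes> m = m \<otimes> d" if "d \<in> D" "m \<in> carrier G" for d m
      using derived_central that by (simp add: D_def)
  qed (use D DG y gen e_mult eD e_y n e0 in auto)
  \<comment> \<open>Swapping the arguments inverts a commutator, so one order of each pair is
    selected to obtain an independent family; a well-order makes the choice.\<close>
  obtain r where r: "well_order_on S r" using well_order_on by blast
  define J where "J = {(s, t). (s, t) \<in> r \<and> s \<noteq> t \<and> s \<in> S \<and> t \<in> S}"
  have J_anti: "(t, s) \<notin> J" if "(s, t) \<in> J" for s t
    using that r by (auto simp: J_def well_order_on_def linear_order_on_def partial_order_on_def antisym_def)
  have J_total: "(s, t) \<in> J \<or> (t, s) \<in> J" if "s \<in> S" "t \<in> S" "s \<noteq> t" for s t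
    using that r by (auto simp: J_def well_order_on_def linear_order_on_def total_on_def)
  define b where "b = (\<lambda>(s, t). comm (y s) (y t))"
  define T where "T = generate G (b ` J)"
  have yS: "y s \<in> carrier G" if "s \<in> S" for s using that y by blast
  have bD: "b j \<in> D" if "j \<in> J" for j
    using that commD yS by (auto simp: b_def J_def)
  have T: "subgroup T G" unfolding T_def by (rule generate_is_subgroup) (use bD DG in blast)
  have yy: "comm (y s) (y t) \<in> T" if st: "s \<in> S" "t \<in> S" for s t
  proof -
    have J: "comm (y s) (y t) \<in> T" if "(s, t) \<in> J" for s t
      unfolding T_def by (rule generate.incl) (use that in \<open>auto simp: b_def intro!: image_eqI[of _ _ "(s, t)"]\<close>)
    show ?thesis
    proof (cases "s = t")
      case True
      then show ?thesis using subgroup.one_closed[OF T] yS[OF st(2)] by (simp add: m_assoc)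
    next
      case False
      then consider "(s, t) \<in> J" | "(t, s) \<in> J" using J_total st by blast
      then show ?thesis
      proof cases
        case 2
        then show ?thesis
          using subgroup.m_inv_closed[OF T J[OF 2]] comm_inv[OF yS[OF st(2)] yS[OF st(1)]] by simp
      qed (rule J)
    qed
  qed
  have "comm a c \<in> T" if a: "a \<in> carrier G" and c: "c \<in> carrier G" for a c
  proof -
    have *: "comm (y s) c \<in> T" if "s \<in> S" for s
      by (rule comm_in_subgroup[OF T yS[OF that] y _ subsetD[OF gen c]]) (use yy that in auto)
    have "comm c (y s) \<in> T" if s: "s \<in> S" for s
      using subgroup.m_inv_closed[OF T *[OF s]] comm_inv[OF yS[OF s] c] by simp
    then have "comm c a \<in> T"
      by (rule comm_in_subgroup[OF T c y _ subsetD[OF gen a]])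
    then show ?thesis using subgroup.m_inv_closed[OF T] comm_inv[OF c a] by simp
  qed
  then have "D \<subseteq> T"
    unfolding D_def derived_def by (intro generate_subgroup_incl[OF _ T]) auto
  then have nT: "n \<in> generate G (b ` J)" using nD by (auto simp: T_def)
  have "n \<in> {\<one>}"
  proof (rule coordinates_detect[where M = D and J = J and b = b and \<epsilon> = "\<lambda>m (i, j). q m i j"])
    show "subgroup {\<one>} G" by (rule triv_subgroup)
    show "{\<one>} \<subseteq> D" using subgroup.one_closed[OF D] by simp
    show "d \<otimes> m = m \<otimes> d" if "d \<in> {\<one>}" "m \<in> D" for d m using that DG by auto
    show "\<exists>d\<in>{\<one>}. a \<otimes> c = c \<otimes> a \<otimes> d" if "a \<in> D" "c \<in> D" for a c
    proof -
      have "a \<in> carrier G" "c \<in> carrier G" using that DG by auto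
      moreover have "a \<otimes> c = c \<otimes> a" using derived_central[of a c] that DG by (auto simp: D_def)
      ultimately show ?thesis by simp
    qed
    show "(case j of (i, k) \<Rightarrow> q (m \<otimes> n) i k) = (case j of (i, k) \<Rightarrow> q m i k) + (case j of (i, k) \<Rightarrow> q n i k)"
      if "m \<in> D" "n \<in> D" for m n j
    proof -
      have "m \<in> carrier G" "n \<in> carrier G" using that DG by auto
      then show ?thesis using eD that by (cases j) (simp add: q_mult)
    qed
    show "(case j of (i, k) \<Rightarrow> q (b i') i k) = (if i' = j then 1 else 0)" if ij: "i' \<in> J" "j \<in> J" for i' j
    proof -
      obtain s t u v where st: "i' = (s, t)" "j = (u, v)" by (cases i'; cases j)
      then have S: "s \<in> S" "t \<in> S" "u \<in> S" "v \<in> S" "s \<noteq> t" "u \<noteq> v" using ij by (auto simp: J_def)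
      \<comment> \<open>At the reversed pair the coordinate would be -1 instead of 0.\<close>
      have "\<not> (s = v \<and> t = u)" using ij st J_anti by blast
      then show ?thesis
        using S yS by (auto simp: st b_def q_mult e_mult ei qi e_y q_y)
    qed
  qed (use D bD q1 nT q0 in auto)
  then show ?thesis by simp
qed

end


text \<open>Images of commutators are central in the target, so a further commutator with them
  becomes trivial.\<close>

lemma hom_trivial_on_gamma3:
  assumes G: "group G" and H: "group H" "class_two H" and h: "h \<in> hom G H"
    and k: "k \<in> commutator_subgroup G (carrier G) (commutator_subgroup G (carrier G) (carrier G))"
  shows "h k = \<one>\<^bsub>H\<^esub>"
proof -
  interpret G: group G by fact
  interpret H: class_two_group H
    by (intro class_two_group.intro class_two_group_axioms.intro H)
  interpret h: group_hom G H h by unfold_locales (rule h)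
  let ?D = "commutator_subgroup G (carrier G) (carrier G)"
  have D: "?D = derived G (carrier G)" by (rule commutator_subgroup_self)
  have DG: "?D \<subseteq> carrier G" unfolding D by (rule G.derived_in_carrier) simp
  have central: "h z \<otimes>\<^bsub>H\<^esub> c = c \<otimes>\<^bsub>H\<^esub> h z" if z: "z \<in> ?D" and c: "c \<in> carrier H" for z c
  proof (rule H.derived_central[OF _ c])
    have "h z \<in> derived H (h ` carrier G)" using z h.derived_img[of "carrier G"] by (simp add: D)
    moreover have "h ` carrier G \<subseteq> carrier H" using h.hom_closed by blast
    ultimately show "h z \<in> derived H (carrier H)" using H.mono_derived by blast
  qed
  have base: "h (y \<otimes>\<^bsub>G\<^esub> z \<otimes>\<^bsub>G\<^esub> inv\<^bsub>G\<^esub> y \<otimes>\<^bsub>G\<^esub> inv\<^bsub>G\<^esub> z) = \<one>\<^bsub>H\<^esub>" if y: "y \<in> carrier G" and z: "z \<in> ?D" for y z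
  proof -
    have zG: "z \<in> carrier G" using z DG by blast
    have "h y \<otimes>\<^bsub>H\<^esub> h z \<otimes>\<^bsub>H\<^esub> inv\<^bsub>H\<^esub> h y \<otimes>\<^bsub>H\<^esub> inv\<^bsub>H\<^esub> h z = \<one>\<^bsub>H\<^esub>"
      by (rule H.comm_unique) (use central[OF z, of "h y"] y zG in auto)
    then show ?thesis using y zG by simp
  qed
  have sub: "(\<Union>y\<in>carrier G. \<Union>z\<in>?D. {y \<otimes>\<^bsub>G\<^esub> z \<otimes>\<^bsub>G\<^esub> inv\<^bsub>G\<^esub> y \<otimes>\<^bsub>G\<^esub> inv\<^bsub>G\<^esub> z}) \<subseteq> carrier G"
    using DG by auto
  show ?thesis
    using k unfolding commutator_subgroup_def[of G "carrier G" ?D]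
  proof (induction rule: generate.induct)
    case (incl k)
    then show ?case using base by blast
  next
    case (inv k)
    then have "h k = \<one>\<^bsub>H\<^esub>" "k \<in> carrier G" using base sub by blast+
    then show ?case by simp
  next
    case (eng k l)
    then show ?case using G.generate_in_carrier[OF sub] by simp
  qed simp
qed

section \<open>The universal property among groups of class two\<close>

locale gamma3_quotient =
  fixes S :: "'s set"
begin

abbreviation F where "F \<equiv> free_group S"

definition K where "K = commutator_subgroup F (carrier F) (commutator_subgroup F (carrier F) (carrier F))"

abbreviation P where "P \<equiv> free_two_step_nilpotent_group S"

definition gen :: "'s \<Rightarrow> 's letter list set" where "gen s = K #>\<^bsub>F\<^esub> free_gen s"

sublocale F: group F by (rule group_free_group)

sublocale P: group P by (rule group_free_two_step_nilpotent_group)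

lemma P_def: "P = F Mod K"
  by (simp add: free_two_step_nilpotent_group_def Let_def K_def)

lemma K_normal: "K \<lhd> F"
  unfolding K_def by (intro F.normal_commutator_subgroup F.carrier_normal)

sublocale K: normal K F by (rule K_normal)

sublocale p: group_hom F P "\<lambda>a. K #>\<^bsub>F\<^esub> a"
  by unfold_locales (use K.r_coset_hom_Mod in \<open>simp add: P_def\<close>)

lemma P_carrier: "carrier P = (\<lambda>a. K #>\<^bsub>F\<^esub> a) ` carrier F"
  by (simp add: P_def carrier_FactGroup)

lemma coset_K: "k \<in> K \<Longrightarrow> K #>\<^bsub>F\<^esub> k = \<one>\<^bsub>P\<^esub>"
  using F.coset_join2[OF _ K.subgroup_axioms] K.subset by (auto simp: P_def)

lemma gen_closed: "gen ` S \<subseteq> carrier P"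
  by (auto simp: gen_def P_carrier intro!: imageI free_gen_closed)

lemma generate_gen: "generate P (gen ` S) = carrier P"
proof -
  have "free_gen ` S \<subseteq> carrier F" using free_gen_closed by auto
  from p.generate_img[OF this] show ?thesis
    by (simp add: gen_def image_image generate_free_gen P_carrier)
qed

lemma class_two_P: "class_two P"
  unfolding class_two_def P_carrier
proof clarify
  fix x y w assume xyw: "x \<in> carrier F" "y \<in> carrier F" "w \<in> carrier F"
  let ?p = "\<lambda>a. K #>\<^bsub>F\<^esub> a"
  let ?z = "x \<otimes>\<^bsub>F\<^esub> y \<otimes>\<^bsub>F\<^esub> inv\<^bsub>F\<^esub> x \<otimes>\<^bsub>F\<^esub> inv\<^bsub>F\<^esub> y"
  have z: "?z \<in> carrier F" using xyw by simp
  have "?z \<in> commutator_subgroup F (carrier F) (carrier F)"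
    unfolding commutator_subgroup_def by (rule generate.incl) (use xyw in auto)
  then have "w \<otimes>\<^bsub>F\<^esub> ?z \<otimes>\<^bsub>F\<^esub> inv\<^bsub>F\<^esub> w \<otimes>\<^bsub>F\<^esub> inv\<^bsub>F\<^esub> ?z \<in> K"
    unfolding K_def commutator_subgroup_def[of F "carrier F" "commutator_subgroup F (carrier F) (carrier F)"]
    by (intro generate.incl) (use xyw in blast)
  from coset_K[OF this]
  have "?p w \<otimes>\<^bsub>P\<^esub> ?p ?z \<otimes>\<^bsub>P\<^esub> inv\<^bsub>P\<^esub> ?p w \<otimes>\<^bsub>P\<^esub> inv\<^bsub>P\<^esub> ?p ?z = \<one>\<^bsub>P\<^esub>"
    using xyw(3) z by (simp only: p.hom_mult p.hom_inv F.m_closed F.inv_closed)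
  then have "?p w \<otimes>\<^bsub>P\<^esub> ?p ?z = ?p ?z \<otimes>\<^bsub>P\<^esub> ?p w"
    using P.comm_swap[of "?p w" "?p ?z"] p.hom_closed[OF xyw(3)] p.hom_closed[OF z] by simp
  moreover have "?p ?z = ?p x \<otimes>\<^bsub>P\<^esub> ?p y \<otimes>\<^bsub>P\<^esub> inv\<^bsub>P\<^esub> ?p x \<otimes>\<^bsub>P\<^esub> inv\<^bsub>P\<^esub> ?p y"
    using xyw by (simp only: p.hom_mult p.hom_inv F.m_closed F.inv_closed)
  ultimately show "?p x \<otimes>\<^bsub>P\<^esub> ?p y \<otimes>\<^bsub>P\<^esub> inv\<^bsub>P\<^esub> ?p x \<otimes>\<^bsub>P\<^esub> inv\<^bsub>P\<^esub> ?p y \<otimes>\<^bsub>P\<^esub> ?p w =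
      ?p w \<otimes>\<^bsub>P\<^esub> (?p x \<otimes>\<^bsub>P\<^esub> ?p y \<otimes>\<^bsub>P\<^esub> inv\<^bsub>P\<^esub> ?p x \<otimes>\<^bsub>P\<^esub> inv\<^bsub>P\<^esub> ?p y)"
    by simp
qed

sublocale P: class_two_group P by unfold_locales (rule class_two_P)

text \<open>The extension of \<open>f\<close> to the free group kills \<open>K\<close>. Two targets
  matter: the coordinate group, which yields coordinates, and the group itself, which yields its
  endomorphisms.\<close>

lemma universal:
  assumes H: "group H" "class_two H" and f: "f \<in> S \<rightarrow> carrier H"
  obtains g where "g \<in> hom P H" "\<And>s. s \<in> S \<Longrightarrow> g (gen s) = f s"
proof -
  obtain h where h: "h \<in> hom F H" "\<And>s. s \<in> S \<Longrightarrow> h (free_gen s) = f s"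
    using free_group_extend[OF H(1) f] by blast
  interpret h: group_hom F H h
    by (intro group_hom.intro group_hom_axioms.intro F.is_group H(1) h(1))
  have "K \<subseteq> kernel F H h"
    using hom_trivial_on_gamma3[OF F.is_group H h(1)] K.subset by (auto simp: kernel_def K_def)
  then obtain g where g: "g \<in> hom (F Mod K) H" "\<And>a. a \<in> carrier F \<Longrightarrow> g (K #>\<^bsub>F\<^esub> a) = h a"
    using h.FactGroup_universal_kernel[OF K_normal] by blast
  have "g (gen s) = f s" if "s \<in> S" for s
    using g(2)[OF free_gen_closed[OF that]] h(2)[OF that] by (simp add: gen_def)
  then show thesis using that[of g] g(1) by (simp add: P_def)
qed

end

theorem theorem5p1:
  fixes S :: "'a set" and N :: "('b, 'c) monoid_scheme"
  assumes "infinite S"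
    and "group N"
    and "N \<cong> free_two_step_nilpotent_group S"
  shows "complete_group (AutoGroup N)"
proof -
  interpret Q: gamma3_quotient S .
  interpret N: group N by fact
  obtain \<iota> where \<iota>: "\<iota> \<in> iso N Q.P" using assms(3) by (auto simp: is_iso_def)
  define \<kappa> where "\<kappa> = inv_into (carrier N) \<iota>"
  have \<kappa>: "\<kappa> \<in> iso Q.P N" unfolding \<kappa>_def by (rule N.iso_set_sym[OF \<iota>])
  have bij: "bij_betw \<iota> (carrier N) (carrier Q.P)" using \<iota> by (simp add: iso_def)
  interpret i: group_hom N Q.P \<iota>
    by (intro group_hom.intro group_hom_axioms.intro N.is_group Q.P.is_group) (use \<iota> in \<open>simp add: iso_def\<close>)
  interpret k: group_hom Q.P N \<kappa>
    by (intro group_hom.intro group_hom_axioms.intro N.is_group Q.P.is_group) (use \<kappa> in \<open>simp add: iso_def\<close>)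
  have ik: "\<iota> (\<kappa> c) = c" if "c \<in> carrier Q.P" for c
    using bij that by (simp add: \<kappa>_def bij_betw_inv_into_right)
  have ki: "\<kappa> (\<iota> n) = n" if "n \<in> carrier N" for n
    using bij that by (simp add: \<kappa>_def bij_betw_inv_into_left)
  have gen: "Q.gen s \<in> carrier Q.P" if "s \<in> S" for s using Q.gen_closed that by blast
  \<comment> \<open>The truncated Magnus expansion, characterised by its values on the
    generators.\<close>
  obtain \<mu> where \<mu>: "\<mu> \<in> hom Q.P coordinate_group"
    "\<And>s. s \<in> S \<Longrightarrow> \<mu> (Q.gen s) = (\<lambda>j. if s = j then 1 else 0, \<lambda>i j. 0)"
    by (rule Q.universal[OF group_coordinate_group class_two_coordinate_group,
          of "\<lambda>s. (\<lambda>j. if s = j then 1 else 0, \<lambda>i j. 0)"]) (auto simp: coordinate_group_def)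
  interpret m: group_hom Q.P coordinate_group \<mu>
    by (intro group_hom.intro group_hom_axioms.intro Q.P.is_group group_coordinate_group \<mu>(1))
  have e_mult: "fst (\<mu> (c \<otimes>\<^bsub>Q.P\<^esub> d)) i = fst (\<mu> c) i + fst (\<mu> d) i"
    and q_mult: "snd (\<mu> (c \<otimes>\<^bsub>Q.P\<^esub> d)) i j = snd (\<mu> c) i j + snd (\<mu> d) i j + fst (\<mu> c) i * fst (\<mu> d) j"
    if "c \<in> carrier Q.P" "d \<in> carrier Q.P" for c d i j
    using that by (simp_all add: coordinate_group_def split_beta)
  have faithful: "c = \<one>\<^bsub>Q.P\<^esub>" if c: "c \<in> carrier Q.P" and 1: "\<mu> c = \<one>\<^bsub>coordinate_group\<^esub>" for c
  proof (rule Q.P.coordinates_faithful[where S = S and y = Q.gen and e = "\<lambda>c. fst (\<mu> c)" and q = "\<lambda>c. snd (\<mu> c)"])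
    show "carrier Q.P \<subseteq> generate Q.P (Q.gen ` S)" using Q.generate_gen by simp
    show "fst (\<mu> c) i = 0" "snd (\<mu> c) i j = 0" for i j using 1 by (simp_all add: coordinate_group_def)
  qed (use Q.gen_closed e_mult q_mult \<mu>(2) c in simp_all)
  interpret C: free_class_two N S "\<lambda>s. \<kappa> (Q.gen s)" "\<lambda>n. fst (\<mu> (\<iota> n))" "\<lambda>n. snd (\<mu> (\<iota> n))"
  proof
    show "infinite S" by fact
    show "\<kappa> (Q.gen s) \<in> carrier N" if "s \<in> S" for s using gen[OF that] by simp
    have "generate N (\<kappa> ` Q.gen ` S) = \<kappa> ` carrier Q.P"
      using k.generate_img[OF Q.gen_closed] Q.generate_gen by simp
    moreover have "carrier N \<subseteq> \<kappa> ` carrier Q.P" using ki i.hom_closed by (metis image_eqI subsetI)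
    ultimately show "carrier N \<subseteq> generate N ((\<lambda>s. \<kappa> (Q.gen s)) ` S)" by (simp add: image_image)
    fix m n assume mn: "m \<in> carrier N" "n \<in> carrier N"
    show "fst (\<mu> (\<iota> (m \<otimes>\<^bsub>N\<^esub> n))) i = fst (\<mu> (\<iota> m)) i + fst (\<mu> (\<iota> n)) i" for i
      using e_mult[of "\<iota> m" "\<iota> n"] mn by simp
    show "snd (\<mu> (\<iota> (m \<otimes>\<^bsub>N\<^esub> n))) i j =
        snd (\<mu> (\<iota> m)) i j + snd (\<mu> (\<iota> n)) i j + fst (\<mu> (\<iota> m)) i * fst (\<mu> (\<iota> n)) j" for i j
      using q_mult[of "\<iota> m" "\<iota> n"] mn by simp
    assume "\<And>i. fst (\<mu> (\<iota> m)) i = fst (\<mu> (\<iota> n)) i" "\<And>i j. snd (\<mu> (\<iota> m)) i j = snd (\<mu> (\<iota> n)) i j"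
    then have eq: "\<mu> (\<iota> m) = \<mu> (\<iota> n)" by (intro prod_eqI ext) auto
    let ?c = "\<iota> m \<otimes>\<^bsub>Q.P\<^esub> inv\<^bsub>Q.P\<^esub> \<iota> n"
    have "?c = \<one>\<^bsub>Q.P\<^esub>"
      by (rule faithful) (use eq mn m.H.r_inv[of "\<mu> (\<iota> n)"] in \<open>simp_all add: m.hom_closed\<close>)
    then have "\<iota> m = \<iota> n" using mn Q.P.inv_equality Q.P.r_cancel_one' by (metis Q.P.inv_inv Q.P.inv_closed i.hom_closed)
    then show "m = n" using ki mn by metis
  next
    fix s assume s: "s \<in> S"
    show "fst (\<mu> (\<iota> (\<kappa> (Q.gen s)))) j = (if s = j then 1 else 0)" for j
      using ik[OF gen[OF s]] \<mu>(2)[OF s] by simp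
    show "snd (\<mu> (\<iota> (\<kappa> (Q.gen s)))) j k = 0" for j k
      using ik[OF gen[OF s]] \<mu>(2)[OF s] by simp
  next
    fix f assume f: "f \<in> S \<rightarrow> carrier N"
    obtain g where g: "g \<in> hom Q.P Q.P" "\<And>s. s \<in> S \<Longrightarrow> g (Q.gen s) = \<iota> (f s)"
      by (rule Q.universal[OF Q.P.is_group Q.class_two_P, of "\<lambda>s. \<iota> (f s)"])
        (use f in \<open>auto simp: Pi_iff\<close>)
    interpret g: group_hom Q.P Q.P g
      by (intro group_hom.intro group_hom_axioms.intro Q.P.is_group g(1))
    have "(\<lambda>n. \<kappa> (g (\<iota> n))) \<in> hom N N" by (rule homI) auto
    moreover have "\<kappa> (g (\<iota> (\<kappa> (Q.gen s)))) = f s" if s: "s \<in> S" for s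
      using ik[OF gen[OF s]] g(2)[OF s] ki[of "f s"] f s by auto
    ultimately show "\<exists>h\<in>hom N N. \<forall>s\<in>S. h (\<kappa> (Q.gen s)) = f s"
      by (intro bexI[of _ "\<lambda>n. \<kappa> (g (\<iota> n))"]) auto
  qed
  show ?thesis by (rule C.complete)
qed

end
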